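(* Let $\Omega\subset\mathbb{R}^d$ be bounded with Lipschitz and in fact $C^\infty$ boundary, let $k$ be a continuous strictly positive definite kernel on $\Omega$ with $k(x,x)\le 1$ for all $x\in\Omega$, and assume that $k$ is well defined on the closure $\bar\Omega$ and that the extension $Ef\in\mathcal H_k(\bar\Omega)$ of any $f\in\mathcal H_k(\Omega)$ satisfies $\|Ef\|_{\mathcal H_k(\bar\Omega)}=\|f\|_{\mathcal H_k(\Omega)}$. Let $\tau>d/2$ and assume that $\mathcal H_k(\Omega)$ is continuously embedded into the Sobolev space $W_2^\tau(\Omega)$. Then there is a constant $C>0$ with $\varepsilon_n(\mathrm{co}(\Phi(\Omega)),\mathcal H_k(\Omega))\le Cn^{-\tau/d}$ for all $n\ge1$, and, for any such $C$, any $\beta\in[0,\infty]$, any admissible $\gamma\in(0,1]$ and any $f\in\mathcal H_k(\Omega)$, any weak $\beta$-greedy algorithm with parameter $\gamma$ applied to $f$ satisfies $$\min_{n+1\le i\le 2n}\|f-I_{X_i}f\|_{L_\infty(\Omega)}\le c\,\gamma^{-1}\left(n^{-\frac\tau d+\frac{1-\beta}2}\right)^{\frac{1}{\max(1,\beta)}}\|f-I_{X_{n+1}}f\|_{\mathcal H_k(\Omega)},\qquad n\in\mathbb N,\ n\ge1,$$ where $c:=(C\sqrt5)^{\frac1{\max(1,\beta)}}$, and for $\beta=\infty$ one reads $c=1$ and $\left(n^{-\frac\tau d+\frac{1-\beta}2}\right)^{1/\max(1,\beta)}$ as its limit $n^{-1/2}$.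
   Context: Kernel interpolation. $k$ is a real-valued kernel and $\mathcal H_k(\Omega)$ is its Reproducing Kernel Hilbert Space on $\Omega$. For a finite set $X\subset\Omega$ of pairwise distinct points, $V(X):=\mathrm{span}\{k(\cdot,x):x\in X\}$ and $I_Xf\in V(X)$ is the unique function in $V(X)$ that interpolates $f$ at $X$ (for $f\in\mathcal H_k(\Omega)$ it is the orthogonal projection of $f$ onto $V(X)$; $I_\emptyset f=0$). The power function is $P_X(x):=\|k(\cdot,x)-\Pi_{V(X)}k(\cdot,x)\|_{\mathcal H_k(\Omega)}$, with $\Pi_V$ the orthogonal projection onto $V$. "$k$ is well defined on $\bar\Omega$" means that $k$ can be evaluated on $\bar\Omega$ and is continuous and strictly positive definite there. $\Phi(\Omega):=\{k(\cdot,x):x\in\Omega\}$. Weak $\beta$-greedy algorithm. Let $X_0:=\emptyset$, $X_{n+1}:=X_n\cup\{x_{n+1}\}$. For $\beta\in[0,\infty)$ put $\eta_\beta(f,X_n)(x):=|(f-I_{X_n}f)(x)|^\beta P_{X_n}(x)^{1-\beta}$, and $\eta_\infty(f,X_n)(x):=|(f-I_{X_n}f)(x)|/P_{X_n}(x)$. A weak $\beta$-greedy algorithm with parameter $\gamma$ applied to $f$ produces any sequence of points such that for all $n\ge0$, $x_{n+1}\in\Omega\setminus X_n$ and $\eta_\beta(f,X_n)(x_{n+1})\ge\gamma\sup_{z\in\Omega\setminus X_n}\eta_\beta(f,X_n)(z)$. Admissible $\gamma$ means $\gamma\in(0,1)$ if $\Omega$ is open and $\gamma\in(0,1]$ if $\Omega$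 is closed. Entropy numbers. For a subset $K$ of a Hilbert space $\mathcal H$: $\mathrm{co}(K):=\mathrm{clos}_{\mathcal H}\{\sum_i c_ig_i: g_i\in K,\ \sum_i|c_i|\le1\}$ (finite sums), and $\varepsilon_n(K,\mathcal H)$ is the infimum of all $\varepsilon>0$ such that $K$ can be covered by at most $2^n$ balls of radius $\varepsilon$ with centers in $\mathcal H$. $W_2^\tau(\Omega)$ is the $L_2$-based Sobolev space of (possibly fractional) order $\tau$. *)

theory Defs
  imports "HOL-Analysis.Analysis" "HOL-Probability.Essential_Supremum"
begin

primrec partials :: "'d list \<Rightarrow> (real^'d::finite \<Rightarrow> real) \<Rightarrow> real^'d \<Rightarrow> real" where
  "partials [] f = f"
| "partials (i # is) f = (\<lambda>x. frechet_derivative (partials is f) (at x) (axis i 1))"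

text \<open>Differentiability of all iterated partial derivatives contains their continuity, so on an
  open set this is \<open>C\<^sup>\<infinity>\<close>.\<close>

definition smooth_on :: "(real^'d::finite) set \<Rightarrow> (real^'d \<Rightarrow> real) \<Rightarrow> bool" where
  "smooth_on U f \<longleftrightarrow> (\<forall>is. \<forall>x\<in>U. partials is f differentiable (at x))"

text \<open>Near each boundary point the set is, in suitably rotated coordinates, the region above the
  graph of a function from the class \<open>G\<close>. The vector \<open>\<nu>\<close> is the direction of the vertical axis, and
  \<open>x - (x \<bullet> \<nu>) *\<^sub>R \<nu>\<close> is the horizontal part of \<open>x\<close>, so only the restriction of \<open>g\<close> to the hyperplane
  orthogonal to \<open>\<nu>\<close> matters. Interior and frontier are described separately so that the definition
  makes sense for open as well as for closed sets.\<close>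

definition graph_boundary :: "((real^'d::finite) \<Rightarrow> real) set \<Rightarrow> (real^'d) set \<Rightarrow> bool" where
  "graph_boundary G \<Omega> \<longleftrightarrow>
     (\<forall>p\<in>frontier \<Omega>. \<exists>r>0. \<exists>\<nu>. \<exists>g\<in>G. norm \<nu> = 1 \<and>
        interior \<Omega> \<inter> ball p r = {x\<in>ball p r. x \<bullet> \<nu> > g (x - (x \<bullet> \<nu>) *\<^sub>R \<nu>)} \<and>
        frontier \<Omega> \<inter> ball p r = {x\<in>ball p r. x \<bullet> \<nu> = g (x - (x \<bullet> \<nu>) *\<^sub>R \<nu>)})"

definition lipschitz_boundary :: "(real^'d::finite) set \<Rightarrow> bool" where
  "lipschitz_boundary \<Omega> \<longleftrightarrow> graph_boundary {g. \<exists>L. L-lipschitz_on UNIV g} \<Omega>"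

definition smooth_boundary :: "(real^'d::finite) set \<Rightarrow> bool" where
  "smooth_boundary \<Omega> \<longleftrightarrow> graph_boundary {g. smooth_on UNIV g} \<Omega>"

definition test_function :: "(real^'d::finite) set \<Rightarrow> (real^'d \<Rightarrow> real) \<Rightarrow> bool" where
  "test_function U \<phi> \<longleftrightarrow>
     smooth_on UNIV \<phi> \<and> compact (closure {x. \<phi> x \<noteq> 0}) \<and> closure {x. \<phi> x \<noteq> 0} \<subseteq> U"

text \<open>Multi-indices are functions \<open>'d \<Rightarrow> nat\<close>. The order of differentiation chosen here is
  irrelevant, as the operator is only applied to smooth functions.\<close>

definition multi_partial :: "('d \<Rightarrow> nat) \<Rightarrow> (real^'d::finite \<Rightarrow> real) \<Rightarrow> real^'d \<Rightarrow> real" where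
  "multi_partial \<alpha> \<phi> = partials (SOME is. \<forall>i. count_list is i = \<alpha> i) \<phi>"

definition multi_order :: "('d::finite \<Rightarrow> nat) \<Rightarrow> nat" where
  "multi_order \<alpha> = (\<Sum>i\<in>UNIV. \<alpha> i)"

definition square_integrable_on :: "(real^'d::finite) set \<Rightarrow> (real^'d \<Rightarrow> real) \<Rightarrow> bool" where
  "square_integrable_on U g \<longleftrightarrow>
     g \<in> borel_measurable (lebesgue_on U) \<and> integrable (lebesgue_on U) (\<lambda>x. (g x)\<^sup>2)"

definition is_weak_deriv ::
    "(real^'d::finite) set \<Rightarrow> ('d \<Rightarrow> nat) \<Rightarrow> (real^'d \<Rightarrow> real) \<Rightarrow> (real^'d \<Rightarrow> real) \<Rightarrow> bool" where
  "is_weak_deriv U \<alpha> f g \<longleftrightarrow> square_integrable_on U g \<and>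
     (\<forall>\<phi>. test_function U \<phi> \<longrightarrow>
        (\<integral>x. f x * multi_partial \<alpha> \<phi> x \<partial>lebesgue_on U) =
        (- 1) ^ multi_order \<alpha> * (\<integral>x. g x * \<phi> x \<partial>lebesgue_on U))"

text \<open>Weak derivatives of a square integrable function are unique up to null sets, so the integrals
  below do not depend on the choice.\<close>

definition weak_deriv ::
    "(real^'d::finite) set \<Rightarrow> ('d \<Rightarrow> nat) \<Rightarrow> (real^'d \<Rightarrow> real) \<Rightarrow> real^'d \<Rightarrow> real" where
  "weak_deriv U \<alpha> f = (SOME g. is_weak_deriv U \<alpha> f g)"

text \<open>The square of the Gagliardo-Slobodeckij seminorm of order \<open>\<sigma> \<in> (0,1)\<close>; the integrand is
  \<open>0\<close> on the diagonal.\<close>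

definition slobodeckij :: "(real^'d::finite) set \<Rightarrow> real \<Rightarrow> (real^'d \<Rightarrow> real) \<Rightarrow> ennreal" where
  "slobodeckij U \<sigma> g =
     (\<integral>\<^sup>+x. (\<integral>\<^sup>+y. ennreal ((g x - g y)\<^sup>2 / dist x y powr (real CARD('d) + 2 * \<sigma>))
        \<partial>lebesgue_on U) \<partial>lebesgue_on U)"

text \<open>\<open>W\<^sub>2\<^sup>\<tau>(U)\<close> for open \<open>U\<close> and \<open>\<tau> \<ge> 0\<close>, written \<open>\<tau> = m + \<sigma>\<close> with \<open>m = \<lfloor>\<tau>\<rfloor>\<close> and \<open>\<sigma> \<in> [0,1)\<close>.\<close>

definition sobolev_space :: "(real^'d::finite) set \<Rightarrow> real \<Rightarrow> (real^'d \<Rightarrow> real) set" where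
  "sobolev_space U \<tau> =
     {f. square_integrable_on U f \<and>
         (\<forall>\<alpha>. multi_order \<alpha> \<le> nat \<lfloor>\<tau>\<rfloor> \<longrightarrow> (\<exists>g. is_weak_deriv U \<alpha> f g)) \<and>
         (frac \<tau> > 0 \<longrightarrow> (\<forall>\<alpha>. multi_order \<alpha> = nat \<lfloor>\<tau>\<rfloor> \<longrightarrow>
            slobodeckij U (frac \<tau>) (weak_deriv U \<alpha> f) < \<infinity>))}"

definition sobolev_norm :: "(real^'d::finite) set \<Rightarrow> real \<Rightarrow> (real^'d \<Rightarrow> real) \<Rightarrow> real" where
  "sobolev_norm U \<tau> f = sqrt (
     (\<Sum>\<alpha> | multi_order \<alpha> \<le> nat \<lfloor>\<tau>\<rfloor>. \<integral>x. (weak_deriv U \<alpha> f x)\<^sup>2 \<partial>lebesgue_on U) +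
     (if frac \<tau> > 0
      then \<Sum>\<alpha> | multi_order \<alpha> = nat \<lfloor>\<tau>\<rfloor>. enn2real (slobodeckij U (frac \<tau>) (weak_deriv U \<alpha> f))
      else 0))"

definition strictly_positive_definite_on :: "'a set \<Rightarrow> ('a \<Rightarrow> 'a \<Rightarrow> real) \<Rightarrow> bool" where
  "strictly_positive_definite_on \<Omega> k \<longleftrightarrow>
     (\<forall>x\<in>\<Omega>. \<forall>y\<in>\<Omega>. k x y = k y x) \<and>
     (\<forall>X c. finite X \<and> X \<subseteq> \<Omega> \<and> (\<exists>x\<in>X. c x \<noteq> 0) \<longrightarrow>
        (\<Sum>x\<in>X. \<Sum>y\<in>X. c x * c y * k x y) > 0)"

definition continuous_kernel_on :: "'a::topological_space set \<Rightarrow> ('a \<Rightarrow> 'a \<Rightarrow> real) \<Rightarrow> bool" where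
  "continuous_kernel_on \<Omega> k \<longleftrightarrow> continuous_on (\<Omega> \<times> \<Omega>) (\<lambda>(x, y). k x y)"

text \<open>The Hilbert space of functions is represented by a complete inner product space \<open>'h\<close> together
  with \<open>ev\<close>, where \<open>ev f\<close> is the function on \<open>\<Omega>\<close> that the vector \<open>f\<close> stands for; its values outside
  \<open>\<Omega>\<close> are irrelevant. The first two conditions say that \<open>'h\<close> is a linear space of functions on \<open>\<Omega>\<close>,
  the third that it contains all \<open>k(\<cdot>, x)\<close> and has the reproducing property.\<close>

definition rkhs ::
    "'a set \<Rightarrow> ('a \<Rightarrow> 'a \<Rightarrow> real) \<Rightarrow> ('h::{real_inner,complete_space} \<Rightarrow> 'a \<Rightarrow> real) \<Rightarrow> bool" where
  "rkhs \<Omega> k ev \<longleftrightarrow>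
     (\<forall>x\<in>\<Omega>. linear (\<lambda>f. ev f x)) \<and>
     (\<forall>f g. (\<forall>x\<in>\<Omega>. ev f x = ev g x) \<longrightarrow> f = g) \<and>
     (\<forall>x\<in>\<Omega>. \<exists>\<phi>. (\<forall>y\<in>\<Omega>. ev \<phi> y = k y x) \<and> (\<forall>f. ev f x = f \<bullet> \<phi>))"

definition kernel_section ::
    "'a set \<Rightarrow> ('a \<Rightarrow> 'a \<Rightarrow> real) \<Rightarrow> ('h::{real_inner,complete_space} \<Rightarrow> 'a \<Rightarrow> real) \<Rightarrow> 'a \<Rightarrow> 'h" where
  "kernel_section \<Omega> k ev x = (THE \<phi>. \<forall>y\<in>\<Omega>. ev \<phi> y = k y x)"

text \<open>A subset of \<open>\<real>\<^sup>d\<close> that is not open carries the Sobolev space of its interior.\<close>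

definition embedded_in_sobolev ::
    "(real^'d::finite) set \<Rightarrow> real \<Rightarrow> ('h::{real_inner,complete_space} \<Rightarrow> real^'d \<Rightarrow> real) \<Rightarrow> bool" where
  "embedded_in_sobolev \<Omega> \<tau> ev \<longleftrightarrow>
     (\<forall>f. ev f \<in> sobolev_space (interior \<Omega>) \<tau>) \<and>
     (\<exists>K. \<forall>f. sobolev_norm (interior \<Omega>) \<tau> (ev f) \<le> K * norm f)"

definition trial_space ::
    "'a set \<Rightarrow> ('a \<Rightarrow> 'a \<Rightarrow> real) \<Rightarrow> ('h::{real_inner,complete_space} \<Rightarrow> 'a \<Rightarrow> real) \<Rightarrow> 'a set \<Rightarrow> 'h set"
  where "trial_space \<Omega> k ev X = span (kernel_section \<Omega> k ev ` X)"

definition interpolant ::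
    "'a set \<Rightarrow> ('a \<Rightarrow> 'a \<Rightarrow> real) \<Rightarrow> ('h::{real_inner,complete_space} \<Rightarrow> 'a \<Rightarrow> real) \<Rightarrow> 'a set \<Rightarrow> 'h \<Rightarrow> 'h"
  where "interpolant \<Omega> k ev X f =
    (THE s. s \<in> trial_space \<Omega> k ev X \<and> (\<forall>x\<in>X. ev s x = ev f x))"

text \<open>The library's \<open>closest_point\<close> is restricted to spaces with the Heine-Borel property.\<close>

definition orth_proj :: "'h::real_inner set \<Rightarrow> 'h \<Rightarrow> 'h" where
  "orth_proj V g = (THE s. s \<in> V \<and> (\<forall>v\<in>V. orthogonal (g - s) v))"

definition power_function ::
    "'a set \<Rightarrow> ('a \<Rightarrow> 'a \<Rightarrow> real) \<Rightarrow> ('h::{real_inner,complete_space} \<Rightarrow> 'a \<Rightarrow> real) \<Rightarrow> 'a set \<Rightarrow> 'a \<Rightarrow> real"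
  where "power_function \<Omega> k ev X x =
    norm (kernel_section \<Omega> k ev x - orth_proj (trial_space \<Omega> k ev X) (kernel_section \<Omega> k ev x))"

definition Linf_norm :: "(real^'d::finite) set \<Rightarrow> (real^'d \<Rightarrow> real) \<Rightarrow> ereal" where
  "Linf_norm \<Omega> g = esssup (lebesgue_on \<Omega>) (\<lambda>x. ereal \<bar>g x\<bar>)"

text \<open>For \<open>\<beta> = 0\<close> the factor \<open>\<bar>f - I\<^sub>X f\<bar>\<^sup>\<beta>\<close> is \<open>1\<close> even where the residual vanishes,
  whereas \<open>0 powr 0 = 0\<close>; hence the separate case.\<close>

definition greedy_indicator ::
    "'a set \<Rightarrow> ('a \<Rightarrow> 'a \<Rightarrow> real) \<Rightarrow> ('h::{real_inner,complete_space} \<Rightarrow> 'a \<Rightarrow> real) \<Rightarrow>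
     ennreal \<Rightarrow> 'h \<Rightarrow> 'a set \<Rightarrow> 'a \<Rightarrow> real" where
  "greedy_indicator \<Omega> k ev \<beta> f X x =
     (let r = \<bar>ev (f - interpolant \<Omega> k ev X f) x\<bar>; P = power_function \<Omega> k ev X x; b = enn2real \<beta>
      in if \<beta> = \<infinity> then r / P
         else if \<beta> = 0 then P
         else r powr b * P powr (1 - b))"

text \<open>The point sequence is \<open>x 1, x 2, \<dots>\<close>; the value \<open>x 0\<close> is not used.\<close>

definition points :: "(nat \<Rightarrow> 'a) \<Rightarrow> nat \<Rightarrow> 'a set" where
  "points x n = x ` {1..n}"

definition weak_greedy ::
    "'a set \<Rightarrow> ('a \<Rightarrow> 'a \<Rightarrow> real) \<Rightarrow> ('h::{real_inner,complete_space} \<Rightarrow> 'a \<Rightarrow> real) \<Rightarrow>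
     ennreal \<Rightarrow> real \<Rightarrow> 'h \<Rightarrow> (nat \<Rightarrow> 'a) \<Rightarrow> bool" where
  "weak_greedy \<Omega> k ev \<beta> \<gamma> f x \<longleftrightarrow>
     (\<forall>n. x (n + 1) \<in> \<Omega> - points x n \<and>
        ereal (greedy_indicator \<Omega> k ev \<beta> f (points x n) (x (n + 1))) \<ge>
        ereal \<gamma> * (SUP z\<in>\<Omega> - points x n. ereal (greedy_indicator \<Omega> k ev \<beta> f (points x n) z)))"

definition admissible :: "'a::topological_space set \<Rightarrow> real \<Rightarrow> bool" where
  "admissible \<Omega> \<gamma> \<longleftrightarrow> (open \<Omega> \<and> 0 < \<gamma> \<and> \<gamma> < 1) \<or> (closed \<Omega> \<and> 0 < \<gamma> \<and> \<gamma> \<le> 1)"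

definition co :: "'h::real_normed_vector set \<Rightarrow> 'h set" where
  "co K = closure {\<Sum>g\<in>S. c g *\<^sub>R g | S c. finite S \<and> S \<subseteq> K \<and> (\<Sum>g\<in>S. \<bar>c g\<bar>) \<le> 1}"

definition entropy_number :: "nat \<Rightarrow> 'h::real_normed_vector set \<Rightarrow> ereal" where
  "entropy_number n K =
     Inf {ereal \<epsilon> | \<epsilon>. \<epsilon> > 0 \<and> (\<exists>S. finite S \<and> card S \<le> 2 ^ n \<and> K \<subseteq> (\<Union>s\<in>S. cball s \<epsilon>))}"

definition entropy_bound ::
    "'h::real_normed_vector set \<Rightarrow> real \<Rightarrow> real \<Rightarrow> bool" where
  "entropy_bound K C s \<longleftrightarrow> (\<forall>n\<ge>1. entropy_number n K \<le> ereal (C * real n powr (- s)))"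

end

theory Submission
  imports Defs "HOL-Computational_Algebra.Polynomial"
begin

text \<open>For the convergence rates, Newton's basis of the selected points turns the power function values
  and the decrease of the residual into products over \<open>n\<close> consecutive steps. The kernel sections of
  these points are triangular with respect to that basis with the power function values as the diagonal,
  so the absolutely convex hull contains a skewed cross-polytope, and comparing its volume with that of
  \<open>2\<^sup>n\<close> balls bounds the product of the power function values. The residual coefficients are
  bounded by the inequality between arithmetic and geometric mean, and one of the \<open>n\<close> steps is
  at most the geometric mean.

  For the entropy bound, point evaluation at \<open>x\<close> is expanded as a telescoping series of functionals
  \<open>f \<mapsto> \<integral> f C\<close>, where \<open>C\<close> is a local polynomial interpolation kernel of mesh width
  \<open>t\<close> whose nodal values are replaced by mollifiers with vanishing moments. Such functionals are
  controlled by weak derivatives inside \<open>\<Omega>\<close>, so no extension theorem is needed, and the increments have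
  norm \<open>O(t\<^bsup>\<tau>-d/2\<^esup>)\<close> and lie in the hull of \<open>O(t\<^bsup>-d\<^esup>)\<close> vectors. The supports stay inside
  \<open>\<Omega>\<close> because they are translated into the domain along one of finitely many directions. Carl's
  argument with Maurey's lemma on every level turns this into the rate \<open>n\<^bsup>-\<tau>/d\<^esup>\<close>.\<close>

section \<open>Volumes\<close>

text \<open>The window has \<open>n\<close> indices to match the \<open>n\<close>-th entropy number:
  \<open>2 ^ n\<close> balls against a cross-polytope in dimension n. The powers of 2 cancel and
  leave n! times the volume of the unit ball, at most (5 n)^(n/2); hence sqrt 5. The remaining sqrt
  n, together with n^(-1/2) for each power of a residual coefficient, gives the exponent (1 -
  beta)/2. The entropy rate needs a gain of d/2 over the decay tau - d/2 of the increments. With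
  mesh ratio 2^(-p), level l has about 2^(e l) vectors, e = p d, of norm about 2^(-s l), s = p (tau
  - d/2). Averaging in Maurey's lemma contributes e/2, and (s + e/2) / e = tau/d. Taking p large
  makes s >= 2, which leaves room for the losses in the sums over levels. The geometric obstacle: an
  increment compares two levels whose shifts into the domain differ by the factor 2^(-p), while
  supports of tensor products are coordinate boxes. One box has to contain both shifted positions
  and still lie inside the domain.\<close>

lemma nn_integral_tent_power:
  fixes b p t :: real
  assumes "p > 0" "t \<ge> 0"
  shows "(\<integral>\<^sup>+y. ennreal ((2 * (t - \<bar>y - b\<bar> / p)) ^ n) * indicator {b - p*t..b + p*t} y \<partial>lborel)
     = ennreal (p * (2 * t) ^ Suc n / real (Suc n))"
proof -
  let ?f = "\<lambda>y. (2 * (t - \<bar>y - b\<bar> / p)) ^ n"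
  let ?F1 = "\<lambda>y. p * (2 * (t - (b - y) / p)) ^ Suc n / (2 * real (Suc n))"
  let ?F2 = "\<lambda>y. - p * (2 * (t - (y - b) / p)) ^ Suc n / (2 * real (Suc n))"
  have pt: "0 \<le> p * t" using assms by simp
  have D1: "(?F1 has_real_derivative (2 * (t - (b - y) / p)) ^ n) (at y)" for y
  proof -
    have "((\<lambda>y. 2 * (t - (b - y) / p)) has_real_derivative 2 / p) (at y)"
      using assms by (auto intro!: derivative_eq_intros simp: field_simps)
    from DERIV_cdivide[OF DERIV_cmult[OF DERIV_power[OF this, of "Suc n"], of p], of "2 * real (Suc n)"]
    show ?thesis by (rule DERIV_cong) (use assms in \<open>simp del: of_nat_Suc\<close>)
  qed
  have D2: "(?F2 has_real_derivative (2 * (t - (y - b) / p)) ^ n) (at y)" for y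
  proof -
    have "((\<lambda>y. 2 * (t - (y - b) / p)) has_real_derivative - 2 / p) (at y)"
      using assms by (auto intro!: derivative_eq_intros simp: field_simps)
    from DERIV_cdivide[OF DERIV_cmult[OF DERIV_power[OF this, of "Suc n"], of "- p"], of "2 * real (Suc n)"]
    show ?thesis by (rule DERIV_cong) (use assms in \<open>simp del: of_nat_Suc\<close>)
  qed
  have I1: "(\<integral>\<^sup>+y. ennreal ((2 * (t - (b - y) / p)) ^ n) * indicator {b - p*t..b} y \<partial>lborel) = ennreal (?F1 b - ?F1 (b - p*t))"
    using assms pt by (intro nn_integral_FTC_Icc D1 zero_le_power) (auto simp: field_simps)
  have I2: "(\<integral>\<^sup>+y. ennreal ((2 * (t - (y - b) / p)) ^ n) * indicator {b..b + p*t} y \<partial>lborel) = ennreal (?F2 (b + p*t) - ?F2 b)"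
    using assms pt by (intro nn_integral_FTC_Icc D2 zero_le_power) (auto simp: field_simps)
  have "(\<integral>\<^sup>+y. ennreal (?f y) * indicator {b - p*t..b + p*t} y \<partial>lborel) =
    (\<integral>\<^sup>+y. ennreal ((2 * (t - (b - y) / p)) ^ n) * indicator {b - p*t..b} y
        + ennreal ((2 * (t - (y - b) / p)) ^ n) * indicator {b..b + p*t} y \<partial>lborel)"
  proof (rule nn_integral_cong_AE)
    have "AE y in lborel. y \<noteq> b" by (rule AE_lborel_singleton)
    then show "AE y in lborel. ennreal (?f y) * indicator {b - p*t..b + p*t} y =
      ennreal ((2 * (t - (b - y) / p)) ^ n) * indicator {b - p*t..b} y
        + ennreal ((2 * (t - (y - b) / p)) ^ n) * indicator {b..b + p*t} y"
      by eventually_elim (use pt in \<open>auto simp: indicator_def abs_if\<close>)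
  qed
  also have "\<dots> = ennreal (?F1 b - ?F1 (b - p*t)) + ennreal (?F2 (b + p*t) - ?F2 b)"
    unfolding I1[symmetric] I2[symmetric] by (intro nn_integral_add) auto
  also have "\<dots> = ennreal (p * (2 * t) ^ Suc n / real (Suc n))"
    using assms by (subst ennreal_plus[symmetric]) (auto simp: field_simps simp del: power_Suc of_nat_Suc)
  finally show ?thesis .
qed

text \<open>The set on the left is an affine image of a cross-polytope under an upper triangular matrix.
  Working with an arbitrary measurable superset avoids proving that image measurable, and the shift
  \<open>b\<close> is what the slices at a fixed last coordinate require.\<close>

lemma emeasure_cross_polytope_ge:
  fixes M :: "nat \<Rightarrow> nat \<Rightarrow> real"
  assumes "\<And>i. i < n \<Longrightarrow> M i i > 0" and "t \<ge> 0"
    and "X \<in> sets (\<Pi>\<^sub>M i\<in>{..<n}. lborel)"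
    and "\<And>c. (\<Sum>j<n. \<bar>c j\<bar>) \<le> t \<Longrightarrow> (\<lambda>i\<in>{..<n}. b i + (\<Sum>j\<in>{i..<n}. M i j * c j)) \<in> X"
  shows "emeasure (\<Pi>\<^sub>M i\<in>{..<n}. lborel) X \<ge> ennreal ((2 * t) ^ n / fact n * (\<Prod>i<n. M i i))"
  using assms
proof (induction n arbitrary: t X b)
  case 0
  have "(\<lambda>i\<in>{..<0}. b i) \<in> X" using "0.prems"(4)[of "\<lambda>_. 0"] "0.prems"(2) by (simp add: restrict_def)
  then have "X = {\<lambda>_. undefined}" unfolding restrict_def using "0.prems"(3) by (auto simp: sets_PiM_empty)
  then show ?case by (simp add: emeasure_PiM_empty)
next
  case (Suc n)
  interpret product_sigma_finite "\<lambda>_::nat. lborel::real measure" by standard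
  let ?P = "\<lambda>n. \<Pi>\<^sub>M i\<in>{..<n}. (lborel::real measure)"
  define p where "p = M n n"
  have p: "p > 0" using Suc.prems(1)[of n] by (simp add: p_def)
  note X[measurable] = Suc.prems(3)
  have ins: "{..<Suc n} = insert n {..<n}" by auto
  have [measurable]: "X \<in> sets (Pi\<^sub>M (insert n {..<n}) (\<lambda>_. lborel))" using X by (simp add: ins)
  define D where "D = (\<Prod>i<n. M i i)"
  have D: "D > 0" unfolding D_def using Suc.prems(1) by (intro prod_pos) auto
  \<comment> \<open>Fixing the last coordinate at y leaves a cross-polytope of one dimension less
    with radius \<open>t - \<bar>y - b n\<bar> / p\<close>. The tent function is its volume up to a
    constant, and \<open>nn_integral_tent_power\<close> integrates these slices.\<close>
  have slice: "(\<integral>\<^sup>+ x. indicator X (x(n := y)) \<partial>?P n) \<ge>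
      ennreal ((2 * (t - \<bar>y - b n\<bar> / p)) ^ n) * indicator {b n - p*t..b n + p*t} y * ennreal (D / fact n)" for y
  proof (cases "y \<in> {b n - p*t..b n + p*t}")
    case True
    \<comment> \<open>The last coefficient is forced by y. It consumes \<open>\<bar>c0\<bar>\<close>
      of the budget \<open>t\<close> and shifts the other coordinates by its column of
      \<open>M\<close>, which the induction hypothesis absorbs into \<open>b\<close>.\<close>
    define c0 where "c0 = (y - b n) / p"
    have c0: "\<bar>c0\<bar> = \<bar>y - b n\<bar> / p" using p by (simp add: c0_def abs_divide)
    have t': "0 \<le> t - \<bar>y - b n\<bar> / p" using True p by (auto simp: field_simps abs_le_iff)
    define Y where "Y = {x \<in> space (?P n). x(n := y) \<in> X}"
    have Ym: "Y \<in> sets (?P n)"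
      unfolding Y_def by measurable
    have "emeasure (?P n) Y \<ge> ennreal ((2 * (t - \<bar>y - b n\<bar> / p)) ^ n / fact n * (\<Prod>i<n. M i i))"
    proof (rule Suc.IH[where b = "\<lambda>i. b i + M i n * c0", OF _ t' Ym])
      show "M i i > 0" if "i < n" for i using Suc.prems(1) that by simp
    next
      fix c :: "nat \<Rightarrow> real" assume c: "(\<Sum>j<n. \<bar>c j\<bar>) \<le> t - \<bar>y - b n\<bar> / p"
      define c' where "c' = c(n := c0)"
      have "(\<Sum>j<n. \<bar>c' j\<bar>) = (\<Sum>j<n. \<bar>c j\<bar>)" by (intro sum.cong) (auto simp: c'_def)
      then have "(\<Sum>j<Suc n. \<bar>c' j\<bar>) \<le> t" using c by (simp add: c'_def c0)
      from Suc.prems(4)[OF this]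
      have inX: "(\<lambda>i\<in>{..<Suc n}. b i + (\<Sum>j\<in>{i..<Suc n}. M i j * c' j)) \<in> X" .
      have eq: "(\<lambda>i\<in>{..<Suc n}. b i + (\<Sum>j\<in>{i..<Suc n}. M i j * c' j)) =
         (\<lambda>i\<in>{..<n}. (b i + M i n * c0) + (\<Sum>j\<in>{i..<n}. M i j * c j))(n := y)"
      proof
        fix i
        consider "i < n" | "i = n" | "i > n" by linarith
        then show "(\<lambda>i\<in>{..<Suc n}. b i + (\<Sum>j\<in>{i..<Suc n}. M i j * c' j)) i =
         ((\<lambda>i\<in>{..<n}. (b i + M i n * c0) + (\<Sum>j\<in>{i..<n}. M i j * c j))(n := y)) i"
        proof cases
          case 1
          then have "(\<Sum>j\<in>{i..<n}. M i j * c' j) = (\<Sum>j\<in>{i..<n}. M i j * c j)"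
            by (intro sum.cong) (auto simp: c'_def)
          then show ?thesis using 1 by (simp add: c'_def)
        next
          case 2 then show ?thesis using p by (simp add: c'_def c0_def p_def)
        qed auto
      qed
      show "(\<lambda>i\<in>{..<n}. (b i + M i n * c0) + (\<Sum>j\<in>{i..<n}. M i j * c j)) \<in> Y"
        using inX unfolding eq Y_def by (auto simp: space_PiM)
    qed
    also have "emeasure (?P n) Y = (\<integral>\<^sup>+ x. indicator Y x \<partial>?P n)" using Ym by simp
    also have "\<dots> = (\<integral>\<^sup>+ x. indicator X (x(n := y)) \<partial>?P n)"
      by (intro nn_integral_cong) (auto simp: Y_def indicator_def)
    finally show ?thesis using True D t'
      by (simp add: D_def[symmetric] ennreal_mult[symmetric])
  qed simp
  have "ennreal ((2 * t) ^ Suc n / fact (Suc n) * (\<Prod>i<Suc n. M i i))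
      = ennreal (p * (2 * t) ^ Suc n / real (Suc n)) * ennreal (D / fact n)"
    using p D Suc.prems(2) by (subst ennreal_mult[symmetric]) (auto simp: D_def p_def field_simps simp del: power_Suc)
  also have "\<dots> = (\<integral>\<^sup>+y. ennreal ((2 * (t - \<bar>y - b n\<bar> / p)) ^ n) * indicator {b n - p*t..b n + p*t} y * ennreal (D / fact n) \<partial>lborel)"
    by (subst nn_integral_tent_power[OF p Suc.prems(2), symmetric], subst nn_integral_multc) auto
  also have "\<dots> \<le> (\<integral>\<^sup>+y. (\<integral>\<^sup>+ x. indicator X (x(n := y)) \<partial>?P n) \<partial>lborel)"
    by (intro nn_integral_mono slice)
  also have "\<dots> = emeasure (?P (Suc n)) X"
    unfolding ins by (subst product_nn_integral_insert_rev[symmetric]) auto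
  finally show ?case .
qed

text \<open>The induction advances two dimensions at a time, because the ball volumes then obey a
  recursion with factor 2 pi / n. From m to n = m + 2 the left-hand side grows by 2 pi (m + 1). On
  the right the new factor 5 n covers this with the help of (1 + 2/m)^(m/2) >= 2.\<close>

lemma fact_mult_unit_ball_vol_le:
  assumes "n \<ge> 1"
  shows "fact n * unit_ball_vol (real n) \<le> sqrt (5 * real n) ^ n"
  using assms
proof (induction n rule: less_induct)
  case (less n)
  consider "n = 1" | "n = 2" | m where "n = m + 2" "m \<ge> 1"
    using less.prems by (metis One_nat_def Suc_1 add.commute add_2_eq_Suc le_neq_implies_less not_less_eq_eq ordered_cancel_comm_monoid_diff_class.diff_add less_2_cases_iff linorder_not_less nat_less_le)
  then show ?case
  proof cases
    case 1
    have "(2::real) \<le> sqrt 5" by (rule real_le_rsqrt) simp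
    then show ?thesis using 1 by simp
  next
    case 2
    have "pi \<le> 4" using pi_less_4 by simp
    then show ?thesis using 2 by (simp add: eval_unit_ball_vol)
  next
    case (3 m)
    have vol: "unit_ball_vol (real n) = unit_ball_vol (real m) * (2 * pi / real n)"
    proof -
      have G: "Gamma (real n / 2 + 1) = (real n / 2) * Gamma (real m / 2 + 1)"
      proof -
        have "Gamma (real n / 2 + 1) = (real n / 2) * Gamma (real n / 2)"
          by (rule Gamma_plus1) (use 3 nonpos_Ints_nonpos[of "real n / 2"] in auto)
        also have "real n / 2 = real m / 2 + 1" using 3 by (simp add: add_divide_distrib)
        finally show ?thesis by (simp add: \<open>real n / 2 = real m / 2 + 1\<close>)
      qed
      have P: "pi powr (real n / 2) = pi powr (real m / 2) * pi"
        using 3 by (simp add: add_divide_distrib powr_add)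
      show ?thesis unfolding unit_ball_vol_def G P using 3 by (simp add: field_simps)
    qed
    have IH: "fact m * unit_ball_vol (real m) \<le> sqrt (5 * real m) ^ m" using less.IH[of m] 3 by simp
    have fac: "(fact n :: real) = real n * real (m+1) * fact m" using 3 by (simp add: algebra_simps)
    have "fact n * unit_ball_vol (real n) = (fact m * unit_ball_vol (real m)) * (2 * pi * real (m+1))"
      using 3 unfolding vol fac by (simp add: field_simps)
    also have "\<dots> \<le> sqrt (5 * real m) ^ m * (2 * pi * real (m+1))"
      by (intro mult_right_mono IH) auto
    also have "\<dots> \<le> sqrt (5 * real n) ^ n"
    proof (cases "m = 1")
      case True
      have "sqrt 5 * (2 * pi * 2) \<le> sqrt 5 * (4 * 4)" using pi_less_4 by (intro mult_left_mono) auto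
      also have "\<dots> \<le> sqrt 5 * (5 * (3 * sqrt 3))"
      proof -
        have "(1.5::real) \<le> sqrt 3" by (rule real_le_rsqrt) (simp add: power2_eq_square)
        then show ?thesis by (intro mult_left_mono) auto
      qed
      also have "\<dots> = sqrt 15 ^ 3"
      proof -
        have "sqrt 15 = sqrt 5 * sqrt 3" by (simp add: real_sqrt_mult[symmetric])
        then show ?thesis by (simp add: power3_eq_cube algebra_simps)
      qed
      finally show ?thesis using True 3 by (simp add: numeral_3_eq_3)
    next
      case False
      then have m2: "m \<ge> 2" using 3 by simp
      \<comment> \<open>Bernoulli's inequality with its second-order term: at x = 2/m it gives 3 + 2
        (m - 1)/m, which is at least 4 from m = 2 on. For m = 1 the power is only 3, hence the
        separate check above.\<close>
      have bin: "1 + real k * x + real k * (real k - 1) / 2 * x\<^sup>2 \<le> (1 + x) ^ k" if "x \<ge> 0" for x :: real and k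
      proof (induction k)
        case (Suc k)
        have "0 \<le> real k * (real k - 1)" by (cases k) auto
        then have "0 \<le> real k * (real k - 1) / 2 * x\<^sup>2 * x" using that by simp
        then have "1 + real (Suc k) * x + real (Suc k) * (real (Suc k) - 1) / 2 * x\<^sup>2
            \<le> (1 + x) * (1 + real k * x + real k * (real k - 1) / 2 * x\<^sup>2)"
          by (simp add: field_simps power2_eq_square)
        also have "\<dots> \<le> (1 + x) * (1 + x) ^ k" using Suc that by (intro mult_left_mono) auto
        finally show ?case by simp
      qed simp
      have "4 \<le> 1 + real m * (2 / real m) + real m * (real m - 1) / 2 * (2 / real m)\<^sup>2"
        using m2 by (simp add: field_simps power2_eq_square)
      also have "\<dots> \<le> (1 + 2 / real m) ^ m" by (rule bin) simp
      finally have "sqrt 4 \<le> sqrt ((1 + 2 / real m) ^ m)" by (rule real_sqrt_le_mono)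
      then have two: "2 \<le> sqrt (1 + 2 / real m) ^ m" by (simp add: real_sqrt_power)
      have sq: "sqrt (5 * real n) = sqrt (5 * real m) * sqrt (1 + 2 / real m)"
        using 3 by (simp add: real_sqrt_mult[symmetric] field_simps)
      have "2 * pi * real (m+1) \<le> 2 * (5 * real n)"
      proof -
        have "pi * real (m+1) \<le> 5 * real n" using pi_less_4 3 by (intro mult_mono) auto
        then show ?thesis by simp
      qed
      also have "\<dots> \<le> sqrt (1 + 2 / real m) ^ m * (5 * real n)"
        using two by (intro mult_right_mono) auto
      finally have "sqrt (5 * real m) ^ m * (2 * pi * real (m+1))
          \<le> sqrt (5 * real m) ^ m * (sqrt (1 + 2 / real m) ^ m * (5 * real n))"
        by (intro mult_left_mono) auto
      also have "\<dots> = sqrt (5 * real n) ^ m * (5 * real n)"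
        unfolding sq by (simp add: power_mult_distrib)
      also have "\<dots> = sqrt (5 * real n) ^ n" using 3(1) by (simp add: power_add)
      finally show ?thesis .
    qed
    finally show ?thesis .
  qed
qed

section \<open>Entropy numbers of absolutely convex hulls\<close>

text \<open>One Gram-Schmidt step per vector. If the new vector already lies in the span then
  \<open>u = 0\<close> and the correction \<open>r\<close> vanishes, so no independence has to be
  assumed.\<close>

lemma ex_orth_proj_span:
  fixes X :: "'a::real_inner set"
  assumes "finite X"
  shows "\<exists>s\<in>span X. \<forall>v\<in>span X. orthogonal (g - s) v"
  using assms
proof (induction arbitrary: g)
  case empty
  then show ?case by (auto simp: orthogonal_def)
next
  case (insert a X)
  obtain a' where a': "a' \<in> span X" "\<And>v. v \<in> span X \<Longrightarrow> orthogonal (a - a') v"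
    using insert.IH[of a] by blast
  obtain s where s: "s \<in> span X" "\<And>v. v \<in> span X \<Longrightarrow> orthogonal (g - s) v"
    using insert.IH[of g] by blast
  define u where "u = a - a'"
  define r where "r = ((g \<bullet> u) / (u \<bullet> u)) *\<^sub>R u"
  have mono: "span X \<subseteq> span (insert a X)" by (intro span_mono) auto
  have u_in: "u \<in> span (insert a X)" unfolding u_def
    using a'(1) mono by (intro span_diff) (auto intro: span_base)
  have gu: "(g - r) \<bullet> u = 0" by (cases "u = 0") (auto simp: r_def inner_diff_left)
  have su: "s \<bullet> u = 0" using a'(2)[OF s(1)] by (simp add: u_def orthogonal_def inner_commute)
  have orth: "orthogonal (g - (s + r)) v" if v: "v \<in> span (insert a X)" for v
  proof -
    obtain k where k: "v - k *\<^sub>R a \<in> span X" using v by (auto simp: span_insert)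
    define w where "w = v - k *\<^sub>R a + k *\<^sub>R a'"
    have w: "w \<in> span X" unfolding w_def using k a'(1) by (intro span_add span_scale)
    have v_eq: "v = w + k *\<^sub>R u" by (simp add: w_def u_def algebra_simps)
    have "(g - s) \<bullet> w = 0" using s(2)[OF w] by (simp add: orthogonal_def)
    moreover have "r \<bullet> w = 0" using a'(2)[OF w] by (simp add: r_def u_def orthogonal_def)
    ultimately show ?thesis using gu su
      by (simp add: orthogonal_def v_eq inner_add_right inner_diff_left inner_add_left)
  qed
  have "s + r \<in> span (insert a X)"
    using s(1) mono u_in by (auto simp: r_def intro!: span_add span_scale)
  with orth show ?case by blast
qed

lemma orth_proj_span_unique:
  fixes X :: "'a::real_inner set"
  assumes "s \<in> span X" "\<And>v. v \<in> X \<Longrightarrow> (g - s) \<bullet> v = 0"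
    and "s' \<in> span X" "\<And>v. v \<in> X \<Longrightarrow> (g - s') \<bullet> v = 0"
  shows "s = s'"
proof -
  have "orthogonal (s - s') v" if "v \<in> span X" for v
  proof (rule orthogonal_to_span[OF that])
    fix x assume "x \<in> X"
    then show "orthogonal (s - s') x" using assms(2)[of x] assms(4)[of x]
      by (simp add: orthogonal_def algebra_simps)
  qed
  from this[OF span_diff[OF assms(1,3)]] show ?thesis by (simp add: orthogonal_def)
qed

text \<open>The functional \<open>J\<close> is, up to a constant, the squared distance to the
  representer. The parallelogram law makes a minimising sequence Cauchy, and the first variation at
  its limit is the desired identity.\<close>

lemma riesz_representation:
  fixes l :: "'a::{real_inner,complete_space} \<Rightarrow> real"
  assumes lin: "linear l" and bd: "\<And>f. \<bar>l f\<bar> \<le> K * norm f"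
  shows "\<exists>v. \<forall>f. l f = f \<bullet> v"
proof -
  interpret linear l by fact
  define J where "J v = (norm v)\<^sup>2 - 2 * l v" for v
  have low: "J v \<ge> - K\<^sup>2" for v
  proof -
    have "2 * l v \<le> 2 * (K * norm v)" using bd[of v] by linarith
    also have "\<dots> \<le> K\<^sup>2 + (norm v)\<^sup>2" using sum_squares_bound[of K "norm v"] by simp
    finally show ?thesis by (simp add: J_def)
  qed
  define m where "m = Inf (range J)"
  have bdd: "bdd_below (range J)" by (rule bdd_belowI2) (rule low)
  have mle: "m \<le> J v" for v unfolding m_def by (rule cInf_lower[OF _ bdd]) auto
  have par: "(norm (v - w))\<^sup>2 \<le> 2 * (J v - m) + 2 * (J w - m)" for v w
  proof -
    have "(norm (v - w))\<^sup>2 = 2 * J v + 2 * J w - 4 * J ((1/2) *\<^sub>R (v + w))"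
      by (simp add: J_def power2_norm_eq_inner add scale algebra_simps inner_commute)
    then show ?thesis using mle[of "(1/2) *\<^sub>R (v + w)"] by simp
  qed
  have "\<exists>v. J v < m + inverse (real (Suc n))" for n
    using cInf_lessD[of "range J" "m + inverse (real (Suc n))"] by (auto simp: m_def)
  then obtain x where x: "\<And>n. J (x n) < m + inverse (real (Suc n))" by metis
  have "Cauchy x"
  proof (rule metric_CauchyI)
    fix e :: real assume e: "e > 0"
    obtain N where N: "inverse (real (Suc N)) < e\<^sup>2 / 4" using reals_Archimedean[of "e\<^sup>2/4"] e by auto
    have "dist (x p) (x q) < e" if "p \<ge> N" "q \<ge> N" for p q
    proof -
      have *: "J (x p) - m < e\<^sup>2 / 4" if "p \<ge> N" for p
      proof -
        have "inverse (real (Suc p)) \<le> inverse (real (Suc N))" using that by (intro le_imp_inverse_le) auto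
        then show ?thesis using x[of p] N by linarith
      qed
      have "2 * (J (x p) - m) + 2 * (J (x q) - m) < 2 * (e\<^sup>2 / 4) + 2 * (e\<^sup>2 / 4)"
        using *[OF that(1)] *[OF that(2)] by (intro add_strict_mono mult_strict_left_mono) auto
      then have "(norm (x p - x q))\<^sup>2 < e\<^sup>2" using par[of "x p" "x q"] by simp
      then show ?thesis using e by (simp add: dist_norm power2_less_imp_less)
    qed
    then show "\<exists>M. \<forall>p\<ge>M. \<forall>q\<ge>M. dist (x p) (x q) < e" by blast
  qed
  then obtain v where v: "x \<longlonglongrightarrow> v" using Cauchy_convergent_iff convergent_def by blast
  have "bounded_linear l" by (rule bounded_linear_intro[of _ K]) (use bd in \<open>auto simp: add scale mult.commute\<close>)
  then have lv: "(\<lambda>n. l (x n)) \<longlonglongrightarrow> l v" using v by (rule bounded_linear.tendsto)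
  have "(\<lambda>n. J (x n)) \<longlonglongrightarrow> J v" unfolding J_def by (intro tendsto_intros v lv)
  moreover have "(\<lambda>n. m + inverse (real (Suc n))) \<longlonglongrightarrow> m + 0"
    by (intro tendsto_intros LIMSEQ_inverse_real_of_nat)
  ultimately have "J v \<le> m + 0" by (rule LIMSEQ_le) (use x in \<open>auto intro: less_imp_le\<close>)
  then have Jv: "J v \<le> J w" for w using mle[of w] by simp
  have "l f = f \<bullet> v" for f
  proof -
    define a where "a = f \<bullet> v - l f"
    have quad: "0 \<le> 2 * t * a + t\<^sup>2 * (norm f)\<^sup>2" for t
    proof -
      have "J (v + t *\<^sub>R f) = J v + 2 * t * a + t\<^sup>2 * (norm f)\<^sup>2"
        unfolding J_def a_def power2_norm_eq_inner
        by (simp add: add scale algebra_simps inner_commute power2_eq_square)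
      then show ?thesis using Jv[of "v + t *\<^sub>R f"] by simp
    qed
    \<comment> \<open>The optimal t would need division by the squared norm of f; adding 1 covers
      \<open>f = 0\<close>.\<close>
    define N where "N = (norm f)\<^sup>2 + 1"
    have N: "N > 0" "(norm f)\<^sup>2 \<le> N" by (auto simp: N_def add_nonneg_pos)
    have "0 \<le> 2 * (- a / N) * a + (- a / N)\<^sup>2 * (norm f)\<^sup>2" by (rule quad)
    also have "\<dots> \<le> 2 * (- a / N) * a + (- a / N)\<^sup>2 * N" using N by (intro add_left_mono mult_left_mono) auto
    also have "\<dots> = - (a\<^sup>2 / N)" using N by (simp add: field_simps power2_eq_square)
    finally have "a\<^sup>2 \<le> 0" using N by (simp add: field_simps)
    then show ?thesis by (simp add: a_def)
  qed
  then show ?thesis by blast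
qed

text \<open>Maurey's lemma, derandomised: averaging over the convex weights shows that some choice of the
  next summand increases the squared error by at most \<open>b\<^sup>2\<close>.\<close>

lemma maurey_approximation:
  fixes W :: "'a::real_inner set"
  assumes "finite W" and b: "\<And>w. w \<in> W \<Longrightarrow> norm w \<le> b"
    and p: "\<And>w. w \<in> W \<Longrightarrow> p w \<ge> 0" "(\<Sum>w\<in>W. p w) = 1"
  shows "\<exists>m. (\<Sum>w\<in>W. m w) = k \<and>
    (norm (real k *\<^sub>R (\<Sum>w\<in>W. p w *\<^sub>R w) - (\<Sum>w\<in>W. real (m w) *\<^sub>R w)))\<^sup>2 \<le> real k * b\<^sup>2"
proof (induction k)
  case 0
  then show ?case by (intro exI[of _ "\<lambda>_. 0"]) auto
next
  case (Suc k)
  define v where "v = (\<Sum>w\<in>W. p w *\<^sub>R w)"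
  obtain m where m: "(\<Sum>w\<in>W. m w) = k"
    "(norm (real k *\<^sub>R v - (\<Sum>w\<in>W. real (m w) *\<^sub>R w)))\<^sup>2 \<le> real k * b\<^sup>2"
    using Suc by (auto simp: v_def)
  define r where "r = real k *\<^sub>R v - (\<Sum>w\<in>W. real (m w) *\<^sub>R w)"
  have "\<exists>w\<in>W. (norm (r + v - w))\<^sup>2 \<le> (norm r)\<^sup>2 + b\<^sup>2"
  proof (rule ccontr)
    assume "\<not> ?thesis"
    then have gt: "(norm (r + v - w))\<^sup>2 > (norm r)\<^sup>2 + b\<^sup>2" if "w \<in> W" for w using that by force
    obtain w0 where w0: "w0 \<in> W" "p w0 > 0"
      using p by (metis less_eq_real_def sum.neutral zero_neq_one)
    have "(\<Sum>w\<in>W. p w * ((norm r)\<^sup>2 + b\<^sup>2)) < (\<Sum>w\<in>W. p w * (norm (r + v - w))\<^sup>2)"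
    proof (rule sum_strict_mono_ex1[OF assms(1)])
      show "\<forall>w\<in>W. p w * ((norm r)\<^sup>2 + b\<^sup>2) \<le> p w * (norm (r + v - w))\<^sup>2"
        using gt p(1) by (intro ballI mult_left_mono) (auto intro: less_imp_le)
      show "\<exists>w\<in>W. p w * ((norm r)\<^sup>2 + b\<^sup>2) < p w * (norm (r + v - w))\<^sup>2"
        using gt[OF w0(1)] w0 by (intro bexI[of _ w0] mult_strict_left_mono) auto
    qed
    then have "(norm r)\<^sup>2 + b\<^sup>2 < (\<Sum>w\<in>W. p w * (norm (r + v - w))\<^sup>2)"
      by (simp add: sum_distrib_right[symmetric] p(2))
    also have "(\<Sum>w\<in>W. p w * (norm (r + v - w))\<^sup>2)
        = (\<Sum>w\<in>W. p w * (norm (r + v))\<^sup>2 - 2 * ((r + v) \<bullet> (p w *\<^sub>R w)) + p w * (norm w)\<^sup>2)"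
      by (intro sum.cong refl) (simp add: power2_norm_eq_inner algebra_simps inner_commute)
    also have "\<dots> = (norm (r + v))\<^sup>2 - 2 * ((r + v) \<bullet> v) + (\<Sum>w\<in>W. p w * (norm w)\<^sup>2)"
      by (simp add: sum.distrib sum_subtractf sum_distrib_right[symmetric] p(2) v_def inner_sum_right
        sum_distrib_left)
    also have "\<dots> = (norm r)\<^sup>2 - (norm v)\<^sup>2 + (\<Sum>w\<in>W. p w * (norm w)\<^sup>2)"
      by (simp add: power2_norm_eq_inner algebra_simps inner_commute)
    also have "(\<Sum>w\<in>W. p w * (norm w)\<^sup>2) \<le> (\<Sum>w\<in>W. p w * b\<^sup>2)"
      using b p by (intro sum_mono mult_left_mono power_mono) auto
    also have "\<dots> = b\<^sup>2" by (simp add: sum_distrib_right[symmetric] p(2))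
    finally show False by (smt (verit) zero_le_power2)
  qed
  then obtain w where w: "w \<in> W" "(norm (r + v - w))\<^sup>2 \<le> (norm r)\<^sup>2 + b\<^sup>2" by blast
  define m' where "m' = m(w := Suc (m w))"
  have s1: "(\<Sum>x\<in>W. m' x) = Suc k"
    using assms(1) w(1) m(1) by (simp add: m'_def sum.remove[of _ w])
  have s2: "(\<Sum>x\<in>W. real (m' x) *\<^sub>R x) = (\<Sum>x\<in>W. real (m x) *\<^sub>R x) + w"
    using assms(1) w(1) by (simp add: m'_def sum.remove[of _ w] algebra_simps)
  have "real (Suc k) *\<^sub>R v - (\<Sum>x\<in>W. real (m' x) *\<^sub>R x) = r + v - w"
    unfolding s2 by (simp add: r_def algebra_simps)
  then have "(norm (real (Suc k) *\<^sub>R v - (\<Sum>x\<in>W. real (m' x) *\<^sub>R x)))\<^sup>2 \<le> real (Suc k) * b\<^sup>2"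
    using w(2) m(2) by (simp add: r_def[symmetric] distrib_right)
  then show ?case using s1 unfolding v_def by blast
qed

section \<open>Finite coverings: Maurey's lemma and Carl's multilevel scheme\<close>

lemma finite_sum_list_eq: "finite {l::nat list. length l = m \<and> sum_list l = N}"
proof (rule finite_subset)
  show "{l::nat list. length l = m \<and> sum_list l = N} \<subseteq> {l. set l \<subseteq> {..N} \<and> length l = m}"
    by (auto simp: member_le_sum_list)
qed (auto intro: finite_lists_length_eq)

text \<open>Averages of \<open>k\<close> elements of H, -H and 0, taken with repetition, serve as
  centres. They are indexed by multiplicity lists of length at most 2 N + 1 with sum
  \<open>k\<close>, whose number the binomial coefficient bounds.\<close>

lemma maurey_cover:
  fixes H :: "'a::real_inner set"
  assumes H: "finite H" "card H \<le> N" and b: "\<And>h. h \<in> H \<Longrightarrow> norm h \<le> b" "b \<ge> 0" and k: "k \<ge> 1"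
  shows "\<exists>S. finite S \<and> card S \<le> (2 * N + k) choose k \<and>
    (\<forall>c. (\<Sum>h\<in>H. \<bar>c h\<bar>) \<le> 1 \<longrightarrow> (\<exists>s\<in>S. norm ((\<Sum>h\<in>H. c h *\<^sub>R h) - s) \<le> b / sqrt (real k)))"
proof -
  \<comment> \<open>The negatives take care of signs, and 0 receives the mass that is missing to a
    convex combination.\<close>
  define W where "W = insert 0 (H \<union> uminus ` H)"
  have W: "finite W" "0 \<in> W" "\<And>w. w \<in> W \<Longrightarrow> norm w \<le> b" using H b by (auto simp: W_def)
  have cW: "card W \<le> 2 * N + 1"
  proof -
    have "card W \<le> Suc (card (H \<union> uminus ` H))" unfolding W_def by (rule card_insert_le_m1) auto
    also have "card (H \<union> uminus ` H) \<le> card H + card (uminus ` H)" by (rule card_Un_le)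
    also have "card (uminus ` H) \<le> card H" using H(1) by (rule card_image_le)
    finally show ?thesis using H(2) by linarith
  qed
  have cW1: "card W \<ge> 1" using W card_gt_0_iff by (metis One_nat_def Suc_leI empty_iff)
  obtain xs where xs: "set xs = W" "distinct xs" using finite_distinct_list[OF W(1)] by blast
  have len: "length xs = card W" using xs distinct_card by fastforce
  define L where "L = {l::nat list. length l = card W \<and> sum_list l = k}"
  define f where "f l = (1 / real k) *\<^sub>R (\<Sum>j<card W. real (l ! j) *\<^sub>R (xs ! j))" for l :: "nat list"
  have L: "finite L" unfolding L_def by (rule finite_sum_list_eq)
  have "card (f ` L) \<le> card L" by (rule card_image_le[OF L])
  also have "card L = (k + card W - 1) choose k" unfolding L_def by (rule card_length_sum_list)
  also have "\<dots> \<le> (2 * N + k) choose k" using cW by (intro binomial_right_mono) auto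
  finally have card: "card (f ` L) \<le> (2 * N + k) choose k" .
  have approx: "\<exists>s\<in>f ` L. norm ((\<Sum>h\<in>H. c h *\<^sub>R h) - s) \<le> b / sqrt (real k)" if c: "(\<Sum>h\<in>H. \<bar>c h\<bar>) \<le> 1" for c
  proof -
    \<comment> \<open>Different h can share the target \<open>sgn (c h) *\<^sub>R h\<close>, for
      instance when H contains a vector and its negative, so the weights are summed over h instead
      of being assigned to vectors.\<close>
    define q where "q h w = (if w = sgn (c h) *\<^sub>R h then \<bar>c h\<bar> else 0)" for h w
    define p where "p w = (\<Sum>h\<in>H. q h w) + (if w = 0 then 1 - (\<Sum>h\<in>H. \<bar>c h\<bar>) else 0)" for w
    have inW: "sgn (c h) *\<^sub>R h \<in> W" if "h \<in> H" for h
      using that by (cases "c h" "0::real" rule: linorder_cases) (auto simp: W_def)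
    have p0: "p w \<ge> 0" for w unfolding p_def q_def using c by (intro add_nonneg_nonneg sum_nonneg) auto
    have q1: "(\<Sum>w\<in>W. q h w) = \<bar>c h\<bar>" if "h \<in> H" for h
      using W(1) inW[OF that] by (simp add: q_def)
    have p1: "(\<Sum>w\<in>W. p w) = 1"
      unfolding p_def sum.distrib by (subst sum.swap) (simp add: q1 W(1,2))
    have q2: "(\<Sum>w\<in>W. q h w *\<^sub>R w) = c h *\<^sub>R h" if "h \<in> H" for h
    proof -
      have "(\<Sum>w\<in>W. q h w *\<^sub>R w) = (\<Sum>w\<in>W. if w = sgn (c h) *\<^sub>R h then \<bar>c h\<bar> *\<^sub>R w else 0)"
        by (intro sum.cong) (auto simp: q_def)
      also have "\<dots> = (\<bar>c h\<bar> * sgn (c h)) *\<^sub>R h" using W(1) inW[OF that] by simp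
      finally show ?thesis by (simp add: abs_mult_sgn)
    qed
    have pv: "(\<Sum>w\<in>W. p w *\<^sub>R w) = (\<Sum>h\<in>H. c h *\<^sub>R h)"
    proof -
      have "(\<Sum>w\<in>W. p w *\<^sub>R w) = (\<Sum>w\<in>W. \<Sum>h\<in>H. q h w *\<^sub>R w)"
        by (intro sum.cong) (auto simp: p_def scaleR_sum_left)
      also have "\<dots> = (\<Sum>h\<in>H. c h *\<^sub>R h)" by (subst sum.swap) (simp add: q2)
      finally show ?thesis .
    qed
    obtain m where m: "(\<Sum>w\<in>W. m w) = k"
      "(norm (real k *\<^sub>R (\<Sum>h\<in>H. c h *\<^sub>R h) - (\<Sum>w\<in>W. real (m w) *\<^sub>R w)))\<^sup>2 \<le> real k * b\<^sup>2"
      using maurey_approximation[OF W(1,3) p0 p1, of k] unfolding pv by blast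
    define l where "l = map m xs"
    have lL: "l \<in> L" using m(1) xs len by (auto simp: L_def l_def sum_list_distinct_conv_sum_set)
    have "(\<Sum>j<card W. real (l ! j) *\<^sub>R (xs ! j)) = (\<Sum>j<length xs. real (m (xs ! j)) *\<^sub>R (xs ! j))"
      using len by (intro sum.cong) (auto simp: l_def)
    also have "\<dots> = (\<Sum>w\<in>W. real (m w) *\<^sub>R w)"
      using sum.reindex_bij_betw[OF bij_betw_nth[OF xs(2) refl xs(1)[symmetric]], of "\<lambda>w. real (m w) *\<^sub>R w"]
      by simp
    finally have fl: "f l = (1 / real k) *\<^sub>R (\<Sum>w\<in>W. real (m w) *\<^sub>R w)" by (simp add: f_def)
    have "norm (real k *\<^sub>R (\<Sum>h\<in>H. c h *\<^sub>R h) - (\<Sum>w\<in>W. real (m w) *\<^sub>R w)) \<le> sqrt (real k * b\<^sup>2)"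
      using m(2) by (rule real_le_rsqrt)
    also have "\<dots> = sqrt (real k) * b" using b(2) by (simp add: real_sqrt_mult)
    finally have le: "norm (real k *\<^sub>R (\<Sum>h\<in>H. c h *\<^sub>R h) - (\<Sum>w\<in>W. real (m w) *\<^sub>R w)) \<le> sqrt (real k) * b" .
    have "(\<Sum>h\<in>H. c h *\<^sub>R h) - f l
        = (1 / real k) *\<^sub>R (real k *\<^sub>R (\<Sum>h\<in>H. c h *\<^sub>R h) - (\<Sum>w\<in>W. real (m w) *\<^sub>R w))"
      using k by (simp add: fl algebra_simps)
    then have "norm ((\<Sum>h\<in>H. c h *\<^sub>R h) - f l) \<le> (1 / real k) * (sqrt (real k) * b)"
      using le k by (simp add: divide_right_mono)
    also have "\<dots> = b / sqrt (real k)" using k by (simp add: field_simps)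
    finally show ?thesis using lL by blast
  qed
  show ?thesis using card approx L by blast
qed

text \<open>One term of the expansion of (1 + y)^(M + k) at y = 2^(-r). The parameter r is left free
  so that it can be tuned to the ratio of M and k.\<close>

lemma choose_le_powr:
  assumes "r \<ge> 0"
  shows "real ((M + k) choose k) \<le> 2 powr (2 * (2 powr - r) * real (M + k) + r * real k)"
proof -
  define y :: real where "y = 2 powr - r"
  have y: "y > 0" by (simp add: y_def)
  have "real ((M + k) choose k) * y ^ k \<le> (\<Sum>j\<le>M + k. real ((M + k) choose j) * y ^ j)"
    using y by (intro member_le_sum[of k "{..M+k}" "\<lambda>j. real ((M + k) choose j) * y ^ j"]) auto
  also have "\<dots> = (y + 1) ^ (M + k)" by (subst binomial_ring) simp
  also have "\<dots> \<le> exp y ^ (M + k)" using y exp_ge_add_one_self[of y] by (intro power_mono) (auto simp: add.commute)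
  also have "\<dots> = exp (real (M + k) * y)" by (rule exp_of_nat_mult[symmetric])
  also have "\<dots> \<le> exp (2 * y * real (M + k) * ln 2)"
  proof -
    have "1 \<le> 2 * ln (2::real)" using ln2_ge_two_thirds by simp
    then have "(real (M + k) * y) * 1 \<le> (real (M + k) * y) * (2 * ln 2)" using y by (intro mult_left_mono) auto
    moreover have "(real (M + k) * y) * (2 * ln 2) = 2 * y * real (M + k) * ln 2" by simp
    ultimately show ?thesis by (metis exp_le_cancel_iff mult.right_neutral)
  qed
  also have "\<dots> = 2 powr (2 * y * real (M + k))" by (simp add: powr_def)
  finally have "real ((M + k) choose k) * y ^ k \<le> 2 powr (2 * y * real (M + k))" .
  then have "real ((M + k) choose k) * y ^ k * 2 powr (r * real k) \<le> 2 powr (2 * y * real (M + k)) * 2 powr (r * real k)"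
    by (rule mult_right_mono) simp
  moreover have "y ^ k * 2 powr (r * real k) = 1"
    by (simp add: y_def powr_power powr_add[symmetric] mult.commute)
  ultimately have "real ((M + k) choose k) \<le> 2 powr (2 * y * real (M + k)) * 2 powr (r * real k)"
    by (simp add: mult.assoc)
  also have "\<dots> = 2 powr (2 * y * real (M + k) + r * real k)" by (rule powr_add[symmetric])
  finally show ?thesis unfolding y_def .
qed

lemma sum_div_2_power_le:
  assumes "a \<ge> 0" "b \<ge> (0::real)"
  shows "(\<Sum>i<m. (a + b * real i) / 2 ^ i) \<le> 2 * a + 2 * b"
proof -
  have "(\<Sum>i<m. (a + b * real i) / 2 ^ i) = 2 * a + 2 * b - (2 * a + 2 * b + 2 * b * real m) / 2 ^ m"
  proof (induction m)
    case (Suc m)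
    have "(2 * a + 2 * b + 2 * b * real m) / 2 ^ m
        = (a + b * real m) / 2 ^ m + (2 * a + 2 * b + 2 * b * real (Suc m)) / 2 ^ Suc m"
      by (simp add: field_simps)
    then show ?case unfolding sum.lessThan_Suc Suc by linarith
  qed simp
  then show ?thesis using assms by simp
qed

text \<open>Every distance to the critical level \<open>l0\<close> occurs at most twice, once on
  each side.\<close>

lemma sum_dist_le:
  fixes g :: "nat \<Rightarrow> real"
  assumes "\<And>i. g i \<ge> 0" and "\<And>m. (\<Sum>i<m. g i) \<le> c"
  shows "(\<Sum>l<m. g (if l < l0 then l0 - l else l - l0)) \<le> 2 * c"
proof -
  have "(\<Sum>l<m. g (if l < l0 then l0 - l else l - l0)) \<le> (\<Sum>l<l0 + m. g (if l < l0 then l0 - l else l - l0))"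
    using assms(1) by (intro sum_mono2) auto
  also have "\<dots> = (\<Sum>l<l0. g (l0 - l)) + (\<Sum>i<m. g i)"
  proof -
    have "{..<l0 + m} = {..<l0} \<union> {l0..<l0 + m}" by auto
    then have "(\<Sum>l<l0 + m. g (if l < l0 then l0 - l else l - l0))
        = (\<Sum>l<l0. g (if l < l0 then l0 - l else l - l0)) + (\<Sum>l\<in>{l0..<l0 + m}. g (if l < l0 then l0 - l else l - l0))"
      by (simp add: sum.union_disjoint ivl_disj_int)
    moreover have "(\<Sum>l\<in>{l0..<l0 + m}. g (if l < l0 then l0 - l else l - l0)) = (\<Sum>i<m. g i)"
      by (rule sum.reindex_bij_witness[of _ "\<lambda>i. i + l0" "\<lambda>l. l - l0"]) auto
    ultimately show ?thesis by simp
  qed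
  also have "(\<Sum>l<l0. g (l0 - l)) = (\<Sum>l<l0. g (Suc (l0 - Suc l)))" by (intro sum.cong) (auto simp: Suc_diff_Suc)
  also have "\<dots> = (\<Sum>l<l0. g (Suc l))" by (rule sum.nat_diff_reindex)
  also have "\<dots> \<le> (\<Sum>l<Suc l0. g l)" using assms(1)[of 0] by (simp add: sum.lessThan_Suc_shift del: sum.lessThan_Suc)
  finally show ?thesis using assms(2)[of "Suc l0"] assms(2)[of m] by linarith
qed

text \<open>The centres are sums of one centre per level: their numbers multiply, so the bits add
  up, and so do the radii.\<close>

lemma sum_cover:
  fixes S :: "nat \<Rightarrow> 'a::real_normed_vector set"
  assumes S: "\<And>l. l < L \<Longrightarrow> finite (S l)" "\<And>l. l < L \<Longrightarrow> real (card (S l)) \<le> 2 powr \<beta> l"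
  shows "\<exists>S'. finite S' \<and> real (card S') \<le> 2 powr (\<Sum>l<L. \<beta> l) \<and>
    (\<forall>v. (\<forall>l<L. \<exists>s\<in>S l. norm (v l - s) \<le> \<rho> l) \<longrightarrow> (\<exists>s\<in>S'. norm ((\<Sum>l<L. v l) - s) \<le> (\<Sum>l<L. \<rho> l)))"
proof (intro exI conjI allI impI)
  let ?P = "Pi\<^sub>E {..<L} S" and ?f = "\<lambda>f. \<Sum>l<L. f l"
  have fin: "finite ?P" using S(1) by (intro finite_PiE) auto
  then show "finite (?f ` ?P)" by simp
  have "real (card (?f ` ?P)) \<le> real (card ?P)" using card_image_le[OF fin] by simp
  also have "\<dots> = (\<Prod>l<L. real (card (S l)))" by (simp add: card_PiE)
  also have "\<dots> \<le> (\<Prod>l<L. 2 powr \<beta> l)" using S(2) by (intro prod_mono) auto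
  also have "\<dots> = 2 powr (\<Sum>l<L. \<beta> l)" by (simp add: powr_sum)
  finally show "real (card (?f ` ?P)) \<le> 2 powr (\<Sum>l<L. \<beta> l)" .
next
  fix v assume "\<forall>l<L. \<exists>s\<in>S l. norm (v l - s) \<le> \<rho> l"
  then obtain s where s: "\<And>l. l < L \<Longrightarrow> s l \<in> S l \<and> norm (v l - s l) \<le> \<rho> l" by metis
  have "(\<Sum>l<L. v l) - (\<Sum>l<L. restrict s {..<L} l) = (\<Sum>l<L. v l - s l)" by (simp add: sum_subtractf)
  also have "norm \<dots> \<le> (\<Sum>l<L. \<rho> l)" using s by (intro sum_norm_le) auto
  finally show "\<exists>s\<in>(\<lambda>f. \<Sum>l<L. f l) ` Pi\<^sub>E {..<L} S. norm ((\<Sum>l<L. v l) - s) \<le> (\<Sum>l<L. \<rho> l)"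
    using s by (intro bexI[of _ "\<Sum>l<L. restrict s {..<L} l"] imageI restrict_PiE_iff[THEN iffD2]) auto
qed

lemma entropy_number_le:
  assumes "finite S" "card S \<le> 2 ^ n" "\<epsilon> > 0" "\<And>v. v \<in> K \<Longrightarrow> \<exists>s\<in>S. norm (v - s) \<le> \<epsilon>"
  shows "entropy_number n K \<le> ereal \<epsilon>"
proof -
  have "K \<subseteq> (\<Union>s\<in>S. cball s \<epsilon>)" using assms(4) by (force simp: dist_norm norm_minus_commute)
  then show ?thesis unfolding entropy_number_def using assms(1-3) by (intro Inf_lower) blast
qed

lemma cover_closure:
  fixes A :: "'a::real_normed_vector set"
  assumes "finite S" "\<And>v. v \<in> A \<Longrightarrow> \<exists>s\<in>S. norm (v - s) \<le> \<epsilon>" "v \<in> closure A"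
  shows "\<exists>s\<in>S. norm (v - s) \<le> \<epsilon>"
proof -
  have "closed (\<Union>s\<in>S. cball s \<epsilon>)" using assms(1) by auto
  moreover have "A \<subseteq> (\<Union>s\<in>S. cball s \<epsilon>)" using assms(2) by (fastforce simp: dist_norm norm_minus_commute)
  ultimately have "v \<in> (\<Union>s\<in>S. cball s \<epsilon>)" using closure_minimal assms(3) by blast
  then show ?thesis by (auto simp: dist_norm norm_minus_commute[of v])
qed

text \<open>Carl's scheme: level \<open>l\<close> of the multilevel expansion is covered with Maurey's lemma, with the
  number of summands decaying geometrically away from the critical level \<open>l0\<close>, at which the number of
  vectors balances the available bits.\<close>

lemma co_cover_multilevel:
  fixes G :: "'a::real_inner set" and H :: "nat \<Rightarrow> 'a set" and e D :: nat
  assumes e: "e \<ge> 1" and s: "s \<ge> 2" and B: "B \<ge> 0"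
    and H: "\<And>l. finite (H l)" "\<And>l. card (H l) \<le> D * 2 ^ (e * l)"
    and Hb: "\<And>l h. h \<in> H l \<Longrightarrow> norm h \<le> B * 2 powr (- s * real l)"
    and G: "\<And>g. g \<in> G \<Longrightarrow> \<exists>C. \<forall>l. (\<Sum>h\<in>H l. \<bar>C l h\<bar>) \<le> 1 \<and>
        norm (g - (\<Sum>j<l. \<Sum>h\<in>H j. C j h *\<^sub>R h)) \<le> B * 2 powr (- s * real l)"
  obtains C0 :: nat where "C0 \<ge> 1"
    "\<And>l0. \<exists>S. finite S \<and> card S \<le> 2 ^ (C0 * 2 ^ (e * l0)) \<and>
      (\<forall>v\<in>co G. \<exists>s'\<in>S. norm (v - s') \<le> 5 * B * 2 powr (- (s + real e / 2) * real l0))"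
proof -
  \<comment> \<open>A level j below \<open>l0\<close> has vectors larger by 2^(s j). With 2^(a j)
    times more summands Maurey's lemma gains 2^(a j/2), at least 2^((s + 1) j), which leaves the
    factor 2^(-j) needed for summation.\<close>
  define a where "a = nat \<lceil>2 * s + 2\<rceil>"
  have a: "real a \<ge> 2 * s + 2" unfolding a_def by linarith
  define c1 where "c1 = real (4 * D + 2)"
  define c2 where "c2 = real ((2 * D + 1) * (e + a + 1))"
  have c: "c1 \<ge> 0" "c2 \<ge> 0" by (auto simp: c1_def c2_def)
  \<comment> \<open>The bracket bounds the one-sided sum of bits, the outer 2 accounts for both
    sides of \<open>l0\<close>, and the final 1 makes \<open>C0\<close> positive.\<close>
  define C0 where "C0 = nat \<lceil>2 * (2 * c1 + 2 * c2)\<rceil> + 1"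
  have "\<exists>S. finite S \<and> card S \<le> 2 ^ (C0 * 2 ^ (e * l0)) \<and>
      (\<forall>v\<in>co G. \<exists>s'\<in>S. norm (v - s') \<le> 5 * B * 2 powr (- (s + real e / 2) * real l0))" for l0
  proof -
    \<comment> \<open>Up to distance e l0 above \<open>l0\<close> the number 2^(e l0 - j) of
      summands is a genuine power of 2. Levels from \<open>L\<close> on are cut off, and as s >= 2
      their remainder is at most \<open>R\<close>.\<close>
    define L where "L = l0 + e * l0 + 1"
    define R where "R = B * 2 powr (- (s + real e / 2) * real l0)"
    have R: "R \<ge> 0" using B by (simp add: R_def)
    define i where "i l = (if l < l0 then l0 - l else l - l0)" for l
    define k :: "nat \<Rightarrow> nat" where "k l = (if l < l0 then 2 ^ (e * l0 + a * (l0 - l)) else 2 ^ (e * l0 - (l - l0)))" for l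
    have k1: "k l \<ge> 1" for l by (auto simp: k_def)
    define \<beta> where "\<beta> l = 2 ^ (e * l0) * ((c1 + c2 * real (i l)) / 2 ^ i l)" for l
    define \<rho> where "\<rho> l = R * (1 / 2 ^ i l)" for l
    define N where "N l = D * 2 ^ (e * l)" for l
    have bits: "real ((2 * N l + k l) choose k l) \<le> 2 powr \<beta> l" if l: "l < L" for l
    proof (cases "l < l0")
      case True
      define j where "j = l0 - l"
      have l0: "l0 = l + j" and j: "j \<ge> 1" using True by (auto simp: j_def)
      \<comment> \<open>On coarse levels \<open>k l\<close> outgrows the number of vectors, so the
        binomial coefficient is reflected below, and r is chosen to make 2^(-r) \<open>k l\<close>
        equal to 2^(e l).\<close>
      define r where "r = real ((e + a) * j)"
      have y: "2 powr - r = 1 / 2 ^ ((e + a) * j)" unfolding r_def powr_minus_divide by (subst powr_realpow) simp_all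
      have kl: "k l = 2 ^ (e * l + (e + a) * j)" using True by (simp add: k_def l0 algebra_simps)
      have yk: "2 powr - r * real (k l) = 2 ^ (e * l)" unfolding y kl by (simp add: power_add)
      have "2 powr - r * real (2 * N l) \<le> 1 * real (2 * N l)" by (intro mult_right_mono) (auto simp: y)
      then have yM: "2 powr - r * real (2 * N l) \<le> 2 * real D * 2 ^ (e * l)" by (simp add: N_def)
      have "real ((2 * N l + k l) choose k l) = real ((k l + 2 * N l) choose (2 * N l))"
        by (subst binomial_symmetric) (auto simp: add.commute)
      also have "\<dots> \<le> 2 powr (2 * (2 powr - r) * real (k l + 2 * N l) + r * real (2 * N l))"
        by (rule choose_le_powr) (simp add: r_def)
      also have "\<dots> \<le> 2 powr \<beta> l"
      proof (rule powr_mono)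
        have "2 * (2 powr - r) * real (k l + 2 * N l) + r * real (2 * N l)
          = 2 * (2 powr - r * real (k l)) + 2 * (2 powr - r * real (2 * N l)) + r * real (2 * N l)"
          by (simp add: algebra_simps)
        also have "\<dots> \<le> 2 * 2 ^ (e * l) + 2 * (2 * real D * 2 ^ (e * l)) + r * real (2 * N l)"
          using yM by (simp add: yk)
        also have "\<dots> = 2 ^ (e * l) * (c1 + real (2 * D * (e + a)) * real j)"
          by (simp add: c1_def r_def N_def algebra_simps)
        also have "\<dots> \<le> 2 ^ (e * l) * (c1 + c2 * real j)"
        proof -
          have "2 * D * (e + a) \<le> (2 * D + 1) * (e + a + 1)" by (intro mult_le_mono) auto
          then have "real (2 * D * (e + a)) \<le> c2" unfolding c2_def by (rule of_nat_mono)
          then show ?thesis by (intro mult_left_mono add_left_mono mult_right_mono) auto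
        qed
        also have "\<dots> \<le> \<beta> l"
        proof -
          have "1 * j \<le> e * j" using e by (intro mult_le_mono) auto
          then have pw: "(2::real) ^ j \<le> 2 ^ (e * j)" by (intro power_increasing) auto
          have "2 ^ (e * l) * (c1 + c2 * real j) * 2 ^ j \<le> 2 ^ (e * l) * (c1 + c2 * real j) * 2 ^ (e * j)"
            using c pw by (intro mult_left_mono) auto
          moreover have "\<beta> l * 2 ^ j = 2 ^ (e * l) * (c1 + c2 * real j) * 2 ^ (e * j)"
          proof -
            have "\<beta> l * 2 ^ j = 2 ^ (e * l0) * (c1 + c2 * real j)" using True by (simp add: \<beta>_def i_def j_def)
            also have "(2::real) ^ (e * l0) = 2 ^ (e * l) * 2 ^ (e * j)" by (simp add: l0 power_add distrib_left)
            finally show ?thesis by (simp only: mult_ac)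
          qed
          ultimately have "2 ^ (e * l) * (c1 + c2 * real j) * 2 ^ j \<le> \<beta> l * 2 ^ j" by simp
          then show ?thesis by (rule mult_right_le_imp_le) simp
        qed
        finally show "2 * (2 powr - r) * real (k l + 2 * N l) + r * real (2 * N l) \<le> \<beta> l" .
      qed simp
      finally show ?thesis .
    next
      case False
      define j where "j = l - l0"
      have lj: "l = l0 + j" using False by (auto simp: j_def)
      have j: "j \<le> e * l0" using l by (simp add: L_def lj)
      \<comment> \<open>On fine levels the vectors with signs outnumber the summands by 2^((e + 1)
        j) up to the constant 2 D; r compensates exactly this ratio.\<close>
      define r where "r = real ((e + 1) * j)"
      have y: "2 powr - r = 1 / 2 ^ ((e + 1) * j)" unfolding r_def powr_minus_divide by (subst powr_realpow) simp_all
      have kl: "real (k l) = 2 ^ (e * l0) / 2 ^ j"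
      proof -
        have "real (k l) = 2 ^ (e * l0 - j)" using False by (simp add: k_def lj)
        also have "\<dots> = 2 ^ (e * l0) / 2 ^ j" using j by (intro power_diff) auto
        finally show ?thesis .
      qed
      have yk: "2 powr - r * real (k l) \<le> real (k l)" by (rule mult_left_le_one_le) (auto simp: y)
      have yM: "2 powr - r * real (2 * N l) = 2 * real D * real (k l)"
      proof -
        have "(2::real) ^ ((e + 1) * j) = 2 ^ (e * j) * 2 ^ j" by (simp add: power_add distrib_right add.commute)
        moreover have "real (2 * N l) = 2 * real D * (2 ^ (e * l0) * 2 ^ (e * j))"
          by (simp add: N_def lj power_add distrib_left)
        ultimately show ?thesis unfolding y kl by simp
      qed
      have "real ((2 * N l + k l) choose k l) \<le> 2 powr (2 * (2 powr - r) * real (2 * N l + k l) + r * real (k l))"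
        by (rule choose_le_powr) (simp add: r_def)
      also have "\<dots> \<le> 2 powr \<beta> l"
      proof (rule powr_mono)
        have "2 * (2 powr - r) * real (2 * N l + k l) + r * real (k l)
          = 2 * (2 powr - r * real (k l)) + 2 * (2 powr - r * real (2 * N l)) + r * real (k l)"
          by (simp add: algebra_simps)
        also have "\<dots> \<le> 2 * real (k l) + 2 * (2 * real D * real (k l)) + r * real (k l)"
          using yk unfolding yM by simp
        also have "\<dots> = real (k l) * (c1 + real (1 * (e + 1)) * real j)"
          by (simp add: c1_def r_def algebra_simps)
        also have "\<dots> \<le> real (k l) * (c1 + c2 * real j)"
        proof -
          have "1 * (e + 1) \<le> (2 * D + 1) * (e + a + 1)" by (intro mult_le_mono) auto
          then have "real (1 * (e + 1)) \<le> c2" unfolding c2_def by (rule of_nat_mono)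
          then show ?thesis by (intro mult_left_mono add_left_mono mult_right_mono) auto
        qed
        also have "\<dots> = \<beta> l" using False by (simp add: kl \<beta>_def i_def j_def)
        finally show "2 * (2 powr - r) * real (2 * N l + k l) + r * real (k l) \<le> \<beta> l" .
      qed simp
      finally show ?thesis .
    qed
    have radius: "B * 2 powr (- s * real l) / sqrt (real (k l)) \<le> \<rho> l" if l: "l < L" for l
    proof -
      define q where "q = (if l < l0 then real (e * l0) + real a * real (i l) else real (e * l0) - real (i l))"
      have il: "i l \<le> e * l0" if "\<not> l < l0" using l that by (auto simp: L_def i_def)
      have "real (k l) = 2 powr q"
      proof (cases "l < l0")
        case True
        then have "q = real (e * l0 + a * i l)" by (simp add: q_def)
        then show ?thesis using True by (simp only: powr_realpow) (simp add: k_def i_def)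
      next
        case False
        then have "q = real (e * l0 - i l)" using il by (simp add: q_def of_nat_diff)
        then show ?thesis using False by (simp only: powr_realpow) (simp add: k_def i_def)
      qed
      then have "sqrt (real (k l)) = 2 powr (q / 2)" by (simp add: powr_half_sqrt[symmetric] powr_powr)
      then have "B * 2 powr (- s * real l) / sqrt (real (k l)) = B * 2 powr (- s * real l - q / 2)"
        by (simp add: powr_diff)
      also have "\<dots> \<le> B * 2 powr (- (s + real e / 2) * real l0 - real (i l))"
      proof (intro mult_left_mono powr_mono B)
        have lin: "- (s + real e / 2) * real l0 - real (i l) = - (s * real l0) - real (e * l0) / 2 - real (i l)"
          by (simp add: algebra_simps)
        show "- s * real l - q / 2 \<le> - (s + real e / 2) * real l0 - real (i l)"
        proof (cases "l < l0")
          case True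
          have "real (i l) * (2 * s + 2) \<le> real (i l) * real a" using a by (intro mult_left_mono) auto
          then have "2 * (s * real (i l)) + 2 * real (i l) \<le> real a * real (i l)" by (simp add: algebra_simps)
          moreover have "real l = real l0 - real (i l)" using True by (simp add: i_def of_nat_diff)
          then have "s * real l = s * real l0 - s * real (i l)" by (simp add: right_diff_distrib)
          moreover have "q = real (e * l0) + real a * real (i l)" using True by (simp add: q_def)
          ultimately show ?thesis unfolding lin by argo
        next
          case False
          have "real (i l) * 2 \<le> real (i l) * s" using s by (intro mult_left_mono) auto
          then have "2 * real (i l) \<le> s * real (i l)" by (simp add: mult.commute)
          moreover have "real l = real l0 + real (i l)" using False by (simp add: i_def of_nat_diff)
          then have "s * real l = s * real l0 + s * real (i l)" by (simp add: distrib_left)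
          moreover have "q = real (e * l0) - real (i l)" using False by (simp add: q_def)
          moreover have "0 \<le> real (i l)" by simp
          ultimately show ?thesis unfolding lin by argo
        qed
      qed simp
      also have "\<dots> = \<rho> l" by (simp add: \<rho>_def R_def powr_diff powr_realpow)
      finally show ?thesis .
    qed
    have "\<exists>S. finite S \<and> real (card S) \<le> 2 powr \<beta> l \<and>
        (\<forall>c. (\<Sum>h\<in>H l. \<bar>c h\<bar>) \<le> 1 \<longrightarrow> (\<exists>s'\<in>S. norm ((\<Sum>h\<in>H l. c h *\<^sub>R h) - s') \<le> \<rho> l))" if l: "l < L" for l
    proof -
      obtain S where S: "finite S" "card S \<le> (2 * N l + k l) choose k l"
        "\<And>c. (\<Sum>h\<in>H l. \<bar>c h\<bar>) \<le> 1 \<Longrightarrow> \<exists>s'\<in>S. norm ((\<Sum>h\<in>H l. c h *\<^sub>R h) - s') \<le> B * 2 powr (- s * real l) / sqrt (real (k l))"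
      proof -
        have b0: "0 \<le> B * 2 powr (- s * real l)" using B by simp
        show ?thesis using maurey_cover[OF H(1)[of l] H(2)[of l] Hb[of _ l] b0 k1[of l]] that unfolding N_def by blast
      qed
      have "real (card S) \<le> 2 powr \<beta> l" using S(2) bits[OF l] by linarith
      then show ?thesis using S radius[OF l] by (meson order_trans)
    qed
    then have "\<forall>l. \<exists>S. l < L \<longrightarrow> finite S \<and> real (card S) \<le> 2 powr \<beta> l \<and>
        (\<forall>c. (\<Sum>h\<in>H l. \<bar>c h\<bar>) \<le> 1 \<longrightarrow> (\<exists>s'\<in>S. norm ((\<Sum>h\<in>H l. c h *\<^sub>R h) - s') \<le> \<rho> l))" by blast
    from choice[OF this] obtain S where S: "\<And>l. l < L \<Longrightarrow> finite (S l)" "\<And>l. l < L \<Longrightarrow> real (card (S l)) \<le> 2 powr \<beta> l"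
      "\<And>l c. l < L \<Longrightarrow> (\<Sum>h\<in>H l. \<bar>c h\<bar>) \<le> 1 \<Longrightarrow> \<exists>s'\<in>S l. norm ((\<Sum>h\<in>H l. c h *\<^sub>R h) - s') \<le> \<rho> l"
      by blast
    from sum_cover[of L S \<beta> \<rho>, OF S(1,2)] obtain S' where S': "finite S'" "real (card S') \<le> 2 powr (\<Sum>l<L. \<beta> l)"
      "\<And>v. (\<And>l. l < L \<Longrightarrow> \<exists>s\<in>S l. norm (v l - s) \<le> \<rho> l) \<Longrightarrow> \<exists>s\<in>S'. norm ((\<Sum>l<L. v l) - s) \<le> (\<Sum>l<L. \<rho> l)"
      by blast
    have sum\<beta>: "(\<Sum>l<L. \<beta> l) \<le> real (C0 * 2 ^ (e * l0))"
    proof -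
      have "(\<Sum>l<L. \<beta> l) = 2 ^ (e * l0) * (\<Sum>l<L. (c1 + c2 * real (i l)) / 2 ^ i l)"
        by (simp add: \<beta>_def sum_distrib_left)
      also have "(\<Sum>l<L. (c1 + c2 * real (i l)) / 2 ^ i l) \<le> 2 * (2 * c1 + 2 * c2)"
        unfolding i_def by (rule sum_dist_le[of "\<lambda>i. (c1 + c2 * real i) / 2 ^ i"]) (use c sum_div_2_power_le in auto)
      also have "2 * (2 * c1 + 2 * c2) \<le> real C0" unfolding C0_def by linarith
      finally show ?thesis by (simp add: mult.commute)
    qed
    have sum\<rho>: "(\<Sum>l<L. \<rho> l) \<le> 4 * R"
    proof -
      have "(\<Sum>l<L. \<rho> l) = R * (\<Sum>l<L. 1 / 2 ^ i l)" by (simp add: \<rho>_def sum_distrib_left)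
      moreover have "(\<Sum>l<L. 1 / 2 ^ i l) \<le> 2 * (2 :: real)"
        unfolding i_def by (rule sum_dist_le[of "\<lambda>i. 1 / 2 ^ i"]) (use sum_div_2_power_le[of 1 0] in auto)
      ultimately show ?thesis using R mult_left_mono[of "\<Sum>l<L. 1 / 2 ^ i l" 4 R] by simp
    qed
    have "2 powr real (C0 * 2 ^ (e * l0)) = real (2 ^ (C0 * 2 ^ (e * l0)))"
      by (subst powr_realpow) auto
    then have "real (card S') \<le> real (2 ^ (C0 * 2 ^ (e * l0)))"
      using S'(2) powr_mono[OF sum\<beta>, of 2] by linarith
    then have card: "card S' \<le> 2 ^ (C0 * 2 ^ (e * l0))" by (rule of_nat_le_iff[THEN iffD1])
    have tail: "B * 2 powr (- s * real L) \<le> R"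
    proof -
      have "real (e * l0) * 2 \<le> real (e * l0) * s" using s by (intro mult_left_mono) auto
      then have "- s * real L \<le> - (s + real e / 2) * real l0"
      proof -
        have "s * real L = s * real l0 + real (e * l0) * s + s" by (simp add: L_def algebra_simps)
        moreover have "(s + real e / 2) * real l0 = s * real l0 + real (e * l0) / 2" by (simp add: algebra_simps)
        moreover have "0 \<le> real (e * l0)" by simp
        ultimately show ?thesis using s \<open>real (e * l0) * 2 \<le> real (e * l0) * s\<close> by linarith
      qed
      then show ?thesis unfolding R_def using B by (intro mult_left_mono powr_mono) auto
    qed
    have "\<exists>s'\<in>S'. norm (v - s') \<le> 5 * R" if "v \<in> co G" for v
    proof (rule cover_closure[OF S'(1) _ that[unfolded co_def]])
      fix v assume "v \<in> {\<Sum>g\<in>F. c g *\<^sub>R g |F c. finite F \<and> F \<subseteq> G \<and> (\<Sum>g\<in>F. \<bar>c g\<bar>) \<le> 1}"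
      then obtain F c where F: "finite F" "F \<subseteq> G" "(\<Sum>g\<in>F. \<bar>c g\<bar>) \<le> 1" and v: "v = (\<Sum>g\<in>F. c g *\<^sub>R g)" by blast
      have "\<forall>g\<in>F. \<exists>C. \<forall>l. (\<Sum>h\<in>H l. \<bar>C l h\<bar>) \<le> 1 \<and>
        norm (g - (\<Sum>j<l. \<Sum>h\<in>H j. C j h *\<^sub>R h)) \<le> B * 2 powr (- s * real l)" using G F(2) by blast
      from bchoice[OF this] obtain C where C: "\<And>g l. g \<in> F \<Longrightarrow> (\<Sum>h\<in>H l. \<bar>C g l h\<bar>) \<le> 1"
        "\<And>g l. g \<in> F \<Longrightarrow> norm (g - (\<Sum>j<l. \<Sum>h\<in>H j. C g j h *\<^sub>R h)) \<le> B * 2 powr (- s * real l)"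
        by blast
      \<comment> \<open>The coefficients of all g are combined on each level first, so that the part
        of v on a level again has coefficients of absolute sum at most 1.\<close>
      define w where "w l = (\<Sum>h\<in>H l. (\<Sum>g\<in>F. c g * C g l h) *\<^sub>R h)" for l
      have "\<exists>s\<in>S'. norm ((\<Sum>l<L. w l) - s) \<le> (\<Sum>l<L. \<rho> l)"
      proof (rule S'(3))
        fix l assume l: "l < L"
        have "(\<Sum>h\<in>H l. \<bar>\<Sum>g\<in>F. c g * C g l h\<bar>) \<le> (\<Sum>h\<in>H l. \<Sum>g\<in>F. \<bar>c g\<bar> * \<bar>C g l h\<bar>)"
          by (intro sum_mono order.trans[OF sum_abs]) (simp add: abs_mult)
        also have "\<dots> = (\<Sum>g\<in>F. \<bar>c g\<bar> * (\<Sum>h\<in>H l. \<bar>C g l h\<bar>))"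
          by (subst sum.swap) (simp add: sum_distrib_left)
        also have "\<dots> \<le> (\<Sum>g\<in>F. \<bar>c g\<bar> * 1)" using C(1) by (intro sum_mono mult_left_mono) auto
        also have "\<dots> \<le> 1" using F(3) by simp
        finally show "\<exists>s\<in>S l. norm (w l - s) \<le> \<rho> l" unfolding w_def by (rule S(3)[OF l])
      qed
      then obtain s' where s': "s' \<in> S'" "norm ((\<Sum>l<L. w l) - s') \<le> 4 * R" using sum\<rho> by fastforce
      have "(\<Sum>l<L. w l) = (\<Sum>g\<in>F. c g *\<^sub>R (\<Sum>l<L. \<Sum>h\<in>H l. C g l h *\<^sub>R h))"
      proof -
        have "w l = (\<Sum>g\<in>F. c g *\<^sub>R (\<Sum>h\<in>H l. C g l h *\<^sub>R h))" for l
          unfolding w_def scaleR_sum_left scaleR_sum_right by (subst sum.swap) simp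
        then show ?thesis by (simp add: scaleR_sum_right) (rule sum.swap)
      qed
      then have "v - (\<Sum>l<L. w l) = (\<Sum>g\<in>F. c g *\<^sub>R (g - (\<Sum>l<L. \<Sum>h\<in>H l. C g l h *\<^sub>R h)))"
        by (simp add: v sum_subtractf scaleR_diff_right)
      also have "norm \<dots> \<le> (\<Sum>g\<in>F. \<bar>c g\<bar> * R)"
      proof (rule sum_norm_le)
        fix g assume "g \<in> F"
        then show "norm (c g *\<^sub>R (g - (\<Sum>l<L. \<Sum>h\<in>H l. C g l h *\<^sub>R h))) \<le> \<bar>c g\<bar> * R"
          using C(2)[of g L] tail by (auto intro!: mult_left_mono)
      qed
      also have "\<dots> \<le> 1 * R" unfolding sum_distrib_right[symmetric] using F(3) R by (rule mult_right_mono)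
      finally have "norm (v - (\<Sum>l<L. w l)) \<le> R" by simp
      then have "norm (v - s') \<le> 5 * R" using s'(2) norm_triangle_ineq[of "v - (\<Sum>l<L. w l)" "(\<Sum>l<L. w l) - s'"] by simp
      then show "\<exists>s'\<in>S'. norm (v - s') \<le> 5 * R" using s'(1) by blast
    qed
    then show ?thesis using S'(1) card by (auto simp: R_def mult.assoc)
  qed
  then show ?thesis using that[of C0] by (simp add: C0_def)
qed

text \<open>The scheme gives radii only for bit counts C0 2^(e l0). For general n the largest such
  count not exceeding n is used, at the cost of the factor (C0 2^e)^alpha; for n < C0 a single ball
  of radius \<open>B\<close> does.\<close>

lemma entropy_bound_multilevel:
  fixes G :: "'a::real_inner set" and H :: "nat \<Rightarrow> 'a set" and e D :: nat
  assumes e: "e \<ge> 1" and s: "s \<ge> 2" and B: "B > 0"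
    and H: "\<And>l. finite (H l)" "\<And>l. card (H l) \<le> D * 2 ^ (e * l)"
    and Hb: "\<And>l h. h \<in> H l \<Longrightarrow> norm h \<le> B * 2 powr (- s * real l)"
    and G: "\<And>g. g \<in> G \<Longrightarrow> \<exists>C. \<forall>l. (\<Sum>h\<in>H l. \<bar>C l h\<bar>) \<le> 1 \<and>
        norm (g - (\<Sum>j<l. \<Sum>h\<in>H j. C j h *\<^sub>R h)) \<le> B * 2 powr (- s * real l)"
  shows "\<exists>C>0. entropy_bound (co G) C ((s + real e / 2) / real e)"
proof -
  define \<alpha> where "\<alpha> = (s + real e / 2) / real e"
  have \<alpha>: "\<alpha> > 0" using e s by (auto simp: \<alpha>_def intro!: divide_pos_pos add_pos_nonneg)
  obtain C0 where C0: "C0 \<ge> 1"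
    "\<And>l0. \<exists>S. finite S \<and> card S \<le> 2 ^ (C0 * 2 ^ (e * l0)) \<and>
      (\<forall>v\<in>co G. \<exists>s'\<in>S. norm (v - s') \<le> 5 * B * 2 powr (- (s + real e / 2) * real l0))"
    using co_cover_multilevel[OF e s less_imp_le[OF B] H Hb G] by metis
  have zero: "norm v \<le> B" if "v \<in> co G" for v
  proof -
    have "\<exists>s\<in>{0}. norm (v - s) \<le> B"
    proof (rule cover_closure[OF _ _ that[unfolded co_def]])
      fix v assume "v \<in> {\<Sum>g\<in>F. c g *\<^sub>R g |F c. finite F \<and> F \<subseteq> G \<and> (\<Sum>g\<in>F. \<bar>c g\<bar>) \<le> 1}"
      then obtain F c where F: "finite F" "F \<subseteq> G" "(\<Sum>g\<in>F. \<bar>c g\<bar>) \<le> 1" and v: "v = (\<Sum>g\<in>F. c g *\<^sub>R g)" by blast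
      have "norm g \<le> B" if "g \<in> G" for g using G[OF that] by (auto dest!: spec[of _ 0])
      then have "norm v \<le> (\<Sum>g\<in>F. \<bar>c g\<bar> * B)" unfolding v using F(2) by (intro sum_norm_le) (auto intro!: mult_left_mono)
      also have "\<dots> \<le> 1 * B" unfolding sum_distrib_right[symmetric] using F(3) B by (intro mult_right_mono) auto
      finally show "\<exists>s\<in>{0}. norm (v - s) \<le> B" by simp
    qed simp
    then show ?thesis by simp
  qed
  define C where "C = 5 * B * (real C0 * 2 ^ e) powr \<alpha>"
  have C0pos: "real C0 > 0" using C0(1) by simp
  have base: "real C0 * 2 ^ e > 0" using C0(1) by simp
  have C: "C > 0" unfolding C_def using B C0pos by (intro mult_pos_pos) auto
  have "entropy_number n (co G) \<le> ereal (C * real n powr (- \<alpha>))" if n: "n \<ge> 1" for n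
  proof (cases "n < C0")
    case True
    have "1 \<le> (real C0 * 2 ^ e / real n) powr \<alpha>"
    proof (rule ge_one_powr_ge_zero)
      have "real n * 1 \<le> real C0 * 2 ^ e" using True by (intro mult_mono) auto
      then show "1 \<le> real C0 * 2 ^ e / real n" using n by simp
    qed (use \<alpha> in simp)
    also have "\<dots> = (real C0 * 2 ^ e) powr \<alpha> * real n powr (- \<alpha>)"
      using base by (simp add: powr_divide powr_minus_divide)
    finally have "B * 1 \<le> (5 * B) * ((real C0 * 2 ^ e) powr \<alpha> * real n powr (- \<alpha>))"
      using B by (intro mult_mono) auto
    then have "B \<le> C * real n powr (- \<alpha>)" by (simp add: C_def mult.assoc)
    moreover have "entropy_number n (co G) \<le> ereal B"
      using B zero by (intro entropy_number_le[of "{0}"]) auto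
    ultimately show ?thesis using order_trans ereal_less_eq(3) by blast
  next
    case False
    define Q where "Q = {l. C0 * 2 ^ (e * l) \<le> n}"
    have "finite Q"
    proof (rule finite_subset)
      show "Q \<subseteq> {..n}"
      proof
        fix l assume "l \<in> Q"
        have "l \<le> 2 ^ l" by (simp add: less_imp_le)
        also have "\<dots> \<le> 2 ^ (e * l)" using e by (intro power_increasing) auto
        also have "\<dots> \<le> C0 * 2 ^ (e * l)" using C0(1) by simp
        finally show "l \<in> {..n}" using \<open>l \<in> Q\<close> by (simp add: Q_def)
      qed
    qed simp
    moreover have "0 \<in> Q" using False by (simp add: Q_def)
    ultimately have l0: "Max Q \<in> Q" using Max_in[of Q] by blast
    have "Suc (Max Q) \<notin> Q" using Max_ge[OF \<open>finite Q\<close>, of "Suc (Max Q)"] by force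
    define l0 where "l0 = Max Q"
    have l1: "C0 * 2 ^ (e * l0) \<le> n" using l0 by (simp add: Q_def l0_def)
    have l2: "n < C0 * 2 ^ (e * Suc l0)" using \<open>Suc (Max Q) \<notin> Q\<close> by (simp add: Q_def l0_def)
    obtain S where S: "finite S" "card S \<le> 2 ^ (C0 * 2 ^ (e * l0))"
      "\<And>v. v \<in> co G \<Longrightarrow> \<exists>s'\<in>S. norm (v - s') \<le> 5 * B * 2 powr (- (s + real e / 2) * real l0)"
      using C0(2)[of l0] by blast
    have "card S \<le> 2 ^ n" using S(2) power_increasing[OF l1, of "2::nat"] by linarith
    then have "entropy_number n (co G) \<le> ereal (5 * B * 2 powr (- (s + real e / 2) * real l0))"
      using B by (intro entropy_number_le[OF S(1) _ _ S(3)]) auto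
    moreover have "5 * B * 2 powr (- (s + real e / 2) * real l0) \<le> C * real n powr (- \<alpha>)"
    proof -
      have "- (s + real e / 2) * real l0 = real (e * l0) * (- \<alpha>)"
      proof -
        have "real e * \<alpha> = s + real e / 2" using e by (simp add: \<alpha>_def)
        then have "- (s + real e / 2) * real l0 = - (real e * \<alpha>) * real l0" by (simp only:)
        then show ?thesis by simp
      qed
      then have "2 powr (- (s + real e / 2) * real l0) = (2 powr real (e * l0)) powr (- \<alpha>)"
        by (simp only: powr_powr)
      also have "2 powr real (e * l0) = (2::real) ^ (e * l0)" by (rule powr_realpow) simp
      finally have "2 powr (- (s + real e / 2) * real l0) = (2 ^ (e * l0)) powr (- \<alpha>)" .
      also have "\<dots> \<le> (real n / (real C0 * 2 ^ e)) powr (- \<alpha>)"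
      proof (rule powr_mono2')
        have "real n < real (C0 * 2 ^ (e * Suc l0))" using l2 by (rule of_nat_less_iff[THEN iffD2])
        also have "\<dots> = 2 ^ (e * l0) * (real C0 * 2 ^ e)" by (simp add: power_add)
        finally show "real n / (real C0 * 2 ^ e) \<le> 2 ^ (e * l0)" using base by (simp add: pos_divide_le_eq)
      qed (use \<alpha> base n in auto)
      also have "\<dots> = (real C0 * 2 ^ e) powr \<alpha> * real n powr (- \<alpha>)"
        using base n by (simp add: powr_divide powr_minus_divide)
      finally have "(5 * B) * 2 powr (- (s + real e / 2) * real l0)
          \<le> (5 * B) * ((real C0 * 2 ^ e) powr \<alpha> * real n powr (- \<alpha>))"
        using B by (intro mult_left_mono) auto
      then show ?thesis by (simp add: C_def mult.assoc)
    qed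
    ultimately show ?thesis using order_trans ereal_less_eq(3) by blast
  qed
  then have "entropy_bound (co G) C \<alpha>" by (simp add: entropy_bound_def)
  then show ?thesis using C unfolding \<alpha>_def by blast
qed

section \<open>Volume comparison with a covering, and estimates for products\<close>

lemma distr_PiM_translate:
  assumes "finite I"
  shows "distr (\<Pi>\<^sub>M i\<in>I. lborel) (\<Pi>\<^sub>M i\<in>I. lborel) (\<lambda>x. \<lambda>i\<in>I. a i + x i) = (\<Pi>\<^sub>M i\<in>I. (lborel::real measure))"
proof -
  interpret product_sigma_finite "\<lambda>_. lborel::real measure" by standard
  let ?P = "\<Pi>\<^sub>M i\<in>I. (lborel::real measure)"
  show ?thesis
  proof (rule PiM_eqI)
    fix A :: "_ \<Rightarrow> real set" assume A: "\<And>i. i \<in> I \<Longrightarrow> A i \<in> sets lborel"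
    have vim: "(\<lambda>x. a i + x) -` A i \<in> sets lborel" if "i \<in> I" for i
      using measurable_sets[of "\<lambda>x. a i + x" lborel lborel "A i"] A[OF that] by simp
    have "emeasure (distr ?P ?P (\<lambda>x. \<lambda>i\<in>I. a i + x i)) (Pi\<^sub>E I A)
        = emeasure ?P ((\<lambda>x. \<lambda>i\<in>I. a i + x i) -` Pi\<^sub>E I A \<inter> space ?P)"
      using A assms by (intro emeasure_distr sets_PiM_I_finite) auto
    also have "(\<lambda>x. \<lambda>i\<in>I. a i + x i) -` Pi\<^sub>E I A \<inter> space ?P = Pi\<^sub>E I (\<lambda>i. (\<lambda>x. a i + x) -` A i)"
      by (auto simp: space_PiM PiE_iff)
    also have "emeasure ?P \<dots> = (\<Prod>i\<in>I. emeasure lborel ((\<lambda>x. a i + x) -` A i))"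
      using assms vim by (rule emeasure_PiM)
    also have "\<dots> = (\<Prod>i\<in>I. emeasure lborel (A i))"
    proof (rule prod.cong[OF refl])
      fix i assume "i \<in> I"
      have "emeasure lborel (A i) = emeasure (distr lborel borel ((+) (a i))) (A i)"
        by (simp add: lborel_distr_plus)
      also have "\<dots> = emeasure lborel ((\<lambda>x. a i + x) -` A i)"
        using A[OF \<open>i \<in> I\<close>] by (subst emeasure_distr) auto
      finally show "emeasure lborel ((\<lambda>x. a i + x) -` A i) = emeasure lborel (A i)" ..
    qed
    finally show "emeasure (distr ?P ?P (\<lambda>x. \<lambda>i\<in>I. a i + x i)) (Pi\<^sub>E I A) = (\<Prod>i\<in>I. emeasure lborel (A i))" .
  qed (use assms in auto)
qed

lemma emeasure_PiM_cball:
  fixes a :: "nat \<Rightarrow> real"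
  assumes "r > 0"
  shows "emeasure (\<Pi>\<^sub>M i\<in>{..<n}. lborel) {x \<in> space (\<Pi>\<^sub>M i\<in>{..<n}. lborel). sqrt (\<Sum>i<n. (x i - a i)\<^sup>2) \<le> r}
    = ennreal (unit_ball_vol (real n) * r ^ n)"
proof -
  let ?P = "\<Pi>\<^sub>M i\<in>{..<n}. (lborel::real measure)"
  let ?T = "\<lambda>x. \<lambda>i\<in>{..<n}. - a i + x i"
  have meas: "{f. sqrt (\<Sum>i<n. (f i)\<^sup>2) \<le> r} \<inter> space ?P \<in> sets ?P"
  proof -
    have "{f. sqrt (\<Sum>i<n. (f i)\<^sup>2) \<le> r} \<inter> space ?P = {f \<in> space ?P. sqrt (\<Sum>i<n. (f i)\<^sup>2) \<le> r}" by auto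
    also have "\<dots> \<in> sets ?P" by measurable
    finally show ?thesis .
  qed
  have "ennreal (unit_ball_vol (real n) * r ^ n) = emeasure ?P ({f. sqrt (\<Sum>i<n. (f i)\<^sup>2) \<le> r} \<inter> space ?P)"
    using emeasure_cball_aux[of "{..<n}" r] assms by simp
  also have "\<dots> = emeasure (distr ?P ?P ?T) ({f. sqrt (\<Sum>i<n. (f i)\<^sup>2) \<le> r} \<inter> space ?P)"
    by (subst distr_PiM_translate) auto
  also have "\<dots> = emeasure ?P (?T -` ({f. sqrt (\<Sum>i<n. (f i)\<^sup>2) \<le> r} \<inter> space ?P) \<inter> space ?P)"
    using meas by (intro emeasure_distr) auto
  also have "?T -` ({f. sqrt (\<Sum>i<n. (f i)\<^sup>2) \<le> r} \<inter> space ?P) \<inter> space ?P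
      = {x \<in> space ?P. sqrt (\<Sum>i<n. (x i - a i)\<^sup>2) \<le> r}"
    by (auto simp: space_PiM)
  finally show ?thesis by simp
qed

lemma bessel_inequality:
  fixes e :: "nat \<Rightarrow> 'a::real_inner"
  assumes "\<And>i j. i < n \<Longrightarrow> j < n \<Longrightarrow> e i \<bullet> e j = (if i = j then 1 else 0)"
  shows "(\<Sum>i<n. (v \<bullet> e i)\<^sup>2) \<le> (norm v)\<^sup>2"
proof -
  define w where "w = (\<Sum>i<n. (v \<bullet> e i) *\<^sub>R e i)"
  have vw: "v \<bullet> w = (\<Sum>i<n. (v \<bullet> e i)\<^sup>2)" by (simp add: w_def inner_sum_right power2_eq_square)
  have we: "w \<bullet> e i = v \<bullet> e i" if "i < n" for i
  proof -
    have "w \<bullet> e i = (\<Sum>j<n. if j = i then v \<bullet> e j else 0)"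
      unfolding w_def inner_sum_left using assms that by (intro sum.cong) auto
    then show ?thesis using that by simp
  qed
  have "w \<bullet> w = (\<Sum>i<n. (v \<bullet> e i) * (w \<bullet> e i))"
    by (subst (2) w_def) (simp add: inner_sum_right)
  also have "\<dots> = (\<Sum>i<n. (v \<bullet> e i)\<^sup>2)" using we by (intro sum.cong) (auto simp: power2_eq_square)
  finally have "w \<bullet> w = v \<bullet> w" using vw by simp
  moreover have "0 \<le> (v - w) \<bullet> (v - w)" by simp
  ultimately have "v \<bullet> w \<le> v \<bullet> v" by (simp add: inner_diff_left inner_diff_right inner_commute)
  then show ?thesis using vw by (simp add: power2_norm_eq_inner)
qed

text \<open>Comparison of volumes after projecting onto the span of \<open>e\<close>: a covering of a set containing the
  absolutely convex hull of the \<open>g j\<close> covers a skewed cross-polytope.\<close>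

lemma prod_diagonal_le_of_cover:
  fixes e g :: "nat \<Rightarrow> 'a::real_inner"
  assumes orth: "\<And>i j. i < n \<Longrightarrow> j < n \<Longrightarrow> e i \<bullet> e j = (if i = j then 1 else 0)"
    and tri: "\<And>i j. j < i \<Longrightarrow> i < n \<Longrightarrow> g j \<bullet> e i = 0"
    and diag: "\<And>j. j < n \<Longrightarrow> g j \<bullet> e j > 0"
    and K: "\<And>c. (\<Sum>j<n. \<bar>c j\<bar>) \<le> 1 \<Longrightarrow> (\<Sum>j<n. c j *\<^sub>R g j) \<in> K"
    and S: "finite S" "card S \<le> 2 ^ n" "K \<subseteq> (\<Union>s\<in>S. cball s \<epsilon>)" and n: "n \<ge> 1" and eps: "\<epsilon> > 0"
  shows "(\<Prod>j<n. g j \<bullet> e j) \<le> (sqrt (5 * real n) * \<epsilon>) ^ n"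
proof -
  let ?P = "\<Pi>\<^sub>M i\<in>{..<n}. (lborel::real measure)"
  define B where "B s = {x \<in> space ?P. sqrt (\<Sum>i<n. (x i - s \<bullet> e i)\<^sup>2) \<le> \<epsilon>}" for s
  have Bm: "B s \<in> sets ?P" for s unfolding B_def by measurable
  have "ennreal ((2 * 1) ^ n / fact n * (\<Prod>i<n. g i \<bullet> e i)) \<le> emeasure ?P (\<Union>s\<in>S. B s)"
  proof (rule emeasure_cross_polytope_ge[where M = "\<lambda>i j. g j \<bullet> e i" and b = "\<lambda>_. 0"])
    show "(\<Union>s\<in>S. B s) \<in> sets ?P" using Bm S(1) by auto
    fix c :: "nat \<Rightarrow> real" assume c: "(\<Sum>j<n. \<bar>c j\<bar>) \<le> 1"
    define v where "v = (\<Sum>j<n. c j *\<^sub>R g j)"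
    obtain s where s: "s \<in> S" "dist s v \<le> \<epsilon>" using K[OF c] S(3) by (auto simp: v_def)
    \<comment> \<open>These are the coordinates of v along \<open>e\<close>; triangularity removes
      the terms with j < i.\<close>
    define x where "x = (\<lambda>i\<in>{..<n}. 0 + (\<Sum>j\<in>{i..<n}. g j \<bullet> e i * c j))"
    have x: "x i = v \<bullet> e i" if "i < n" for i
    proof -
      have "v \<bullet> e i = (\<Sum>j<n. g j \<bullet> e i * c j)" by (simp add: v_def inner_sum_left mult.commute)
      also have "\<dots> = (\<Sum>j\<in>{i..<n}. g j \<bullet> e i * c j)"
        using tri that by (intro sum.mono_neutral_right) auto
      finally show ?thesis using that by (simp add: x_def)
    qed
    have "(\<Sum>i<n. (x i - s \<bullet> e i)\<^sup>2) = (\<Sum>i<n. ((v - s) \<bullet> e i)\<^sup>2)"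
      by (intro sum.cong) (auto simp: x inner_diff_left)
    also have "\<dots> \<le> (norm (v - s))\<^sup>2" by (rule bessel_inequality[OF orth])
    finally have "sqrt (\<Sum>i<n. (x i - s \<bullet> e i)\<^sup>2) \<le> norm (v - s)" by (rule real_le_lsqrt[rotated]) auto
    then have "x \<in> B s" using s(2) by (auto simp: B_def space_PiM x_def dist_norm norm_minus_commute)
    then show "(\<lambda>i\<in>{..<n}. 0 + (\<Sum>j\<in>{i..<n}. g j \<bullet> e i * c j)) \<in> (\<Union>s\<in>S. B s)" using s(1) by (auto simp: x_def)
  qed (use diag in auto)
  also have "\<dots> \<le> (\<Sum>s\<in>S. emeasure ?P (B s))" using Bm S(1) by (intro emeasure_subadditive_finite) auto
  also have "\<dots> = ennreal (real (card S) * (unit_ball_vol (real n) * \<epsilon> ^ n))"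
    unfolding B_def emeasure_PiM_cball[OF eps] using eps
    by (simp add: ennreal_of_nat_eq_real_of_nat ennreal_mult[symmetric])
  finally have "(2 * 1) ^ n / fact n * (\<Prod>i<n. g i \<bullet> e i) \<le> real (card S) * (unit_ball_vol (real n) * \<epsilon> ^ n)"
    using eps by (subst (asm) ennreal_le_iff) auto
  also have "real (card S) \<le> 2 ^ n" using S(2) by (metis numeral_power_le_of_nat_cancel_iff of_nat_le_iff of_nat_numeral of_nat_power)
  finally have "2 ^ n / fact n * (\<Prod>i<n. g i \<bullet> e i) \<le> 2 ^ n * (unit_ball_vol (real n) * \<epsilon> ^ n)"
    using eps by (simp add: mult_right_mono)
  then have "(\<Prod>i<n. g i \<bullet> e i) \<le> (fact n * unit_ball_vol (real n)) * \<epsilon> ^ n"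
    by (simp add: field_simps)
  also have "\<dots> \<le> sqrt (5 * real n) ^ n * \<epsilon> ^ n"
    using eps fact_mult_unit_ball_vol_le[OF n] by (intro mult_right_mono) auto
  finally show ?thesis by (simp add: power_mult_distrib)
qed

lemma prod_le_mean_power:
  fixes a :: "nat \<Rightarrow> real"
  assumes "\<And>i. i < n \<Longrightarrow> a i \<ge> 0" "n \<ge> 1" "(\<Sum>i<n. a i) \<le> s"
  shows "(\<Prod>i<n. a i) \<le> (s / real n) ^ n"
proof -
  have nn: "0 \<le> (\<Prod>i<n. a i)" using assms(1) by (intro prod_nonneg) auto
  have "{..<n} \<noteq> {}" using assms(2) by (auto simp: lessThan_empty_iff)
  then have "(\<Prod>i<n. a i) powr (1 / real n) \<le> (\<Sum>i<n. a i) / real n"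
    using arith_geom_mean[of "{..<n}" a] assms(1) by (simp add: sum_divide_distrib)
  then have "root n (\<Prod>i<n. a i) \<le> (\<Sum>i<n. a i) / real n"
  proof -
    define p where "p = (\<Prod>i<n. a i)"
    have "p powr (1 / real n) = root n p" using nn assms(2)
      by (cases "p = 0") (simp_all add: p_def[symmetric] root_powr_inverse)
    then show ?thesis using \<open>(\<Prod>i<n. a i) powr (1 / real n) \<le> (\<Sum>i<n. a i) / real n\<close> by (simp add: p_def)
  qed
  also have "\<dots> \<le> s / real n" using assms(3) by (simp add: divide_right_mono)
  finally have le: "root n (\<Prod>i<n. a i) \<le> s / real n" .
  have "(\<Prod>i<n. a i) = root n (\<Prod>i<n. a i) ^ n" using assms(2) nn by simp
  also have "\<dots> \<le> (s / real n) ^ n" using le nn assms(2) by (intro power_mono) auto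
  finally show ?thesis .
qed

lemma ex_le_of_prod_le:
  fixes G :: "nat \<Rightarrow> real"
  assumes "n \<ge> 1" "B \<ge> 0" "(\<Prod>j<n. G j) \<le> B ^ n"
  shows "\<exists>j<n. G j \<le> B"
proof (rule ccontr)
  assume "\<not> ?thesis"
  then have gt: "\<And>j. j < n \<Longrightarrow> G j > B" by force
  have "(\<Prod>j<n. B) < (\<Prod>j<n. G j)"
    using gt assms(1,2) by (intro prod_mono_strict) (auto simp: lessThan_empty_iff intro: less_imp_le le_less_trans)
  then show False using assms(3) by simp
qed

section \<open>Greedy kernel interpolation\<close>

lemma span_image_finite:
  fixes f :: "'b \<Rightarrow> 'a::real_vector"
  assumes "finite X" "v \<in> span (f ` X)"
  shows "\<exists>c. v = (\<Sum>x\<in>X. c x *\<^sub>R f x)"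
  using assms
proof (induction arbitrary: v)
  case (insert a X)
  obtain k where "v - k *\<^sub>R f a \<in> span (f ` X)" using insert.prems by (auto simp: span_insert)
  then obtain c where c: "v - k *\<^sub>R f a = (\<Sum>x\<in>X. c x *\<^sub>R f x)" using insert.IH by blast
  have "(\<Sum>x\<in>X. (c(a := k)) x *\<^sub>R f x) = (\<Sum>x\<in>X. c x *\<^sub>R f x)"
    using insert.hyps by (intro sum.cong) auto
  then have "v = (\<Sum>x\<in>insert a X. (c(a := k)) x *\<^sub>R f x)"
    using insert.hyps c by (simp add: algebra_simps)
  then show ?case by blast
qed auto

locale kernel_space =
  fixes \<Omega> :: "'a set" and k :: "'a \<Rightarrow> 'a \<Rightarrow> real"
    and ev :: "'h::{real_inner,complete_space} \<Rightarrow> 'a \<Rightarrow> real"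
  assumes rkhs: "rkhs \<Omega> k ev" and spd: "strictly_positive_definite_on \<Omega> k"
    and diag_le_1: "\<And>x. x \<in> \<Omega> \<Longrightarrow> k x x \<le> 1"
begin

abbreviation "\<phi> \<equiv> kernel_section \<Omega> k ev"
abbreviation "V \<equiv> trial_space \<Omega> k ev"
abbreviation "I \<equiv> interpolant \<Omega> k ev"
abbreviation "P \<equiv> power_function \<Omega> k ev"

lemma kernel_section:
  assumes "x \<in> \<Omega>"
  shows "\<And>y. y \<in> \<Omega> \<Longrightarrow> ev (\<phi> x) y = k y x" and "\<And>f. ev f x = f \<bullet> \<phi> x"
proof -
  obtain p where p: "\<forall>y\<in>\<Omega>. ev p y = k y x" "\<forall>f. ev f x = f \<bullet> p"
    using rkhs assms unfolding rkhs_def by blast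
  have "\<phi> x = p"
    unfolding kernel_section_def
  proof (rule the_equality)
    fix q assume q: "\<forall>y\<in>\<Omega>. ev q y = k y x"
    then have "\<forall>y\<in>\<Omega>. ev q y = ev p y" using p(1) by simp
    then show "q = p" using rkhs unfolding rkhs_def by blast
  qed (rule p(1))
  then show "\<And>y. y \<in> \<Omega> \<Longrightarrow> ev (\<phi> x) y = k y x" and "\<And>f. ev f x = f \<bullet> \<phi> x" using p by auto
qed

lemma inner_kernel_section: "x \<in> \<Omega> \<Longrightarrow> y \<in> \<Omega> \<Longrightarrow> \<phi> x \<bullet> \<phi> y = k x y"
  using kernel_section spd by (metis inner_commute)

lemma norm_kernel_section_le: "x \<in> \<Omega> \<Longrightarrow> norm (\<phi> x) \<le> 1"
  using inner_kernel_section[of x x] diag_le_1[of x] by (simp add: norm_eq_sqrt_inner)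

lemma abs_ev_le: "x \<in> \<Omega> \<Longrightarrow> \<bar>ev f x\<bar> \<le> norm f"
  using kernel_section(2)[of x f] Cauchy_Schwarz_ineq2[of f "\<phi> x"] norm_kernel_section_le[of x]
  by (metis mult.right_neutral mult_left_mono norm_ge_zero order_trans)

lemma spd_sym: "x \<in> \<Omega> \<Longrightarrow> y \<in> \<Omega> \<Longrightarrow> k x y = k y x"
  using spd by (auto simp: strictly_positive_definite_on_def)

text \<open>A linear dependence would make the quadratic form of \<open>k\<close> vanish at a
  coefficient vector whose entry at \<open>x\<close> is 1.\<close>

lemma kernel_section_notin_span:
  assumes "finite X" "X \<subseteq> \<Omega>" "x \<in> \<Omega> - X"
  shows "\<phi> x \<notin> span (\<phi> ` X)"
proof
  assume "\<phi> x \<in> span (\<phi> ` X)"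
  then obtain c where c: "\<phi> x = (\<Sum>y\<in>X. c y *\<^sub>R \<phi> y)" using span_image_finite[OF assms(1)] by blast
  define c' where "c' y = (if y = x then 1 else - c y)" for y
  have "(\<Sum>y\<in>X. c' y *\<^sub>R \<phi> y) = (\<Sum>y\<in>X. - (c y *\<^sub>R \<phi> y))"
    using assms(3) by (intro sum.cong) (auto simp: c'_def)
  then have "(\<Sum>y\<in>insert x X. c' y *\<^sub>R \<phi> y) = 0"
    using assms c by (simp add: c'_def sum_negf)
  moreover have kk: "k y z = \<phi> z \<bullet> \<phi> y" if "y \<in> insert x X" "z \<in> insert x X" for y z
  proof -
    have "y \<in> \<Omega>" "z \<in> \<Omega>" using that assms by auto
    then show ?thesis using spd_sym[of y z] inner_kernel_section[of z y] by simp
  qed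
  moreover from kk have "(\<Sum>y\<in>insert x X. \<Sum>z\<in>insert x X. c' y * c' z * k y z)
      = (\<Sum>y\<in>insert x X. c' y *\<^sub>R \<phi> y) \<bullet> (\<Sum>z\<in>insert x X. c' z *\<^sub>R \<phi> z)"
    unfolding inner_sum_right inner_sum_left
    by (intro sum.cong refl) (simp add: kk)
  moreover have "(\<Sum>y\<in>insert x X. \<Sum>z\<in>insert x X. c' y * c' z * k y z) > 0"
    using spd assms unfolding strictly_positive_definite_on_def
    by (elim conjE allE[of _ "insert x X"] allE[of _ c']) (auto simp: c'_def)
  ultimately show False by simp
qed

text \<open>Evaluation at x is the inner product with \<open>\<phi> x\<close>. Interpolation on
  \<open>X\<close> therefore means that the residual is orthogonal to the generators of
  \<open>V X\<close>, and interpolant and projection are the same vector.\<close>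

lemma interpolant_props:
  assumes "finite X" "X \<subseteq> \<Omega>"
  shows "I X f \<in> V X" and "\<And>x. x \<in> X \<Longrightarrow> ev (f - I X f) x = 0" and "orth_proj (V X) f = I X f"
    and "\<And>s. s \<in> V X \<Longrightarrow> (\<And>x. x \<in> X \<Longrightarrow> (f - s) \<bullet> \<phi> x = 0) \<Longrightarrow> s = I X f"
    and "\<And>v. v \<in> V X \<Longrightarrow> (f - I X f) \<bullet> v = 0"
proof -
  obtain s where s: "s \<in> V X" "\<And>v. v \<in> V X \<Longrightarrow> orthogonal (f - s) v"
    using ex_orth_proj_span[of "\<phi> ` X" f] assms(1) unfolding trial_space_def by auto
  have inV: "\<phi> x \<in> V X" if "x \<in> X" for x
    unfolding trial_space_def using that by (intro span_base) auto
  have uniq: "t = s" if "t \<in> V X" "\<And>x. x \<in> X \<Longrightarrow> (f - t) \<bullet> \<phi> x = 0" for t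
  proof (rule orth_proj_span_unique[of t "\<phi> ` X" f s])
    show "(f - s) \<bullet> v = 0" if "v \<in> \<phi> ` X" for v
      using s(2)[of v] that inV by (auto simp: orthogonal_def)
    show "(f - t) \<bullet> v = 0" if "v \<in> \<phi> ` X" for v
      using \<open>\<And>x. x \<in> X \<Longrightarrow> (f - t) \<bullet> \<phi> x = 0\<close> that by auto
  qed (use \<open>t \<in> V X\<close> s(1) in \<open>simp_all add: trial_space_def\<close>)
  have ev_iff: "ev t x = ev f x \<longleftrightarrow> (f - t) \<bullet> \<phi> x = 0" if "x \<in> X" for t x
    using that assms(2) kernel_section(2)[of x] by (auto simp: inner_diff_left)
  have sx: "(f - s) \<bullet> \<phi> x = 0" if "x \<in> X" for x
    using s(2)[OF inV[OF that]] by (simp add: orthogonal_def)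
  have I: "I X f = s" unfolding interpolant_def
  proof (rule the_equality)
    show "s \<in> V X \<and> (\<forall>x\<in>X. ev s x = ev f x)" using s(1) sx ev_iff by simp
    show "t = s" if "t \<in> V X \<and> (\<forall>x\<in>X. ev t x = ev f x)" for t
      by (rule uniq) (use that ev_iff in simp_all)
  qed
  have O: "orth_proj (V X) f = s" unfolding orth_proj_def
  proof (rule the_equality)
    fix t assume t: "t \<in> V X \<and> (\<forall>v\<in>V X. orthogonal (f - t) v)"
    show "t = s"
    proof (rule uniq)
      show "(f - t) \<bullet> \<phi> x = 0" if "x \<in> X" for x
        using t inV[OF that] by (auto simp: orthogonal_def)
    qed (use t in simp)
  qed (use s in auto)
  show "I X f \<in> V X" "orth_proj (V X) f = I X f" using s(1) I O by auto
  show "\<And>x. x \<in> X \<Longrightarrow> ev (f - I X f) x = 0" using sx kernel_section(2) assms(2) I by auto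
  show "\<And>s. s \<in> V X \<Longrightarrow> (\<And>x. x \<in> X \<Longrightarrow> (f - s) \<bullet> \<phi> x = 0) \<Longrightarrow> s = I X f" using uniq I by auto
  show "\<And>v. v \<in> V X \<Longrightarrow> (f - I X f) \<bullet> v = 0" using s(2) I by (auto simp: orthogonal_def)
qed

lemma power_function_eq:
  assumes "finite X" "X \<subseteq> \<Omega>"
  shows "P X x = norm (\<phi> x - I X (\<phi> x))"
  using interpolant_props(3)[OF assms, of "\<phi> x"] by (simp add: power_function_def)

lemma power_function_pos:
  assumes "finite X" "X \<subseteq> \<Omega>" "x \<in> \<Omega> - X"
  shows "P X x > 0"
  using kernel_section_notin_span[OF assms] interpolant_props(1)[OF assms(1,2), of "\<phi> x"]
  by (auto simp: power_function_eq[OF assms(1,2)] trial_space_def)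

text \<open>A projection residual is no longer than the vector, whose length
  \<open>norm_kernel_section_le\<close> bounds through the diagonal of \<open>k\<close>. For \<beta>
  > 1 this allows powers of \<open>P\<close> to be dropped.\<close>

lemma power_function_le_1:
  assumes "finite X" "X \<subseteq> \<Omega>" "x \<in> \<Omega>"
  shows "P X x \<le> 1"
proof -
  let ?r = "\<phi> x - I X (\<phi> x)"
  have "?r \<bullet> ?r = ?r \<bullet> \<phi> x - ?r \<bullet> I X (\<phi> x)" by (rule inner_diff_right)
  also have "?r \<bullet> I X (\<phi> x) = 0" by (rule interpolant_props(5)[OF assms(1,2) interpolant_props(1)[OF assms(1,2)]])
  also have "?r \<bullet> \<phi> x - 0 \<le> norm ?r * 1"
    using norm_cauchy_schwarz[of ?r "\<phi> x"] norm_kernel_section_le[OF assms(3)]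
    by (simp add: mult_left_le order_trans)
  finally have "norm ?r * norm ?r \<le> norm ?r * 1" by (simp add: power2_norm_eq_inner[symmetric] power2_eq_square)
  then show ?thesis unfolding power_function_eq[OF assms(1,2)]
    by (cases "norm ?r = 0") (auto simp: mult_le_cancel_left)
qed

text \<open>The projection is self-adjoint, so taking residuals may be left on one factor or put on
  both; the second claim has it on both before Cauchy-Schwarz.\<close>

lemma ev_residual:
  assumes "finite X" "X \<subseteq> \<Omega>" "z \<in> \<Omega>"
  shows "ev (f - I X f) z = f \<bullet> (\<phi> z - I X (\<phi> z))"
    and "\<bar>ev (f - I X f) z\<bar> \<le> norm (f - I X f) * P X z"
proof -
  let ?r = "f - I X f"
  note ip = interpolant_props[OF assms(1,2)]
  have 1: "ev ?r z = ?r \<bullet> (\<phi> z - I X (\<phi> z))"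
    using kernel_section(2)[OF assms(3)] ip(5)[OF ip(1)] by (simp add: inner_diff_right)
  also have "\<dots> = f \<bullet> (\<phi> z - I X (\<phi> z))"
    using ip(5)[OF ip(1), of "\<phi> z" f] by (simp add: inner_diff_left inner_diff_right inner_commute)
  finally show "ev ?r z = f \<bullet> (\<phi> z - I X (\<phi> z))" .
  show "\<bar>ev ?r z\<bar> \<le> norm ?r * P X z"
    unfolding 1 power_function_eq[OF assms(1,2)] by (rule Cauchy_Schwarz_ineq2)
qed

lemma finite_points [simp]: "finite (points x n)"
  by (simp add: points_def)

lemma points_Suc: "points x (Suc n) = insert (x (Suc n)) (points x n)"
  by (auto simp: points_def atLeastAtMostSuc_conv)

text \<open>Newton's update: \<open>u\<close> spans the orthogonal complement of \<open>V X\<close>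
  in the enlarged space, so a single Fourier coefficient is added.\<close>

lemma interpolant_insert:
  assumes "finite X" "X \<subseteq> \<Omega>" "z \<in> \<Omega> - X"
  defines "u \<equiv> \<phi> z - I X (\<phi> z)"
  shows "I (insert z X) f = I X f + ((f \<bullet> u) / (u \<bullet> u)) *\<^sub>R u"
    and "u \<in> V (insert z X)" and "u \<bullet> u > 0"
proof -
  note ip = interpolant_props[OF assms(1,2)]
  have sub: "V X \<subseteq> V (insert z X)" unfolding trial_space_def by (intro span_mono) auto
  have fin: "finite (insert z X)" "insert z X \<subseteq> \<Omega>" using assms by auto
  have z: "\<phi> z \<in> V (insert z X)" unfolding trial_space_def by (intro span_base) auto
  show u: "u \<in> V (insert z X)" unfolding u_def
    using z sub ip(1) unfolding trial_space_def by (intro span_diff) auto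
  have "norm u > 0" using power_function_pos[OF assms(1-3)] by (simp add: power_function_eq[OF assms(1,2)] u_def)
  then show pos: "u \<bullet> u > 0" by simp
  have uX: "u \<bullet> v = 0" if "v \<in> V X" for v unfolding u_def by (rule ip(5)[OF that])
  have zu: "u \<bullet> \<phi> z = u \<bullet> u"
    using uX[OF ip(1)[of "\<phi> z"]] by (simp add: u_def inner_diff_right)
  define s where "s = I X f + ((f \<bullet> u) / (u \<bullet> u)) *\<^sub>R u"
  have "s = I (insert z X) f"
  proof (rule interpolant_props(4)[OF fin])
    show "s \<in> V (insert z X)" unfolding s_def using sub ip(1) u
      unfolding trial_space_def by (intro span_add span_scale) auto
    fix y assume y: "y \<in> insert z X"
    have "(f - I X f) \<bullet> u = f \<bullet> u"
      using uX[OF ip(1)[of f]] by (simp add: inner_diff_right inner_commute[of _ u])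
    moreover have "(f - I X f) \<bullet> \<phi> z = (f - I X f) \<bullet> u"
      using ip(5)[OF ip(1)[of "\<phi> z"], of f] by (simp add: u_def inner_diff_right)
    ultimately have "(f - s) \<bullet> \<phi> z = 0" using zu pos by (simp add: s_def inner_diff_left inner_add_left)
    moreover have "(f - s) \<bullet> \<phi> y = 0" if "y \<in> X"
    proof -
      have "\<phi> y \<in> V X" unfolding trial_space_def using that by (intro span_base) auto
      then show ?thesis using ip(5)[of "\<phi> y" f] uX[of "\<phi> y"] by (simp add: s_def inner_diff_left inner_add_left)
    qed
    ultimately show "(f - s) \<bullet> \<phi> y = 0" using y by auto
  qed
  then show "I (insert z X) f = I X f + ((f \<bullet> u) / (u \<bullet> u)) *\<^sub>R u" by (simp add: s_def)
qed

end

section \<open>Newton's basis of a point sequence\<close>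

locale point_sequence = kernel_space \<Omega> k ev
  for \<Omega> :: "'a set" and k and ev :: "'h::{real_inner,complete_space} \<Rightarrow> 'a \<Rightarrow> real" +
  fixes x :: "nat \<Rightarrow> 'a"
  assumes new_point: "\<And>n. x (Suc n) \<in> \<Omega> - points x n"
begin

abbreviation "X n \<equiv> points x n"

text \<open>The index is that of the step: \<open>newton n\<close> is the unit vector that the new
  point \<open>x (Suc n)\<close> adds to \<open>V (X n)\<close>, and \<open>pivot n\<close> is its
  length before normalisation.\<close>

definition newton :: "nat \<Rightarrow> 'h" where
  "newton n = (let u = \<phi> (x (Suc n)) - I (X n) (\<phi> (x (Suc n))) in (1 / norm u) *\<^sub>R u)"

definition pivot :: "nat \<Rightarrow> real" where "pivot n = P (X n) (x (Suc n))"

lemma X_subset: "X n \<subseteq> \<Omega>"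
proof
  fix y assume "y \<in> X n"
  then obtain i where i: "y = x i" "i \<ge> 1" by (auto simp: points_def)
  then show "y \<in> \<Omega>" using new_point[of "i - 1"] by simp
qed

lemmas fs = finite_points X_subset

lemma pivot_pos: "pivot n > 0"
  unfolding pivot_def by (rule power_function_pos[OF fs new_point])

lemma pivot_eq: "pivot n = norm (\<phi> (x (Suc n)) - I (X n) (\<phi> (x (Suc n))))"
  unfolding pivot_def by (rule power_function_eq[OF fs])

lemma newton_eq: "\<phi> (x (Suc n)) - I (X n) (\<phi> (x (Suc n))) = pivot n *\<^sub>R newton n"
  using pivot_pos[of n] by (simp add: newton_def pivot_eq Let_def)

lemma norm_newton: "newton n \<bullet> newton n = 1"
proof -
  have "norm (newton n) = 1" using pivot_pos[of n] by (simp add: newton_def pivot_eq Let_def)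
  then show ?thesis by (simp add: norm_eq_1)
qed

lemma interpolant_Suc: "I (X (Suc n)) f = I (X n) f + (f \<bullet> newton n) *\<^sub>R newton n"
proof -
  have "I (X (Suc n)) f = I (X n) f + ((f \<bullet> (pivot n *\<^sub>R newton n)) / ((pivot n *\<^sub>R newton n) \<bullet> (pivot n *\<^sub>R newton n))) *\<^sub>R (pivot n *\<^sub>R newton n)"
    using interpolant_insert(1)[OF finite_points X_subset[of n] new_point[of n], of f] by (simp only: points_Suc newton_eq)
  then show ?thesis using pivot_pos[of n] by (simp add: norm_newton)
qed

lemma V_mono: "m \<le> n \<Longrightarrow> V (X m) \<subseteq> V (X n)"
  unfolding trial_space_def points_def by (intro span_mono image_mono) auto

lemma newton_in: "newton n \<in> V (X (Suc n))"
  using interpolant_insert(2)[OF finite_points X_subset[of n] new_point[of n]] unfolding newton_def Let_def points_Suc trial_space_def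
  by (rule span_scale)

lemma newton_orth: "v \<in> V (X n) \<Longrightarrow> newton n \<bullet> v = 0"
  using interpolant_props(5)[OF finite_points X_subset[of n], of v "\<phi> (x (Suc n))"] by (simp add: newton_def Let_def)

lemma newton_orthonormal: "newton i \<bullet> newton j = (if i = j then 1 else 0)"
proof -
  have *: "newton i \<bullet> newton j = 0" if "j < i" for i j
    using newton_orth newton_in[of j] V_mono[of "Suc j" i] that by auto
  show ?thesis using *[of i j] *[of j i] norm_newton[of i] by (cases i j rule: linorder_cases) (auto simp: inner_commute)
qed

text \<open>The section of point \<open>Suc j\<close> lies in \<open>V (X (Suc j))\<close>, to which
  all later basis vectors are orthogonal, and its component orthogonal to \<open>V (X j)\<close> is
  the pivot times \<open>newton j\<close>.\<close>

lemma section_newton: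
  shows "j < i \<Longrightarrow> \<phi> (x (Suc j)) \<bullet> newton i = 0" and "\<phi> (x (Suc j)) \<bullet> newton j = pivot j"
proof -
  have in_V: "\<phi> (x (Suc j)) \<in> V (X (Suc j))"
    unfolding trial_space_def points_def by (intro span_base) auto
  then show "j < i \<Longrightarrow> \<phi> (x (Suc j)) \<bullet> newton i = 0"
    using newton_orth[of "\<phi> (x (Suc j))" i] V_mono[of "Suc j" i] by (auto simp: inner_commute)
  have "\<phi> (x (Suc j)) = I (X j) (\<phi> (x (Suc j))) + pivot j *\<^sub>R newton j" using newton_eq[of j] by (simp add: algebra_simps)
  then have "\<phi> (x (Suc j)) \<bullet> newton j = I (X j) (\<phi> (x (Suc j))) \<bullet> newton j + pivot j * (newton j \<bullet> newton j)"
    by (metis inner_add_left inner_scaleR_left)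
  moreover have "I (X j) (\<phi> (x (Suc j))) \<bullet> newton j = 0"
    using newton_orth[OF interpolant_props(1)[OF fs]] by (simp add: inner_commute)
  ultimately show "\<phi> (x (Suc j)) \<bullet> newton j = pivot j" by (simp add: norm_newton)
qed

lemma residual_norm:
  "(norm (f - I (X (Suc n)) f))\<^sup>2 = (norm (f - I (X n) f))\<^sup>2 - (f \<bullet> newton n)\<^sup>2"
proof -
  define r where "r = f - I (X n) f"
  have 1: "r \<bullet> newton n = f \<bullet> newton n"
    using newton_orth[OF interpolant_props(1)[OF finite_points X_subset[of n], of f]]
    by (simp add: r_def inner_diff_right inner_commute[of _ "newton n"])
  have 2: "f - I (X (Suc n)) f = r - (f \<bullet> newton n) *\<^sub>R newton n"
    by (simp add: interpolant_Suc r_def)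
  show ?thesis unfolding 2 r_def[symmetric] power2_norm_eq_inner
    by (simp add: inner_diff_left inner_diff_right 1 inner_commute[of "newton n"] norm_newton power2_eq_square)
qed

lemma residual_norm_antimono: "m \<le> n \<Longrightarrow> norm (f - I (X n) f) \<le> norm (f - I (X m) f)"
proof (induction rule: dec_induct)
  case (step n)
  have "(norm (f - I (X (Suc n)) f))\<^sup>2 \<le> (norm (f - I (X n) f))\<^sup>2" by (simp add: residual_norm)
  then have "norm (f - I (X (Suc n)) f) \<le> norm (f - I (X n) f)" by (rule power2_le_imp_le) simp
  then show ?case using step by simp
qed simp

lemma residual_at_new_point: "ev (f - I (X n) f) (x (Suc n)) = pivot n * (f \<bullet> newton n)"
  using ev_residual(1)[OF finite_points X_subset[of n], of "x (Suc n)" f] new_point[of n] by (simp add: newton_eq)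

text \<open>The squared coefficients telescope to a difference of squared residual norms, so their
  sum over n steps is at most the first of these; the inequality of means is applied to the
  squares.\<close>

lemma prod_newton_coeff_le:
  assumes "n \<ge> 1"
  shows "(\<Prod>j<n. \<bar>f \<bullet> newton (m + j)\<bar>) \<le> (norm (f - I (X m) f) / sqrt (real n)) ^ n"
proof -
  have sum: "(\<Sum>j<n. (f \<bullet> newton (m + j))\<^sup>2) = (norm (f - I (X m) f))\<^sup>2 - (norm (f - I (X (m + n)) f))\<^sup>2"
    by (induction n) (simp_all add: residual_norm)
  have "(\<Prod>j<n. \<bar>f \<bullet> newton (m + j)\<bar>)\<^sup>2 = (\<Prod>j<n. (f \<bullet> newton (m + j))\<^sup>2)"
    by (simp add: prod_power_distrib)
  also have "\<dots> \<le> ((norm (f - I (X m) f))\<^sup>2 / real n) ^ n"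
    using assms by (intro prod_le_mean_power) (auto simp: sum)
  also have "\<dots> = ((norm (f - I (X m) f) / sqrt (real n)) ^ n)\<^sup>2"
  proof -
    have "(norm (f - I (X m) f))\<^sup>2 / real n = (norm (f - I (X m) f) / sqrt (real n))\<^sup>2" by (simp add: power_divide)
    then show ?thesis by (simp only: power_mult[symmetric] mult.commute)
  qed
  finally show ?thesis by (rule power2_le_imp_le) simp
qed

lemma prod_pivot_le:
  assumes n: "n \<ge> 1" and ent: "entropy_number n (co (\<phi> ` \<Omega>)) \<le> ereal E" and E: "E \<ge> 0"
  shows "(\<Prod>j<n. pivot (m + j)) \<le> (sqrt (5 * real n) * E) ^ n"
proof -
  \<comment> \<open>In \<open>co\<close> the coefficients belong to the vectors of a set, not to
    indices, so a family has to be injective to be rewritten as such a sum.\<close>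
  have inj: "inj_on (\<lambda>j. \<phi> (x (Suc (m + j)))) {..<n}"
  proof (rule linorder_inj_onI)
    fix i j :: nat assume "i < j"
    have "\<phi> (x (Suc (m + i))) \<bullet> newton (m + j) = 0" using section_newton(1) \<open>i < j\<close> by simp
    moreover have "\<phi> (x (Suc (m + j))) \<bullet> newton (m + j) \<noteq> 0" using section_newton(2) pivot_pos[of "m + j"] by simp
    ultimately show "\<phi> (x (Suc (m + i))) \<noteq> \<phi> (x (Suc (m + j)))" by metis
  qed auto
  have *: "(\<Prod>j<n. pivot (m + j)) \<le> (sqrt (5 * real n) * \<epsilon>) ^ n" if gt: "\<epsilon> > E" for \<epsilon>
  proof -
    have "Inf {ereal \<epsilon> | \<epsilon>. \<epsilon> > 0 \<and> (\<exists>S. finite S \<and> card S \<le> 2 ^ n \<and> co (\<phi> ` \<Omega>) \<subseteq> (\<Union>s\<in>S. cball s \<epsilon>))} < ereal \<epsilon>"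
      using ent gt unfolding entropy_number_def by (simp add: le_less_trans)
    then obtain \<delta> S where S: "\<delta> > 0" "\<delta> < \<epsilon>" "finite S" "card S \<le> 2 ^ n" "co (\<phi> ` \<Omega>) \<subseteq> (\<Union>s\<in>S. cball s \<delta>)"
      unfolding Inf_less_iff by auto
    have "(\<Prod>j<n. \<phi> (x (Suc (m + j))) \<bullet> newton (m + j)) \<le> (sqrt (5 * real n) * \<delta>) ^ n"
    proof (rule prod_diagonal_le_of_cover[OF _ _ _ _ S(3-5) n S(1)])
      fix c :: "nat \<Rightarrow> real" assume c: "(\<Sum>j<n. \<bar>c j\<bar>) \<le> 1"
      let ?g = "\<lambda>j. \<phi> (x (Suc (m + j)))"
      define c' where "c' v = c (inv_into {..<n} ?g v)" for v
      have c': "c' (?g j) = c j" if "j < n" for j using inv_into_f_f[OF inj, of j] that by (simp add: c'_def)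
      have "(\<Sum>v\<in>?g ` {..<n}. c' v *\<^sub>R v) = (\<Sum>j<n. c j *\<^sub>R ?g j)"
        by (subst sum.reindex[OF inj]) (auto simp: c' intro: sum.cong)
      moreover have "(\<Sum>v\<in>?g ` {..<n}. \<bar>c' v\<bar>) = (\<Sum>j<n. \<bar>c j\<bar>)"
        by (subst sum.reindex[OF inj]) (auto simp: c' intro: sum.cong)
      moreover have "?g ` {..<n} \<subseteq> \<phi> ` \<Omega>" using new_point by auto
      ultimately have "\<exists>F c'. (\<Sum>j<n. c j *\<^sub>R ?g j) = (\<Sum>v\<in>F. c' v *\<^sub>R v) \<and> finite F \<and> F \<subseteq> \<phi> ` \<Omega> \<and> (\<Sum>v\<in>F. \<bar>c' v\<bar>) \<le> 1"
        using c by (intro exI[of _ "?g ` {..<n}"] exI[of _ c']) auto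
      then show "(\<Sum>j<n. c j *\<^sub>R ?g j) \<in> co (\<phi> ` \<Omega>)"
        unfolding co_def by (intro closure_subset[THEN subsetD]) blast
    qed (use section_newton pivot_pos newton_orthonormal in auto)
    also have "\<dots> \<le> (sqrt (5 * real n) * \<epsilon>) ^ n"
      using S(1,2) by (intro power_mono mult_left_mono) auto
    finally show ?thesis by (simp add: section_newton(2))
  qed
  \<comment> \<open>The infimum in the entropy number need not be attained; the bound for all larger
    radii passes to the limit.\<close>
  have "((\<lambda>\<epsilon>. (sqrt (5 * real n) * \<epsilon>) ^ n) \<longlongrightarrow> (sqrt (5 * real n) * E) ^ n) (at_right E)"
    by (intro tendsto_intros)
  then show ?thesis
    by (rule tendsto_lowerbound) (auto simp: eventually_at_filter * intro!: always_eventually)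
qed

end

section \<open>From the selection rule to convergence rates\<close>

lemma power_powr_commute: "y \<ge> 0 \<Longrightarrow> (y ^ n) powr a = (y powr a) ^ n" for y :: real
  by (induction n) (simp_all add: powr_mult)

context point_sequence
begin

text \<open>Bounds the uniform norm of the residual in step \<open>i\<close>. The case \<open>\<beta> = 0\<close> is
  kept apart because \<open>0 powr 0 = 0\<close>.\<close>

definition greedy_bound :: "ennreal \<Rightarrow> 'h \<Rightarrow> real \<Rightarrow> nat \<Rightarrow> real" where
  "greedy_bound \<beta> f \<rho> i = (let b = enn2real \<beta>; q = \<bar>f \<bullet> newton i\<bar> in
     if \<beta> = \<infinity> then q
     else if \<beta> = 0 then pivot i * \<rho>
     else if b \<le> 1 then pivot i * q powr b * \<rho> powr (1 - b)
     else q * pivot i powr (1 / b))"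

lemma residual_le_greedy_bound:
  assumes wg: "ereal (greedy_indicator \<Omega> k ev \<beta> f (X i) (x (Suc i)))
      \<ge> ereal \<gamma> * (SUP z\<in>\<Omega> - X i. ereal (greedy_indicator \<Omega> k ev \<beta> f (X i) z))"
    and \<gamma>: "0 < \<gamma>" "\<gamma> \<le> 1" and \<rho>: "norm (f - I (X i) f) \<le> \<rho>" and z: "z \<in> \<Omega>"
  shows "\<bar>ev (f - I (X i) f) z\<bar> \<le> inverse \<gamma> * greedy_bound \<beta> f \<rho> i"
proof -
  define q where "q = \<bar>f \<bullet> newton i\<bar>"
  define p where "p = pivot i"
  have p: "p > 0" and q: "q \<ge> 0" using pivot_pos by (auto simp: p_def q_def)
  have \<rho>0: "\<rho> \<ge> 0" using \<rho> norm_ge_zero[of "f - I (X i) f"] by linarith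
  have gb0: "greedy_bound \<beta> f \<rho> i \<ge> 0"
    using p q \<rho>0 by (auto simp: greedy_bound_def Let_def p_def q_def)
  define r where "r = \<bar>ev (f - I (X i) f) z\<bar>"
  have R: "\<bar>ev (f - I (X i) f) (x (Suc i))\<bar> = p * q"
    using p by (simp add: residual_at_new_point abs_mult p_def q_def)
  show ?thesis
  \<comment> \<open>The selection rule says nothing about points already chosen, and the laws of
    \<open>powr\<close> need r > 0. In both excluded cases the residual is 0.\<close>
  proof (cases "z \<in> X i \<or> r = 0")
    case True
    then have "r = 0" using interpolant_props(2)[OF finite_points X_subset[of i]] by (auto simp: r_def)
    then show ?thesis using gb0 \<gamma> by (simp add: r_def)
  next
    case False
    then have zX: "z \<in> \<Omega> - X i" and r: "r > 0" using z by (auto simp: r_def)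
    define P' where "P' = P (X i) z"
    have P': "P' > 0" "P' \<le> 1"
      using power_function_pos[OF finite_points X_subset zX] power_function_le_1[OF finite_points X_subset z]
      by (auto simp: P'_def)
    have rP: "r \<le> \<rho> * P'"
      using ev_residual(2)[OF finite_points X_subset[of i] z, of f] mult_right_mono[OF \<rho>, of P'] P'
      unfolding r_def P'_def by linarith
    have "ereal \<gamma> * ereal (greedy_indicator \<Omega> k ev \<beta> f (X i) z)
        \<le> ereal \<gamma> * (SUP z\<in>\<Omega> - X i. ereal (greedy_indicator \<Omega> k ev \<beta> f (X i) z))"
      using \<gamma> zX by (intro ereal_mult_left_mono SUP_upper) auto
    then have "ereal \<gamma> * ereal (greedy_indicator \<Omega> k ev \<beta> f (X i) z)
        \<le> ereal (greedy_indicator \<Omega> k ev \<beta> f (X i) (x (Suc i)))"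
      using wg by (rule order_trans)
    then have "\<gamma> * greedy_indicator \<Omega> k ev \<beta> f (X i) z \<le> greedy_indicator \<Omega> k ev \<beta> f (X i) (x (Suc i))"
      by simp
    then have ind: "greedy_indicator \<Omega> k ev \<beta> f (X i) z \<le> inverse \<gamma> * greedy_indicator \<Omega> k ev \<beta> f (X i) (x (Suc i))"
      using \<gamma> by (simp add: field_simps)
    have pP: "P (X i) (x (Suc i)) = p" by (simp add: p_def pivot_def)
    define b where "b = enn2real \<beta>"
    consider "\<beta> = \<infinity>" | "\<beta> = 0" | "\<beta> \<noteq> \<infinity>" "\<beta> \<noteq> 0" "b \<le> 1" | "\<beta> \<noteq> \<infinity>" "\<beta> \<noteq> 0" "b > 1" by linarith
    then have "r \<le> inverse \<gamma> * greedy_bound \<beta> f \<rho> i"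
    proof cases
      case 1
      have "r / P' \<le> inverse \<gamma> * (p * q / p)"
        using ind unfolding greedy_indicator_def Let_def R pP using 1 by (simp add: r_def P'_def)
      then have "r / P' \<le> inverse \<gamma> * q" using p by simp
      then have "r \<le> inverse \<gamma> * q * P'" using P' by (simp add: pos_divide_le_eq)
      also have "\<dots> \<le> inverse \<gamma> * q" using P' \<gamma> q by (intro mult_left_le) auto
      finally show ?thesis using 1 by (simp add: greedy_bound_def q_def)
    next
      case 2
      have "P' \<le> inverse \<gamma> * p" using ind unfolding greedy_indicator_def Let_def pP using 2 by (simp add: P'_def)
      then have "\<rho> * P' \<le> \<rho> * (inverse \<gamma> * p)" using \<rho>0 by (rule mult_left_mono)
      then show ?thesis using rP 2 by (simp add: greedy_bound_def p_def mult_ac)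
    next
      case 3
      have b: "b > 0" using 3 by (simp add: b_def enn2real_positive_iff less_top pos2 zero_less_iff_neq_zero)
      have "r powr b * P' powr (1 - b) \<le> inverse \<gamma> * ((p * q) powr b * p powr (1 - b))"
        using ind unfolding greedy_indicator_def Let_def R pP using 3 by (simp add: r_def P'_def b_def)
      also have "(p * q) powr b * p powr (1 - b) = p * q powr b"
        using p q by (simp add: powr_mult powr_diff)
      finally have ind': "r powr b * P' powr (1 - b) \<le> inverse \<gamma> * (p * q powr b)" .
      \<comment> \<open>The selection rule controls only the power b of the residual. The other
        factor is bounded by means of \<open>\<rho> * P'\<close>, which supplies the power of
        \<open>P'\<close> that the indicator contains.\<close>
      have "r = r powr b * r powr (1 - b)" using r by (simp add: powr_add[symmetric])
      also have "\<dots> \<le> r powr b * (\<rho> * P') powr (1 - b)"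
        using rP r 3 by (intro mult_left_mono powr_mono2) auto
      also have "\<dots> = (r powr b * P' powr (1 - b)) * \<rho> powr (1 - b)"
        using \<rho>0 P' by (simp add: powr_mult)
      also have "\<dots> \<le> inverse \<gamma> * (p * q powr b) * \<rho> powr (1 - b)" using ind' by (rule mult_right_mono) simp
      finally show ?thesis using 3 by (simp add: greedy_bound_def Let_def b_def[symmetric] p_def q_def mult.assoc)
    next
      case 4
      have "r powr b * P' powr (1 - b) \<le> inverse \<gamma> * ((p * q) powr b * p powr (1 - b))"
        using ind unfolding greedy_indicator_def Let_def R pP using 4 by (simp add: r_def P'_def b_def)
      also have "(p * q) powr b * p powr (1 - b) = p * q powr b"
        using p q by (simp add: powr_mult powr_diff)
      finally have ind': "r powr b * P' powr (1 - b) \<le> inverse \<gamma> * (p * q powr b)" .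
      have "r powr b = (r powr b * P' powr (1 - b)) * P' powr (b - 1)"
        using P' by (simp add: mult.assoc powr_add[symmetric])
      also have "\<dots> \<le> (r powr b * P' powr (1 - b)) * 1"
        using P' 4 by (intro mult_left_mono powr_le1) auto
      also have "\<dots> \<le> inverse \<gamma> * (p * q powr b)" using ind' by simp
      finally have "(r powr b) powr (1 / b) \<le> (inverse \<gamma> * (p * q powr b)) powr (1 / b)"
        using 4 by (intro powr_mono2) auto
      then have "r \<le> inverse \<gamma> powr (1 / b) * (p powr (1 / b) * q)"
        using r 4 p q \<gamma> by (simp add: powr_powr powr_mult)
      also have "\<dots> \<le> inverse \<gamma> powr 1 * (p powr (1 / b) * q)"
        using \<gamma> 4 q by (intro mult_right_mono powr_mono) (auto simp: one_le_inverse_iff)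
      finally show ?thesis using 4 \<gamma> by (simp add: greedy_bound_def Let_def b_def[symmetric] p_def q_def mult_ac)
    qed
    then show ?thesis by (simp add: r_def)
  qed
qed

text \<open>In every case \<open>greedy_bound\<close> is a product of powers of a pivot, a
  coefficient and the constant \<rho>, so its product over n steps is at most the n-th power of the
  same expression in the geometric mean bounds \<open>Q\<close> and \<open>S\<close>.\<close>

lemma ex_greedy_bound_le:
  fixes \<beta> :: ennreal
  assumes n: "n \<ge> 1" and C: "C > 0"
    and ent: "entropy_number n (co (\<phi> ` \<Omega>)) \<le> ereal (C * real n powr (- \<alpha>))"
    and \<gamma>: "0 < \<gamma>" and \<rho>: "\<rho> = norm (f - I (X m) f)"
  defines "b \<equiv> enn2real \<beta>"
  shows "\<exists>j<n. inverse \<gamma> * greedy_bound \<beta> f \<rho> (m + j) \<le>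
    (if \<beta> = \<infinity> then 1 else (C * sqrt 5) powr (1 / max 1 b)) * inverse \<gamma> *
    (if \<beta> = \<infinity> then real n powr (- 1 / 2) else (real n powr (- \<alpha> + (1 - b) / 2)) powr (1 / max 1 b)) * \<rho>"
proof -
  define N where "N = real n"
  have N: "N > 0" using n by (simp add: N_def)
  have \<rho>0: "\<rho> \<ge> 0" by (simp add: \<rho>)
  define Q where "Q = C * sqrt 5 * N powr (1 / 2 - \<alpha>)"
  have Q: "Q > 0" using C N by (simp add: Q_def)
  have pp: "(\<Prod>j<n. pivot (m + j)) \<le> Q ^ n"
  proof -
    have "sqrt (5 * real n) * (C * real n powr (- \<alpha>)) = Q"
      using N by (simp add: Q_def N_def[symmetric] real_sqrt_mult powr_half_sqrt[symmetric] powr_diff powr_minus_divide)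
    then show ?thesis using prod_pivot_le[OF n ent, of m] C by simp
  qed
  define S where "S = \<rho> * N powr (- 1 / 2)"
  have S0: "S \<ge> 0" using \<rho>0 by (simp add: S_def)
  have qq: "(\<Prod>j<n. \<bar>f \<bullet> newton (m + j)\<bar>) \<le> S ^ n"
  proof -
    have "norm (f - I (X m) f) / sqrt (real n) = S"
      using N by (simp add: S_def \<rho> N_def[symmetric] powr_half_sqrt[symmetric] powr_minus_divide)
    then show ?thesis using prod_newton_coeff_le[OF n, of f m] by simp
  qed
  have pp0: "0 \<le> (\<Prod>j<n. pivot (m + j))" using pivot_pos by (intro prod_nonneg) (auto intro: less_imp_le)
  have qq0: "0 \<le> (\<Prod>j<n. \<bar>f \<bullet> newton (m + j)\<bar>)" by (intro prod_nonneg) auto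
  have *: ?thesis if B: "B \<ge> 0" "(\<Prod>j<n. greedy_bound \<beta> f \<rho> (m + j)) \<le> B ^ n"
    and eq: "B = (if \<beta> = \<infinity> then 1 else (C * sqrt 5) powr (1 / max 1 b)) *
    (if \<beta> = \<infinity> then real n powr (- 1 / 2) else (real n powr (- \<alpha> + (1 - b) / 2)) powr (1 / max 1 b)) * \<rho>" for B
  proof -
    obtain j where "j < n" "greedy_bound \<beta> f \<rho> (m + j) \<le> B" using ex_le_of_prod_le[OF n B] by blast
    then have "inverse \<gamma> * greedy_bound \<beta> f \<rho> (m + j) \<le> inverse \<gamma> * B" using \<gamma> by (intro mult_left_mono) auto
    then show ?thesis using \<open>j < n\<close> unfolding eq by (intro exI[of _ j]) (simp add: mult_ac)
  qed
  consider "\<beta> = \<infinity>" | "\<beta> = 0" | "\<beta> \<noteq> \<infinity>" "\<beta> \<noteq> 0" "b \<le> 1" | "\<beta> \<noteq> \<infinity>" "\<beta> \<noteq> 0" "b > 1" by linarith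
  then show ?thesis
  proof cases
    case 1
    show ?thesis
    proof (rule *[of S])
      show "(\<Prod>j<n. greedy_bound \<beta> f \<rho> (m + j)) \<le> S ^ n" using qq 1 by (simp add: greedy_bound_def)
    qed (use S0 1 in \<open>simp_all add: S_def N_def mult.commute\<close>)
  next
    case 2
    show ?thesis
    proof (rule *[of "Q * \<rho>"])
      have "(\<Prod>j<n. greedy_bound \<beta> f \<rho> (m + j)) = (\<Prod>j<n. pivot (m + j)) * \<rho> ^ n"
        using 2 by (simp add: greedy_bound_def prod.distrib)
      also have "\<dots> \<le> Q ^ n * \<rho> ^ n" using pp \<rho>0 by (intro mult_right_mono) auto
      finally show "(\<Prod>j<n. greedy_bound \<beta> f \<rho> (m + j)) \<le> (Q * \<rho>) ^ n" by (simp add: power_mult_distrib)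
    qed (use Q \<rho>0 C 2 in \<open>simp_all add: b_def Q_def N_def\<close>)
  next
    case 3
    have b: "b > 0" using 3 by (simp add: b_def enn2real_positive_iff less_top zero_less_iff_neq_zero)
    have g: "greedy_bound \<beta> f \<rho> (m + j) = pivot (m + j) * \<bar>f \<bullet> newton (m + j)\<bar> powr b * \<rho> powr (1 - b)" for j
      using 3 by (simp add: greedy_bound_def Let_def b_def)
    show ?thesis
    proof (rule *[of "Q * S powr b * \<rho> powr (1 - b)"])
      have "(\<Prod>j<n. greedy_bound \<beta> f \<rho> (m + j))
          = (\<Prod>j<n. pivot (m + j)) * (\<Prod>j<n. \<bar>f \<bullet> newton (m + j)\<bar>) powr b * (\<rho> powr (1 - b)) ^ n"
        by (simp add: g prod.distrib prod_powr_distrib)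
      also have "\<dots> \<le> Q ^ n * (S ^ n) powr b * (\<rho> powr (1 - b)) ^ n"
        using pp qq pp0 qq0 Q b by (intro mult_right_mono mult_mono powr_mono2) auto
      also have "\<dots> = (Q * S powr b * \<rho> powr (1 - b)) ^ n"
        using S0 by (simp add: power_powr_commute power_mult_distrib)
      finally show "(\<Prod>j<n. greedy_bound \<beta> f \<rho> (m + j)) \<le> (Q * S powr b * \<rho> powr (1 - b)) ^ n" .
      have "\<rho> powr b * \<rho> powr (1 - b) = \<rho>" using \<rho>0 b by (cases "\<rho> = 0") (simp_all add: powr_add[symmetric])
      then have "Q * S powr b * \<rho> powr (1 - b) = Q * N powr (- b / 2) * \<rho>"
        using \<rho>0 by (simp add: S_def powr_mult powr_powr mult_ac)
      also have "Q * N powr (- b / 2) = C * sqrt 5 * N powr (- \<alpha> + (1 - b) / 2)"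
        by (simp add: Q_def powr_add[symmetric] add_divide_distrib diff_divide_distrib algebra_simps)
      finally show "Q * S powr b * \<rho> powr (1 - b) = (if \<beta> = \<infinity> then 1 else (C * sqrt 5) powr (1 / max 1 b)) *
        (if \<beta> = \<infinity> then real n powr (- 1 / 2) else (real n powr (- \<alpha> + (1 - b) / 2)) powr (1 / max 1 b)) * \<rho>"
        using 3 C by (simp add: N_def)
    qed (use Q in simp)
  next
    case 4
    have g: "greedy_bound \<beta> f \<rho> (m + j) = \<bar>f \<bullet> newton (m + j)\<bar> * pivot (m + j) powr (1 / b)" for j
      using 4 by (simp add: greedy_bound_def Let_def b_def)
    show ?thesis
    proof (rule *[of "S * Q powr (1 / b)"])
      have "(\<Prod>j<n. greedy_bound \<beta> f \<rho> (m + j))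
          = (\<Prod>j<n. \<bar>f \<bullet> newton (m + j)\<bar>) * (\<Prod>j<n. pivot (m + j)) powr (1 / b)"
        using pivot_pos by (simp add: g prod.distrib prod_powr_distrib less_imp_le)
      also have "\<dots> \<le> S ^ n * (Q ^ n) powr (1 / b)"
        using pp qq pp0 qq0 S0 4 by (intro mult_mono powr_mono2) auto
      also have "\<dots> = (S * Q powr (1 / b)) ^ n"
        using Q by (simp add: power_powr_commute power_mult_distrib)
      finally show "(\<Prod>j<n. greedy_bound \<beta> f \<rho> (m + j)) \<le> (S * Q powr (1 / b)) ^ n" .
      have "Q powr (1 / b) = (C * sqrt 5) powr (1 / b) * N powr ((1 / 2 - \<alpha>) / b)"
        using C by (simp add: Q_def powr_mult powr_powr)
      then have "S * Q powr (1 / b) = (C * sqrt 5) powr (1 / b) * (N powr (- 1 / 2) * N powr ((1 / 2 - \<alpha>) / b)) * \<rho>"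
        by (simp add: S_def)
      also have "N powr (- 1 / 2) * N powr ((1 / 2 - \<alpha>) / b) = N powr ((- \<alpha> + (1 - b) / 2) * (1 / b))"
      proof -
        have "- 1 / 2 + (1 / 2 - \<alpha>) / b = (- \<alpha> + (1 - b) / 2) * (1 / b)" using 4 by (simp add: field_simps)
        then show ?thesis by (simp only: powr_add[symmetric])
      qed
      also have "\<dots> = (N powr (- \<alpha> + (1 - b) / 2)) powr (1 / b)" by (rule powr_powr[symmetric])
      finally show "S * Q powr (1 / b) = (if \<beta> = \<infinity> then 1 else (C * sqrt 5) powr (1 / max 1 b)) *
        (if \<beta> = \<infinity> then real n powr (- 1 / 2) else (real n powr (- \<alpha> + (1 - b) / 2)) powr (1 / max 1 b)) * \<rho>"
        using 4 by (simp add: N_def max_def)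
    qed (use S0 in simp)
  qed
qed

end

text \<open>The squared distance of two kernel sections is k y y - 2 k x y + k x x, so the map from
  x to \<open>\<phi> x\<close> inherits continuity from \<open>k\<close>.\<close>

lemma continuous_on_ev:
  fixes \<Omega> :: "'a::metric_space set" and ev :: "'h::{real_inner,complete_space} \<Rightarrow> 'a \<Rightarrow> real"
  assumes "kernel_space \<Omega> k ev" "continuous_kernel_on \<Omega> k"
  shows "continuous_on \<Omega> (ev f)"
proof -
  interpret kernel_space \<Omega> k ev by fact
  have "continuous_on \<Omega> \<phi>"
    unfolding continuous_on
  proof
    fix x assume x: "x \<in> \<Omega>"
    have c: "continuous_on \<Omega> (\<lambda>y. k y y)" "continuous_on \<Omega> (\<lambda>y. k x y)"
      using assms(2) x unfolding continuous_kernel_on_def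
      by (auto intro!: continuous_on_compose2[where f = "\<lambda>y. (y, y)" and g = "\<lambda>(x, y). k x y", simplified]
        continuous_on_compose2[where f = "\<lambda>y. (x, y)" and g = "\<lambda>(x, y). k x y", simplified] continuous_intros)
    have "((\<lambda>y. k y y - 2 * k x y + k x x) \<longlongrightarrow> k x x - 2 * k x x + k x x) (at x within \<Omega>)"
      using c x unfolding continuous_on by (intro tendsto_intros) auto
    moreover have "eventually (\<lambda>y. k y y - 2 * k x y + k x x = (norm (\<phi> y - \<phi> x))\<^sup>2) (at x within \<Omega>)"
      unfolding eventually_at_filter
      by (rule always_eventually)
        (auto simp: power2_norm_eq_inner inner_diff_left inner_diff_right inner_kernel_section x spd_sym)
    ultimately have "((\<lambda>y. (norm (\<phi> y - \<phi> x))\<^sup>2) \<longlongrightarrow> 0) (at x within \<Omega>)"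
      using tendsto_cong by fastforce
    then have "((\<lambda>y. norm (\<phi> y - \<phi> x)) \<longlongrightarrow> 0) (at x within \<Omega>)"
      using tendsto_real_sqrt by fastforce
    then show "(\<phi> \<longlongrightarrow> \<phi> x) (at x within \<Omega>)" by (metis Lim_null tendsto_norm_zero_iff)
  qed
  then have "continuous_on \<Omega> (\<lambda>x. f \<bullet> \<phi> x)" by (intro continuous_intros)
  then show ?thesis by (rule continuous_on_eq) (simp add: kernel_section(2))
qed

lemma Linf_norm_le:
  fixes \<Omega> :: "(real^'d::finite) set"
  assumes "continuous_on \<Omega> g" "\<Omega> \<in> sets lebesgue" "\<And>z. z \<in> \<Omega> \<Longrightarrow> \<bar>g z\<bar> \<le> B"
  shows "Linf_norm \<Omega> g \<le> ereal B"
  unfolding Linf_norm_def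
proof (rule esssup_I)
  have "g \<in> borel_measurable (lebesgue_on \<Omega>)"
    using assms(1,2) by (rule continuous_imp_measurable_on_sets_lebesgue)
  then show "(\<lambda>x. ereal \<bar>g x\<bar>) \<in> borel_measurable (lebesgue_on \<Omega>)" by measurable
qed (use assms(3) in \<open>auto intro!: AE_I2\<close>)

theorem greedy_min_residual_le:
  fixes \<Omega> :: "(real^'d::finite) set" and ev :: "'h::{real_inner,complete_space} \<Rightarrow> real^'d \<Rightarrow> real"
  assumes ks: "kernel_space \<Omega> k ev" and cont: "continuous_kernel_on \<Omega> k"
    and adm: "admissible \<Omega> \<gamma>" and wg: "weak_greedy \<Omega> k ev \<beta> \<gamma> f x"
    and C: "C > 0" and ent: "entropy_bound (co (kernel_section \<Omega> k ev ` \<Omega>)) C \<alpha>" and n: "n \<ge> 1"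
  defines "b \<equiv> enn2real \<beta>"
  shows "(MIN i\<in>{n+1..2*n}. Linf_norm \<Omega> (ev (f - interpolant \<Omega> k ev (points x i) f))) \<le> ereal (
    (if \<beta> = \<infinity> then 1 else (C * sqrt 5) powr (1 / max 1 b)) * inverse \<gamma> *
    (if \<beta> = \<infinity> then real n powr (- 1 / 2) else (real n powr (- \<alpha> + (1 - b) / 2)) powr (1 / max 1 b)) *
    norm (f - interpolant \<Omega> k ev (points x (n + 1)) f))"
proof -
  interpret point_sequence \<Omega> k ev x
    using ks wg by (auto simp: point_sequence_def point_sequence_axioms_def weak_greedy_def)
  have \<gamma>: "0 < \<gamma>" "\<gamma> \<le> 1" and meas: "\<Omega> \<in> sets lebesgue"
    using adm by (auto simp: admissible_def)
  define \<rho> where "\<rho> = norm (f - I (X (n + 1)) f)"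
  obtain j where j: "j < n" "inverse \<gamma> * greedy_bound \<beta> f \<rho> (n + 1 + j) \<le>
    (if \<beta> = \<infinity> then 1 else (C * sqrt 5) powr (1 / max 1 b)) * inverse \<gamma> *
    (if \<beta> = \<infinity> then real n powr (- 1 / 2) else (real n powr (- \<alpha> + (1 - b) / 2)) powr (1 / max 1 b)) * \<rho>"
    (is "_ \<le> ?B")
    using ex_greedy_bound_le[OF n C _ \<gamma>(1) \<rho>_def, where \<alpha> = \<alpha> and \<beta> = \<beta>] ent n unfolding b_def entropy_bound_def by blast
  \<comment> \<open>Starting the product at n + 1 makes i run through n + 1, ..., 2 n, and as
    residual norms do not increase, the norm at n + 1 serves for all these steps.\<close>
  define i where "i = n + 1 + j"
  have "Linf_norm \<Omega> (ev (f - I (X i) f)) \<le> ereal ?B"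
  proof (rule Linf_norm_le[OF continuous_on_ev[OF ks cont] meas])
    fix z assume z: "z \<in> \<Omega>"
    have "norm (f - I (X i) f) \<le> \<rho>" unfolding \<rho>_def by (rule residual_norm_antimono) (simp add: i_def)
    from residual_le_greedy_bound[OF _ \<gamma> this z, of \<beta>] wg
    have "\<bar>ev (f - I (X i) f) z\<bar> \<le> inverse \<gamma> * greedy_bound \<beta> f \<rho> i" by (simp add: weak_greedy_def)
    then show "\<bar>ev (f - I (X i) f) z\<bar> \<le> ?B" using j(2) by (simp add: i_def)
  qed
  moreover have "(MIN i\<in>{n+1..2*n}. Linf_norm \<Omega> (ev (f - I (X i) f))) \<le> Linf_norm \<Omega> (ev (f - I (X i) f))"
    using j(1) by (intro Min_le) (auto simp: i_def)
  ultimately show ?thesis unfolding \<rho>_def by (rule order_trans[rotated])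
qed

section \<open>Mollifiers with vanishing moments\<close>

definition lagrange_basis :: "nat \<Rightarrow> nat \<Rightarrow> real \<Rightarrow> real" where
  "lagrange_basis m k v = (\<Prod>j\<in>{..m} - {k}. (v - real j) / (real k - real j))"

lemma lagrange_basis_node:
  assumes "k \<le> m" "i \<le> m"
  shows "lagrange_basis m k (real i) = (if i = k then 1 else 0)"
proof (cases "i = k")
  case True
  have "(\<Prod>j\<in>{..m} - {k}. (real k - real j) / (real k - real j)) = (\<Prod>j\<in>{..m} - {k}. 1)"
    by (intro prod.cong) auto
  then show ?thesis using True by (simp add: lagrange_basis_def)
next
  case False
  then have "i \<in> {..m} - {k}" using assms by auto
  then show ?thesis using False unfolding lagrange_basis_def by (subst prod_zero) auto
qed

text \<open>Both sides are polynomials in v of degree at most m that agree at m + 1 nodes.\<close>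

lemma lagrange_interpolation_poly:
  assumes "degree p \<le> m"
  shows "(\<Sum>k\<le>m. lagrange_basis m k v * poly p (real k)) = poly p v"
proof -
  define L where "L k = (\<Prod>j\<in>{..m} - {k}. smult (1 / (real k - real j)) [:- real j, 1:])" for k
  have L: "poly (L k) w = lagrange_basis m k w" for k w
    by (simp add: L_def lagrange_basis_def poly_prod divide_simps mult.commute)
  have degL: "degree (L k) \<le> m" if "k \<le> m" for k
  proof -
    have "degree (L k) \<le> (\<Sum>j\<in>{..m} - {k}. degree (smult (1 / (real k - real j)) [:- real j, 1:]))"
      unfolding L_def using degree_prod_sum_le[of "{..m} - {k}" "\<lambda>j. smult (1 / (real k - real j)) [:- real j, 1:]"]
      by (simp add: o_def)
    also have "\<dots> \<le> (\<Sum>j\<in>{..m} - {k}. 1)" by (intro sum_mono) auto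
    also have "\<dots> = m" using that by simp
    finally show ?thesis .
  qed
  define q where "q = (\<Sum>k\<le>m. smult (poly p (real k)) (L k))"
  have "q = p"
  proof (rule poly_eqI_degree[of "real ` {..m}"])
    fix x assume "x \<in> real ` {..m}"
    then obtain i where i: "i \<le> m" "x = real i" by auto
    have "poly q x = (\<Sum>k\<le>m. if k = i then poly p (real k) else 0)"
      unfolding q_def poly_sum using i by (intro sum.cong) (auto simp: L lagrange_basis_node)
    then show "poly q x = poly p x" using i by simp
  next
    have "degree q \<le> m" unfolding q_def
    proof (rule degree_sum_le)
      show "degree (smult (poly p (real k)) (L k)) \<le> m" if "k \<in> {..m}" for k
        using degL[of k] that degree_smult_le[of "poly p (real k)" "L k"] by auto
    qed simp
    then show "degree q < card (real ` {..m})" by (simp add: card_image inj_on_def)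
    show "degree p < card (real ` {..m})" using assms by (simp add: card_image inj_on_def)
  qed
  then have "poly p v = poly q v" by simp
  then show ?thesis by (simp add: q_def poly_sum L mult.commute)
qed

text \<open>The instance for nodes s (c + k). It serves twice: to extrapolate dilation factors to 0
  and to compute the moments of an interpolation kernel.\<close>

lemma lagrange_interpolation_power:
  assumes "j \<le> m"
  shows "(\<Sum>k\<le>m. lagrange_basis m k v * (s * (c + real k)) ^ j) = (s * (c + v)) ^ j"
proof -
  have "degree ([:s * c, s:] ^ j) \<le> m"
  proof -
    have "degree ([:s * c, s:] ^ j) \<le> degree [:s * c, s:] * j" by (rule degree_power_le)
    also have "\<dots> \<le> 1 * j" by (intro mult_right_mono) auto
    finally show ?thesis using assms by simp
  qed
  from lagrange_interpolation_poly[OF this, of v] show ?thesis by (simp add: algebra_simps)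
qed

lemma abs_lagrange_basis_le:
  assumes "\<bar>v\<bar> \<le> R" "k \<le> m"
  shows "\<bar>lagrange_basis m k v\<bar> \<le> (R + real m) ^ m"
proof -
  have "\<bar>lagrange_basis m k v\<bar> = (\<Prod>j\<in>{..m} - {k}. \<bar>(v - real j) / (real k - real j)\<bar>)"
    unfolding lagrange_basis_def by (rule abs_prod)
  also have "\<dots> \<le> (\<Prod>j\<in>{..m} - {k}. R + real m)"
  proof (rule prod_mono, intro conjI)
    fix j assume j: "j \<in> {..m} - {k}"
    have "1 \<le> \<bar>real k - real j\<bar>" using j by (auto simp: abs_if)
    then have "\<bar>v - real j\<bar> / \<bar>real k - real j\<bar> \<le> \<bar>v - real j\<bar> / 1" by (intro divide_left_mono) auto
    also have "\<dots> \<le> R + real m" using assms(1) j by auto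
    finally show "\<bar>(v - real j) / (real k - real j)\<bar> \<le> R + real m" by (simp add: abs_divide)
  qed simp
  also have "\<dots> = (R + real m) ^ m" using assms(2) by simp
  finally show ?thesis .
qed

section \<open>Smooth functions of one variable and the standard bump\<close>

definition smooth1 :: "(real \<Rightarrow> real) \<Rightarrow> bool" where
  "smooth1 f \<longleftrightarrow> (\<forall>n x. ((deriv ^^ n) f has_real_derivative (deriv ^^ Suc n) f x) (at x))"

lemma smooth1D: "smooth1 f \<Longrightarrow> ((deriv ^^ n) f has_real_derivative (deriv ^^ Suc n) f x) (at x)"
  by (simp add: smooth1_def)

lemma smooth1I:
  assumes "\<And>n x. (F n has_real_derivative F (Suc n) x) (at x)" "f = F 0"
  shows "smooth1 f" and "(deriv ^^ n) f = F n"
proof -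
  have *: "(deriv ^^ n) f = F n" for n
  proof (induction n)
    case (Suc n)
    have "deriv (F n) = F (Suc n)" by (intro ext DERIV_imp_deriv assms(1))
    then show ?case using Suc by simp
  qed (simp add: assms(2))
  then show "(deriv ^^ n) f = F n" .
  show "smooth1 f" unfolding smooth1_def * using assms(1) by blast
qed

lemma smooth1_cont: "smooth1 f \<Longrightarrow> continuous_on A ((deriv ^^ n) f)"
  by (meson DERIV_continuous continuous_at_imp_continuous_on smooth1D)

lemma smooth1_cont0: "smooth1 f \<Longrightarrow> continuous_on A f"
  using smooth1_cont[of f A 0] by simp

lemma smooth1_sum:
  assumes "\<And>k. k \<in> K \<Longrightarrow> smooth1 (f k)"
  shows "smooth1 (\<lambda>x. \<Sum>k\<in>K. c k * f k x)"
proof (rule smooth1I(1)[where F = "\<lambda>n x. \<Sum>k\<in>K. c k * (deriv ^^ n) (f k) x"])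
  show "((\<lambda>x. \<Sum>k\<in>K. c k * (deriv ^^ n) (f k) x) has_real_derivative
      (\<Sum>k\<in>K. c k * (deriv ^^ Suc n) (f k) x)) (at x)" for n x
    using smooth1D[OF assms, of _ n x] by (intro DERIV_sum DERIV_cmult) auto
qed simp

lemma smooth1_affine:
  assumes "smooth1 f"
  shows "smooth1 (\<lambda>x. c * f (a * x + b))"
proof (rule smooth1I(1)[where F = "\<lambda>n x. c * a ^ n * (deriv ^^ n) f (a * x + b)"])
  fix n x
  have "((\<lambda>x. (deriv ^^ n) f (a * x + b)) has_real_derivative (deriv ^^ Suc n) f (a * x + b) * a) (at x)"
    by (rule DERIV_chain2[where f = "(deriv ^^ n) f"]) (use smooth1D[OF assms] in \<open>auto intro!: derivative_eq_intros\<close>)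
  from DERIV_cmult[OF this, of "c * a ^ n"]
  show "((\<lambda>x. c * a ^ n * (deriv ^^ n) f (a * x + b)) has_real_derivative
      c * a ^ Suc n * (deriv ^^ Suc n) f (a * x + b)) (at x)" by (simp add: mult_ac)
qed simp

lemma smooth1_diff:
  assumes "smooth1 f" "smooth1 g"
  shows "smooth1 (\<lambda>x. f x - g x)"
proof (rule smooth1I(1)[where F = "\<lambda>n x. (deriv ^^ n) f x - (deriv ^^ n) g x"])
  show "((\<lambda>x. (deriv ^^ n) f x - (deriv ^^ n) g x) has_real_derivative
      (deriv ^^ Suc n) f x - (deriv ^^ Suc n) g x) (at x)" for n x
    by (intro DERIV_diff smooth1D assms)
qed simp

text \<open>A family of functions that is closed under differentiation and contains the standard bump.\<close>

definition bump_fun :: "real poly \<Rightarrow> nat \<Rightarrow> real \<Rightarrow> real" where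
  "bump_fun p k x = (if \<bar>x\<bar> < 1 then poly p x / (1 - x\<^sup>2) ^ k * exp (- 1 / (1 - x\<^sup>2)) else 0)"

text \<open>The n-th power of exp z >= z at z = 1/(n u). It lets the exponential absorb a pole of
  any order at the boundary.\<close>

lemma exp_neg_inverse_le:
  assumes "u > 0"
  shows "exp (- 1 / u) \<le> (real n * u) ^ n"
proof (cases "n = 0")
  case False
  have "1 / (real n * u) \<le> exp (1 / (real n * u))"
    using exp_ge_add_one_self[of "1 / (real n * u)"] by linarith
  then have "(1 / (real n * u)) ^ n \<le> exp (1 / (real n * u)) ^ n"
    using assms by (intro power_mono) auto
  also have "\<dots> = exp (1 / u)" using False by (simp add: exp_of_nat_mult[symmetric])
  finally have "1 / exp (1 / u) \<le> 1 / (1 / (real n * u)) ^ n"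
    using False assms by (intro divide_left_mono) auto
  then show ?thesis using False assms by (simp add: exp_minus field_simps power_divide)
qed (use assms in simp)

text \<open>Two orders beyond the pole are kept, so that the function is quadratically small near 1
  and -1 and its difference quotients tend to 0 there.\<close>

lemma bump_fun_flat: "\<exists>C\<ge>0. \<forall>x. \<bar>bump_fun p k x\<bar> \<le> C * (max 0 (1 - x\<^sup>2))\<^sup>2"
proof -
  have "compact ((\<lambda>x. poly p x) ` {-1..1})" by (intro compact_continuous_image continuous_intros) auto
  then obtain M where M: "\<And>x. x \<in> {-1..1} \<Longrightarrow> \<bar>poly p x\<bar> \<le> M"
    using compact_imp_bounded by (fastforce simp: bounded_iff)
  define C where "C = M * real (k + 2) ^ (k + 2)"
  have M0: "M \<ge> 0" using M[of 0] by simp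
  have "\<bar>bump_fun p k x\<bar> \<le> C * (max 0 (1 - x\<^sup>2))\<^sup>2" for x
  proof (cases "\<bar>x\<bar> < 1")
    case True
    then have u: "1 - x\<^sup>2 > 0" by (simp add: abs_square_less_1)
    have "\<bar>bump_fun p k x\<bar> = \<bar>poly p x\<bar> / (1 - x\<^sup>2) ^ k * exp (- 1 / (1 - x\<^sup>2))"
      using True u by (simp add: bump_fun_def abs_mult)
    also have "\<dots> \<le> M / (1 - x\<^sup>2) ^ k * (real (k + 2) * (1 - x\<^sup>2)) ^ (k + 2)"
    proof (intro mult_mono divide_right_mono exp_neg_inverse_le)
      show "\<bar>poly p x\<bar> \<le> M" using True by (intro M) auto
    qed (use u M0 in auto)
    also have "\<dots> = C * (1 - x\<^sup>2)\<^sup>2"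
      using u by (simp add: C_def power_mult_distrib power_add power2_eq_square)
    finally show ?thesis using u by simp
  next
    case False
    then show ?thesis using M0 by (simp add: bump_fun_def C_def)
  qed
  moreover have "C \<ge> 0" using M0 by (simp add: C_def)
  ultimately show ?thesis by blast
qed

text \<open>The numerator of the derivative over the common denominator (1 - x^2)^(k + 2), where
  \<open>[:1, 0, -1:]\<close> is 1 - x^2 and \<open>[:0, 1:]\<close> is x.\<close>

definition bump_deriv_poly :: "real poly \<Rightarrow> nat \<Rightarrow> real poly" where
  "bump_deriv_poly p k = pderiv p * [:1, 0, -1:]\<^sup>2 + smult (2 * real k) ([:0, 1:] * p * [:1, 0, -1:]) - smult 2 ([:0, 1:] * p)"

lemma bump_fun_deriv: "(bump_fun p k has_real_derivative bump_fun (bump_deriv_poly p k) (k + 2) x) (at x)"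
proof -
  consider "\<bar>x\<bar> < 1" | "\<bar>x\<bar> > 1" | "\<bar>x\<bar> = 1" by linarith
  then show ?thesis
  proof cases
    case 1
    then have u: "1 - x\<^sup>2 > 0" by (simp add: abs_square_less_1)
    define u where "u = 1 - x\<^sup>2"
    have D: "((\<lambda>x. poly p x / (1 - x\<^sup>2) ^ k * exp (- 1 / (1 - x\<^sup>2))) has_real_derivative
      bump_fun (bump_deriv_poly p k) (k + 2) x) (at x)"
    proof -
      have d1: "((\<lambda>x. 1 - x\<^sup>2) has_real_derivative - 2 * x) (at x)" by (auto intro!: derivative_eq_intros)
      have d2: "((\<lambda>x. (1 - x\<^sup>2) ^ k) has_real_derivative real k * ((- 2 * x) * u ^ (k - 1))) (at x)"
        using DERIV_power[OF d1, of k] by (simp add: u_def)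
      have d3: "((\<lambda>x. - 1 / (1 - x\<^sup>2)) has_real_derivative - 2 * x / u\<^sup>2) (at x)"
        using u by (auto intro!: derivative_eq_intros d1 simp: u_def power2_eq_square)
      have d4: "((\<lambda>x. exp (- 1 / (1 - x\<^sup>2))) has_real_derivative exp (- 1 / u) * (- 2 * x / u\<^sup>2)) (at x)"
        using DERIV_fun_exp[OF d3] by (simp add: u_def)
      have d5: "((\<lambda>x. poly p x / (1 - x\<^sup>2) ^ k) has_real_derivative
          (poly (pderiv p) x * u ^ k - poly p x * (real k * ((- 2 * x) * u ^ (k - 1)))) / (u ^ k * u ^ k)) (at x)"
        using DERIV_divide[OF poly_DERIV d2] u by (simp add: u_def)
      have k1: "real k * ((- 2 * x) * u ^ (k - 1)) * u = real k * (- 2 * x) * u ^ k"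
        by (cases k) auto
      have eq: "(poly (pderiv p) x * u ^ k - poly p x * (real k * ((- 2 * x) * u ^ (k - 1)))) / (u ^ k * u ^ k)
          = (poly (pderiv p) x * u + 2 * real k * x * poly p x) / u ^ (k + 1)"
      proof -
        have "(poly (pderiv p) x * u ^ k - poly p x * (real k * ((- 2 * x) * u ^ (k - 1)))) * u
          = poly (pderiv p) x * u ^ k * u - poly p x * (real k * ((- 2 * x) * u ^ (k - 1)) * u)" by (simp add: algebra_simps)
        also have "\<dots> = (poly (pderiv p) x * u + 2 * real k * x * poly p x) * u ^ k"
          unfolding k1 by (simp add: algebra_simps)
        finally show ?thesis using u unfolding u_def[symmetric] by (simp add: field_simps)
      qed
      have "((\<lambda>x. poly p x / (1 - x\<^sup>2) ^ k * exp (- 1 / (1 - x\<^sup>2))) has_real_derivative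
        (poly (pderiv p) x * u + 2 * real k * x * poly p x) / u ^ (k + 1) * exp (- 1 / u)
          + exp (- 1 / u) * (- 2 * x / u\<^sup>2) * (poly p x / u ^ k)) (at x)"
        using DERIV_mult[OF d5 d4] unfolding eq by (simp add: u_def)
      moreover have "(poly (pderiv p) x * u + 2 * real k * x * poly p x) / u ^ (k + 1) * exp (- 1 / u)
          + exp (- 1 / u) * (- 2 * x / u\<^sup>2) * (poly p x / u ^ k) = bump_fun (bump_deriv_poly p k) (k + 2) x"
      proof -
        have "poly (bump_deriv_poly p k) x = poly (pderiv p) x * u\<^sup>2 + 2 * real k * x * poly p x * u - 2 * x * poly p x"
          by (simp add: bump_deriv_poly_def u_def power2_eq_square algebra_simps)
        then have "bump_fun (bump_deriv_poly p k) (k + 2) x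
          = (poly (pderiv p) x * u\<^sup>2 + 2 * real k * x * poly p x * u - 2 * x * poly p x) / u ^ (k + 2) * exp (- 1 / u)"
          using 1 by (simp add: bump_fun_def u_def)
        moreover have "(a * u + 2 * real k * x * c) / u ^ (k + 1) * E + E * (- 2 * x / u\<^sup>2) * (c / u ^ k)
          = (a * u\<^sup>2 + 2 * real k * x * c * u - 2 * x * c) / u ^ (k + 2) * E" for a c E
          using u unfolding u_def[symmetric] by (simp add: field_simps power2_eq_square)
        ultimately show ?thesis by simp
      qed
      ultimately show ?thesis by simp
    qed
    show ?thesis
      by (rule has_field_derivative_transform_within_open[OF D, of "{-1<..<1}"])
        (use 1 in \<open>auto simp: bump_fun_def\<close>)
  next
    case 2
    have "((\<lambda>_. 0) has_real_derivative 0) (at x)" by simp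
    then have "(bump_fun p k has_real_derivative 0) (at x)"
      by (rule has_field_derivative_transform_within_open[of _ _ _ "- {-1..1}"])
        (use 2 in \<open>auto simp: bump_fun_def abs_if split: if_splits\<close>)
    then show ?thesis using 2 by (simp add: bump_fun_def)
  next
    case 3
    obtain C where C: "C \<ge> 0" "\<And>x. \<bar>bump_fun p k x\<bar> \<le> C * (max 0 (1 - x\<^sup>2))\<^sup>2" using bump_fun_flat by metis
    have bnd: "\<bar>bump_fun p k y\<bar> \<le> 4 * C * \<bar>y - x\<bar>\<^sup>2" for y
    proof (cases "\<bar>y\<bar> < 1")
      case True
      have "0 \<le> 1 - y\<^sup>2" using True by (simp add: abs_square_le_1)
      have "1 - y\<^sup>2 = (1 - \<bar>y\<bar>) * (1 + \<bar>y\<bar>)" by (simp add: algebra_simps power2_eq_square)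
      also have "\<dots> \<le> \<bar>y - x\<bar> * 2" using True 3 by (intro mult_mono) auto
      finally have "(max 0 (1 - y\<^sup>2))\<^sup>2 \<le> (2 * \<bar>y - x\<bar>)\<^sup>2" using \<open>0 \<le> 1 - y\<^sup>2\<close> by (intro power_mono) auto
      then have "C * (max 0 (1 - y\<^sup>2))\<^sup>2 \<le> C * (2 * \<bar>y - x\<bar>)\<^sup>2" using C(1) by (rule mult_left_mono)
      then show ?thesis using C(2)[of y] by (simp add: power_mult_distrib)
    next
      case False then show ?thesis using C(1) by (simp add: bump_fun_def)
    qed
    have "((\<lambda>y. (bump_fun p k y - bump_fun p k x) / (y - x)) \<longlongrightarrow> 0) (at x)"
    proof (rule Lim_null_comparison)
      show "\<forall>\<^sub>F y in at x. norm ((bump_fun p k y - bump_fun p k x) / (y - x)) \<le> 4 * C * \<bar>y - x\<bar>"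
        unfolding eventually_at_filter
      proof (intro always_eventually allI impI)
        fix y assume "y \<noteq> x"
        have "bump_fun p k x = 0" using 3 by (simp add: bump_fun_def)
        then show "norm ((bump_fun p k y - bump_fun p k x) / (y - x)) \<le> 4 * C * \<bar>y - x\<bar>"
          using bnd[of y] \<open>y \<noteq> x\<close> by (simp add: abs_divide pos_divide_le_eq power2_eq_square mult.assoc)
      qed
      show "((\<lambda>y. 4 * C * \<bar>y - x\<bar>) \<longlongrightarrow> 0) (at x)" by (auto intro!: tendsto_eq_intros)
    qed
    then show ?thesis using 3 by (simp add: has_field_derivative_iff bump_fun_def)
  qed
qed

lemma smooth1_bump_fun: "smooth1 (bump_fun p k)"
proof -
  define Q where "Q = (\<lambda>(p, k). (bump_deriv_poly p k, k + 2))"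
  define F where "F n = case_prod bump_fun ((Q ^^ n) (p, k))" for n
  show ?thesis
  proof (rule smooth1I(1)[of F])
    show "(F n has_real_derivative F (Suc n) x) (at x)" for n x
      using bump_fun_deriv[of "fst ((Q ^^ n) (p, k))" "snd ((Q ^^ n) (p, k))" x]
      by (simp add: F_def Q_def split_beta)
  qed (simp add: F_def)
qed

section \<open>Integrals and moments of compactly supported functions\<close>

lemma integrable_compact_support:
  fixes f :: "real \<Rightarrow> real"
  assumes "continuous_on UNIV f" "\<And>x. x \<notin> {l..u} \<Longrightarrow> f x = 0"
  shows "integrable lborel f"
proof -
  have "integrable lborel (\<lambda>x. f x * indicator {l..u} x)"
    using assms(1) by (intro borel_integrable_atLeastAtMost) (simp add: continuous_on_eq_continuous_at)
  also have "(\<lambda>x. f x * indicator {l..u} x) = f"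
  proof
    show "f x * indicator {l..u} x = f x" for x using assms(2)[of x] by (cases "x \<in> {l..u}") auto
  qed
  finally show ?thesis .
qed

lemma integral_deriv_compact_support:
  fixes F :: "real \<Rightarrow> real"
  assumes "\<And>x. (F has_real_derivative f x) (at x)" "continuous_on UNIV f"
    and "\<And>x. x \<notin> {l..u} \<Longrightarrow> F x = 0" "l \<le> u"
  shows "(\<integral>x. f x \<partial>lborel) = 0"
proof -
  have f0: "f x = 0" if "x \<notin> {l..u}" for x
  proof -
    have "((\<lambda>_. 0) has_real_derivative 0) (at x)" by simp
    then have "(F has_real_derivative 0) (at x)"
      by (rule has_field_derivative_transform_within_open[of _ _ _ "- {l..u}"]) (use that assms(3) in auto)
    then show ?thesis using assms(1) DERIV_unique by blast
  qed
  \<comment> \<open>The interval is enlarged because \<open>F\<close> is only known to vanish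
    strictly outside [l, u].\<close>
  have "(\<integral>x. f x \<partial>lborel) = (\<integral>x. f x * indicator {l - 1..u + 1} x \<partial>lborel)"
  proof (rule Bochner_Integration.integral_cong[OF refl])
    show "f x = f x * indicator {l - 1..u + 1} x" for x
      using f0[of x] by (cases "x \<in> {l..u}") auto
  qed
  also have "\<dots> = F (u + 1) - F (l - 1)"
    using assms by (intro integral_FTC_Icc_real) (auto simp: continuous_on_eq_continuous_at)
  finally show ?thesis using assms(3)[of "u + 1"] assms(3)[of "l - 1"] by simp
qed

lemma ex_bump: "\<exists>b. smooth1 b \<and> (\<forall>x. x \<notin> {-1..1} \<longrightarrow> b x = 0) \<and> (\<integral>x. b x \<partial>lborel) = 1"
proof -
  define g where "g = bump_fun 1 0"
  have sm: "smooth1 g" unfolding g_def by (rule smooth1_bump_fun)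
  have sup: "g x = 0" if "x \<notin> {-1..1}" for x using that by (auto simp: g_def bump_fun_def)
  have pos: "g x > 0" if "\<bar>x\<bar> < 1" for x using that by (simp add: g_def bump_fun_def)
  have nn: "g x \<ge> 0" for x by (simp add: g_def bump_fun_def)
  have int: "integrable lborel g" by (rule integrable_compact_support[OF smooth1_cont0[OF sm] sup])
  have "(\<integral>x. g x \<partial>lborel) \<noteq> 0"
  proof
    assume "(\<integral>x. g x \<partial>lborel) = 0"
    then have "AE x in lborel. g x = 0" using integral_nonneg_eq_0_iff_AE[OF int] nn by simp
    then have "AE x in lborel. x \<notin> {-1<..<(1::real)}"
    proof eventually_elim
      case (elim x)
      then show ?case using pos[of x] by (auto simp: abs_less_iff)
    qed
    then have "{-1<..<(1::real)} \<in> null_sets lborel" by (subst (asm) AE_iff_null_sets[symmetric]) auto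
    then show False by (simp add: null_sets_def)
  qed
  moreover have "(\<integral>x. g x \<partial>lborel) \<ge> 0" using nn by simp
  ultimately have I: "(\<integral>x. g x \<partial>lborel) > 0" by simp
  define b where "b x = (1 / (\<integral>x. g x \<partial>lborel)) * g (1 * x + 0)" for x
  have "smooth1 b" unfolding b_def by (rule smooth1_affine[OF sm])
  moreover have "b x = 0" if "x \<notin> {-1..1}" for x using sup[OF that] by (simp add: b_def)
  moreover have "(\<integral>x. b x \<partial>lborel) = 1" using I by (simp add: b_def)
  ultimately show ?thesis by blast
qed

lemma integrable_moment:
  fixes f :: "real \<Rightarrow> real"
  assumes "continuous_on UNIV f" "\<And>x. x \<notin> {l..u} \<Longrightarrow> f x = 0"
  shows "integrable lborel (\<lambda>x. f x * x ^ j)"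
  using assms by (intro integrable_compact_support[of _ l u] continuous_intros) auto

text \<open>The dilates of a bump are combined with the weights that extrapolate polynomials of degree at
  most \<open>m\<close> from the dilation factors to \<open>0\<close>.\<close>

lemma ex_mollifier:
  "\<exists>\<psi>. smooth1 \<psi> \<and> (\<forall>x. x \<notin> {-1..1} \<longrightarrow> \<psi> x = 0) \<and> (\<forall>j\<le>m. (\<integral>x. \<psi> x * x ^ j \<partial>lborel) = 0 ^ j)"
proof -
  obtain b where b: "smooth1 b" "\<And>x. x \<notin> {-1..1} \<Longrightarrow> b x = 0" "(\<integral>x. b x \<partial>lborel) = 1" using ex_bump by blast
  \<comment> \<open>The dilation factors are the nodes s (1 + k), all in (0, 1], so that supports
    stay in [-1, 1]. The factor 0 corresponds to v = -1, hence the argument of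
    \<open>lagrange_basis\<close> below.\<close>
  define s where "s = 1 / real (m + 1)"
  define a where "a k = s * (1 + real k)" for k
  have s: "s > 0" by (simp add: s_def)
  have a: "a k > 0" for k using s by (simp add: a_def)
  have a1: "a k \<le> 1" if "k \<le> m" for k using that by (simp add: a_def s_def)
  define \<psi> where "\<psi> x = (\<Sum>k\<le>m. lagrange_basis m k (-1) * (1 / a k * b (1 / a k * x + 0)))" for x
  have sm: "smooth1 \<psi>" unfolding \<psi>_def by (intro smooth1_sum smooth1_affine b(1))
  have sup_k: "b (1 / a k * x + 0) = 0" if "x \<notin> {-1..1}" "k \<le> m" for x k
  proof (rule b(2))
    have "a k < \<bar>x\<bar>" using a1[OF that(2)] that(1) by (auto simp: abs_if)
    then have "1 < \<bar>x / a k\<bar>" using a[of k] by (simp add: abs_divide)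
    then show "1 / a k * x + 0 \<notin> {-1..1}" by (auto simp: abs_if split: if_splits)
  qed
  have "\<psi> x = 0" if "x \<notin> {-1..1}" for x unfolding \<psi>_def using sup_k[OF that] by simp
  moreover have "(\<integral>x. \<psi> x * x ^ j \<partial>lborel) = 0 ^ j" if j: "j \<le> m" for j
  proof -
    have mom: "(\<integral>x. 1 / a k * b (1 / a k * x + 0) * x ^ j \<partial>lborel) = a k ^ j * (\<integral>x. b x * x ^ j \<partial>lborel)" for k
    proof -
      have "(\<integral>x. 1 / a k * b (1 / a k * x + 0) * x ^ j \<partial>lborel)
          = \<bar>a k\<bar> *\<^sub>R (\<integral>x. 1 / a k * b (1 / a k * (0 + a k * x) + 0) * (0 + a k * x) ^ j \<partial>lborel)"
        using a[of k] by (intro lborel_integral_real_affine) auto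
      also have "(\<lambda>x. 1 / a k * b (1 / a k * (0 + a k * x) + 0) * (0 + a k * x) ^ j) = (\<lambda>x. (a k ^ j / a k) * (b x * x ^ j))"
        using a[of k] by (auto simp: power_mult_distrib)
      finally show ?thesis using a[of k] by simp
    qed
    have int: "integrable lborel (\<lambda>x. 1 / a k * b (1 / a k * x + 0) * x ^ j)" if "k \<le> m" for k
      using sup_k that by (intro integrable_moment[of _ "-1" 1] smooth1_cont0 smooth1_affine b(1)) auto
    have "(\<integral>x. \<psi> x * x ^ j \<partial>lborel) = (\<integral>x. (\<Sum>k\<le>m. lagrange_basis m k (-1) * (1 / a k * b (1 / a k * x + 0) * x ^ j)) \<partial>lborel)"
      by (simp add: \<psi>_def sum_distrib_right mult.assoc)
    also have "\<dots> = (\<Sum>k\<le>m. lagrange_basis m k (-1) * (a k ^ j * (\<integral>x. b x * x ^ j \<partial>lborel)))"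
    proof -
      have "(\<integral>x. (\<Sum>k\<le>m. lagrange_basis m k (-1) * (1 / a k * b (1 / a k * x + 0) * x ^ j)) \<partial>lborel)
          = (\<Sum>k\<le>m. (\<integral>x. lagrange_basis m k (-1) * (1 / a k * b (1 / a k * x + 0) * x ^ j) \<partial>lborel))"
        by (rule Bochner_Integration.integral_sum) (intro integrable_mult_right int, simp)
      then show ?thesis by (simp only: integral_mult_right_zero mom)
    qed
    also have "\<dots> = (\<Sum>k\<le>m. lagrange_basis m k (-1) * (s * (1 + real k)) ^ j) * (\<integral>x. b x * x ^ j \<partial>lborel)"
      by (simp add: a_def sum_distrib_right mult.assoc)
    also have "\<dots> = 0 ^ j * (\<integral>x. b x * x ^ j \<partial>lborel)"
      by (subst lagrange_interpolation_power[OF j]) simp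
    also have "\<dots> = 0 ^ j" using b(3) by (cases j) auto
    finally show ?thesis .
  qed
  ultimately show ?thesis using sm by blast
qed

text \<open>The integral from the left is 0 before \<open>l\<close>, and to the right of
  \<open>u\<close> it is the whole integral, which vanishes. Integration starts at l - 1 to have a
  two-sided derivative at l.\<close>

lemma ex_antiderivative_compact_support:
  assumes sm: "smooth1 V" and sup: "\<And>x. x \<notin> {l..u} \<Longrightarrow> V x = 0" and lu: "l \<le> u"
    and int0: "(\<integral>x. V x \<partial>lborel) = 0" and M: "\<And>x. \<bar>V x\<bar> \<le> M"
  shows "\<exists>W. smooth1 W \<and> deriv W = V \<and> (\<forall>x. x \<notin> {l..u} \<longrightarrow> W x = 0) \<and> (\<forall>x. \<bar>W x\<bar> \<le> (u - l) * M)"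
proof -
  define W where "W x = integral {l - 1..x} V" for x
  have cont: "continuous_on A V" for A by (rule smooth1_cont0[OF sm])
  have W_low: "W x = 0" if "x < l" for x
  proof -
    have "W x = integral {l - 1..x} (\<lambda>_. 0)" unfolding W_def using that sup by (intro integral_cong) auto
    then show ?thesis by simp
  qed
  have D: "(W has_real_derivative V x) (at x)" for x
  proof (cases "x < l")
    case True
    have "((\<lambda>_. 0) has_real_derivative 0) (at x)" by simp
    then have "(W has_real_derivative 0) (at x)"
      by (rule has_field_derivative_transform_within_open[of _ _ _ "{..<l}"]) (use True W_low in auto)
    then show ?thesis using sup True by simp
  next
    case False
    have "((\<lambda>x. integral {l - 1..x} V) has_real_derivative V x) (at x within {l - 1..x + 1})"
      using False by (intro integral_has_real_derivative cont) auto
    moreover have "at x within {l - 1..x + 1} = at x"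
      using False by (intro at_within_interior) (simp add: interior_atLeastAtMost_real)
    ultimately show ?thesis by (simp add: W_def[abs_def])
  qed
  have W_high: "W x = 0" if "x > u" for x
  proof -
    have "W x - W (l - 1) = (\<integral>y. V y * indicator {l - 1..x} y \<partial>lborel)"
      using that lu cont[of UNIV] by (intro integral_FTC_Icc_real[symmetric] D) (auto simp: continuous_on_eq_continuous_at)
    also have "\<dots> = (\<integral>y. V y \<partial>lborel)"
    proof (rule Bochner_Integration.integral_cong[OF refl])
      show "V y * indicator {l - 1..x} y = V y" for y
        using sup[of y] that by (cases "y \<in> {l..u}") auto
    qed
    finally show ?thesis using int0 W_low[of "l - 1"] by simp
  qed
  have M0: "M \<ge> 0" using M[of 0] by linarith
  have bnd: "\<bar>W x\<bar> \<le> (u - l) * M" for x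
  proof -
    have W_le: "\<bar>W x\<bar> \<le> (x - y) * M" if yl: "y < l" and yx: "y < x" for x y
    proof -
      obtain z where "W x - W y = (x - y) * V z" using MVT2[OF yx, of W V] D by blast
      then have "\<bar>W x\<bar> = (x - y) * \<bar>V z\<bar>" using W_low[OF yl] yx by (simp add: abs_mult)
      then show ?thesis using M[of z] yx by (simp add: mult_left_mono)
    qed
    consider "x < l" | "x > u" | "x \<in> {l..u}" by force
    then show ?thesis
    proof cases
      case 3
      \<comment> \<open>\<open>W\<close> is known to vanish only strictly left of \<open>l\<close>,
        so the mean value theorem is applied from l - d with d arbitrarily small.\<close>
      have "\<bar>W x\<bar> \<le> (x - l) * M + e" if "e > 0" for e
      proof -
        define d where "d = e / (M + 1)"
        have d: "d > 0" "d * M \<le> e" using that M0 by (auto simp: d_def field_simps)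
        have "\<bar>W x\<bar> \<le> (x - (l - d)) * M" using d 3 by (intro W_le) auto
        then show ?thesis using d by (simp add: algebra_simps)
      qed
      then have "\<bar>W x\<bar> \<le> (x - l) * M" by (rule field_le_epsilon)
      also have "\<dots> \<le> (u - l) * M" using 3 M0 by (intro mult_right_mono) auto
      finally show ?thesis .
    qed (use W_low W_high M0 lu in auto)
  qed
  have "smooth1 W"
  proof (rule smooth1I(1)[where F = "\<lambda>n. case n of 0 \<Rightarrow> W | Suc n \<Rightarrow> (deriv ^^ n) V"])
    show "((case n of 0 \<Rightarrow> W | Suc n \<Rightarrow> (deriv ^^ n) V) has_real_derivative
        (case Suc n of 0 \<Rightarrow> W | Suc n \<Rightarrow> (deriv ^^ n) V) x) (at x)" for n x
      using D smooth1D[OF sm] by (cases n) auto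
  qed simp
  moreover have "deriv W = V" by (intro ext DERIV_imp_deriv D)
  ultimately show ?thesis using W_low W_high bnd by (intro exI[of _ W]) force
qed

text \<open>Integration by parts: the derivative of W x^(j + 1) has integral 0.\<close>

lemma moment_antiderivative:
  assumes sm: "smooth1 W" and sup: "\<And>x. x \<notin> {l..u} \<Longrightarrow> W x = 0" and lu: "l \<le> u"
  shows "(\<integral>x. W x * x ^ j \<partial>lborel) = - (\<integral>x. deriv W x * x ^ Suc j \<partial>lborel) / real (Suc j)"
proof -
  have D: "(W has_real_derivative deriv W x) (at x)" for x using smooth1D[OF sm, of 0 x] by simp
  have c: "continuous_on UNIV W" "continuous_on UNIV (deriv W)"
    using smooth1_cont[OF sm, of UNIV 0] smooth1_cont[OF sm, of UNIV 1] by simp_all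
  have dsup: "deriv W x = 0" if "x \<notin> {l..u}" for x
  proof -
    have "((\<lambda>_. 0) has_real_derivative 0) (at x)" by simp
    then have "(W has_real_derivative 0) (at x)"
      by (rule has_field_derivative_transform_within_open[of _ _ _ "- {l..u}"]) (use that sup in auto)
    then show ?thesis by (rule DERIV_imp_deriv)
  qed
  have i1: "integrable lborel (\<lambda>x. deriv W x * x ^ Suc j)" by (rule integrable_moment[OF c(2) dsup])
  have i2: "integrable lborel (\<lambda>x. real (Suc j) * (W x * x ^ j))" by (intro integrable_mult_right integrable_moment[OF c(1) sup])
  have "(\<integral>x. deriv W x * x ^ Suc j + real (Suc j) * (W x * x ^ j) \<partial>lborel) = 0"
  proof (rule integral_deriv_compact_support[where F = "\<lambda>x. W x * x ^ Suc j", OF _ _ _ lu])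
    show "((\<lambda>x. W x * x ^ Suc j) has_real_derivative deriv W x * x ^ Suc j + real (Suc j) * (W x * x ^ j)) (at x)" for x
      using DERIV_mult[OF D DERIV_pow[of "Suc j" x UNIV]] by (simp add: algebra_simps)
  qed (use c sup in \<open>auto intro!: continuous_intros\<close>)
  then have "(\<integral>x. deriv W x * x ^ Suc j \<partial>lborel) + real (Suc j) * (\<integral>x. W x * x ^ j \<partial>lborel) = 0"
    by (simp only: Bochner_Integration.integral_add[OF i1 i2] integral_mult_right_zero)
  then have "real (Suc j) * (\<integral>x. W x * x ^ j \<partial>lborel) = - (\<integral>x. deriv W x * x ^ Suc j \<partial>lborel)" by linarith
  then show ?thesis by (simp only: nonzero_eq_divide_eq mult.commute of_nat_neq_0 not_False_eq_True)
qed

text \<open>Every integration consumes one vanishing moment and lowers the order of the others. Of p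
  + 1 moments one is left after p integrations, the mean value 0 of W, which the fractional seminorm
  will need.\<close>

lemma ex_iterated_antiderivative:
  assumes "smooth1 V" "\<And>x. x \<notin> {l..u} \<Longrightarrow> V x = 0" "l \<le> u"
    and "\<And>j. j \<le> p \<Longrightarrow> (\<integral>x. V x * x ^ j \<partial>lborel) = 0" and "\<And>x. \<bar>V x\<bar> \<le> M"
  shows "\<exists>W. smooth1 W \<and> (deriv ^^ p) W = V \<and> (\<forall>x. x \<notin> {l..u} \<longrightarrow> W x = 0) \<and>
    (\<forall>x. \<bar>W x\<bar> \<le> (u - l) ^ p * M) \<and> (\<integral>x. W x \<partial>lborel) = 0"
  using assms
proof (induction p arbitrary: V M)
  case 0
  then show ?case using "0.prems"(4)[of 0] by (intro exI[of _ V]) auto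
next
  case (Suc p)
  obtain W where W: "smooth1 W" "deriv W = V" "\<And>x. x \<notin> {l..u} \<Longrightarrow> W x = 0" "\<And>x. \<bar>W x\<bar> \<le> (u - l) * M"
    using ex_antiderivative_compact_support[OF Suc.prems(1-3) _ Suc.prems(5)] Suc.prems(4)[of 0] by auto
  have mom: "(\<integral>x. W x * x ^ j \<partial>lborel) = 0" if "j \<le> p" for j
    using moment_antiderivative[OF W(1,3) Suc.prems(3), of j] Suc.prems(4)[of "Suc j"] that by (simp add: W(2))
  obtain U where U: "smooth1 U" "(deriv ^^ p) U = W" "\<forall>x. x \<notin> {l..u} \<longrightarrow> U x = 0"
      "\<forall>x. \<bar>U x\<bar> \<le> (u - l) ^ p * ((u - l) * M)" "(\<integral>x. U x \<partial>lborel) = 0"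
    using Suc.IH[OF W(1,3) Suc.prems(3) mom W(4)] by blast
  have "(deriv ^^ Suc p) U = V" using U(2) W(2) by simp
  then show ?case using U by (intro exI[of _ U]) (auto simp: mult_ac)
qed

section \<open>Pairing Sobolev functions with tensor products\<close>

definition tensor :: "('d \<Rightarrow> real \<Rightarrow> real) \<Rightarrow> real^'d::finite \<Rightarrow> real" where
  "tensor C y = (\<Prod>i\<in>UNIV. C i (y $ i))"

lemma tensor_has_derivative:
  assumes "\<And>i. smooth1 (C i)"
  shows "(tensor C has_derivative (\<lambda>v. \<Sum>i\<in>UNIV. (deriv (C i) (x $ i) * v $ i) * (\<Prod>j\<in>UNIV - {i}. C j (x $ j)))) (at x)"
  unfolding tensor_def[abs_def]
proof (rule has_derivative_prod)
  fix i
  have "(C i has_derivative (\<lambda>h. deriv (C i) (x $ i) * h)) (at (x $ i))"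
    using smooth1D[OF assms[of i], of 0 "x $ i"] by (simp add: has_field_derivative_def)
  moreover have "((\<lambda>y. y $ i) has_derivative (\<lambda>v. v $ i)) (at x)"
    by (rule bounded_linear_imp_has_derivative) (rule bounded_linear_vec_nth)
  ultimately show "((\<lambda>y. C i (y $ i)) has_derivative (\<lambda>v. deriv (C i) (x $ i) * v $ i)) (at x)"
    using has_derivative_compose[of "\<lambda>y. y $ i"] by blast
qed

lemma smooth1_deriv_iter: "smooth1 f \<Longrightarrow> smooth1 ((deriv ^^ n) f)"
  by (rule smooth1I(1)[where F = "\<lambda>k. (deriv ^^ (k + n)) f"]) (use smooth1D in auto)

lemma partials_tensor:
  assumes "\<And>i. smooth1 (C i)"
  shows "partials is (tensor C) = tensor (\<lambda>i. (deriv ^^ count_list is i) (C i))"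
proof (induction "is")
  case (Cons a as)
  define C' where "C' i = (deriv ^^ count_list as i) (C i)" for i
  have sm: "smooth1 (C' i)" for i unfolding C'_def by (rule smooth1_deriv_iter[OF assms])
  have "frechet_derivative (tensor C') (at x) (axis a 1) = tensor (\<lambda>i. (deriv ^^ count_list (a # as) i) (C i)) x" for x
  proof -
    have "frechet_derivative (tensor C') (at x) =
        (\<lambda>v. \<Sum>i\<in>UNIV. (deriv (C' i) (x $ i) * v $ i) * (\<Prod>j\<in>UNIV - {i}. C' j (x $ j)))"
      using tensor_has_derivative[of C' x] sm by (simp add: frechet_derivative_at[symmetric])
    then have "frechet_derivative (tensor C') (at x) (axis a 1) =
      (\<Sum>i\<in>UNIV. if i = a then deriv (C' i) (x $ i) * (\<Prod>j\<in>UNIV - {i}. C' j (x $ j)) else 0)"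
      by (simp only:) (rule sum.cong, auto simp: axis_def)
    also have "\<dots> = deriv (C' a) (x $ a) * (\<Prod>j\<in>UNIV - {a}. C' j (x $ j))" by simp
    also have "\<dots> = tensor (\<lambda>i. (deriv ^^ count_list (a # as) i) (C i)) x"
      unfolding tensor_def by (subst prod.remove[of UNIV a]) (auto simp: C'_def intro!: prod.cong)
    finally show ?thesis .
  qed
  moreover have "partials as (tensor C) = tensor C'" using Cons by (simp add: C'_def[abs_def])
  ultimately show ?case by simp
qed simp

lemma smooth_on_tensor:
  assumes "\<And>i. smooth1 (C i)"
  shows "smooth_on UNIV (tensor C)"
  unfolding smooth_on_def partials_tensor[OF assms] differentiable_def
proof (intro allI ballI exI)
  show "(tensor (\<lambda>i. (deriv ^^ count_list is i) (C i)) has_derivative (\<lambda>v. \<Sum>i\<in>UNIV.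
      (deriv ((deriv ^^ count_list is i) (C i)) (x $ i) * v $ i) *
      (\<Prod>j\<in>UNIV - {i}. (deriv ^^ count_list is j) (C j) (x $ j)))) (at x)" for "is" x
    by (rule tensor_has_derivative) (rule smooth1_deriv_iter[OF assms])
qed

lemma continuous_on_tensor:
  assumes "\<And>i. continuous_on UNIV (C i)"
  shows "continuous_on A (tensor C)"
proof -
  have "continuous_on A (\<lambda>y. C i (y $ i))" for i
    by (rule continuous_on_compose2[OF assms]) (auto intro: continuous_intros)
  then show ?thesis unfolding tensor_def[abs_def] by (intro continuous_on_prod)
qed

lemma tensor_eq_0:
  assumes "\<And>i s. s \<notin> {lo $ i..hi $ i} \<Longrightarrow> C i s = 0" "y \<notin> cbox lo hi"
  shows "tensor C y = 0"
proof -
  obtain i where "y $ i \<notin> {lo $ i..hi $ i}" using assms(2) by (auto simp: mem_box_cart)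
  then have "\<exists>i\<in>UNIV. C i (y $ i) = 0" using assms(1) by blast
  then show ?thesis unfolding tensor_def by (intro prod_zero) auto
qed

lemma test_function_tensor:
  assumes "\<And>i. smooth1 (C i)" and sup: "\<And>i s. s \<notin> {lo $ i..hi $ i} \<Longrightarrow> C i s = 0" and "cbox lo hi \<subseteq> U"
  shows "test_function U (tensor C)"
proof -
  have "closure {x. tensor C x \<noteq> 0} \<subseteq> cbox lo hi"
    by (rule closure_minimal) (use tensor_eq_0[of lo hi C, OF sup] in auto)
  moreover from this have "compact (closure {x. tensor C x \<noteq> 0})"
    by (simp add: compact_eq_bounded_closed bounded_subset[OF bounded_cbox])
  ultimately show ?thesis unfolding test_function_def
    using smooth_on_tensor[of C, OF assms(1)] assms(3) by blast
qed

text \<open>For tensor products only the counts in the list of directions matter, so it suffices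
  that some list has the required counts; a constant list does.\<close>

lemma multi_partial_tensor:
  assumes "\<And>i. smooth1 (C i)"
  shows "multi_partial (\<lambda>j. if j = i then m else 0) (tensor C) = tensor (C(i := (deriv ^^ m) (C i)))"
proof -
  define xs where "xs = (SOME is. \<forall>j. count_list is j = (if j = i then m else 0))"
  have "\<forall>j. count_list (replicate m i) j = (if j = i then m else 0)" by (induction m) auto
  then have "\<forall>j. count_list xs j = (if j = i then m else 0)" unfolding xs_def by (rule someI)
  then have "(\<lambda>j. (deriv ^^ count_list xs j) (C j)) = C(i := (deriv ^^ m) (C i))" by (auto simp: fun_eq_iff)
  then show ?thesis unfolding multi_partial_def xs_def[symmetric] partials_tensor[OF assms] by simp
qed

text \<open>Fubini's theorem. Lebesgue measure on vectors is the image of a product indexed by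
  \<open>Basis\<close>, so the factors are first moved from coordinates i to basis vectors
  \<open>axis i 1\<close>.\<close>

lemma integral_tensor:
  assumes "\<And>i. integrable lborel (C i)"
  shows "(\<integral>y. tensor C y \<partial>lborel) = (\<Prod>i\<in>(UNIV :: 'd::finite set). \<integral>s. C i s \<partial>lborel)"
proof -
  interpret product_sigma_finite "\<lambda>_. lborel::real measure" by standard
  let ?B = "Basis :: (real^'d) set"
  have B: "?B = range (\<lambda>i. axis i 1)" by (auto simp: Basis_vec_def)
  have inj: "inj (\<lambda>i::'d. axis i (1::real))" by (auto simp: inj_def axis_eq_axis)
  have nth: "(\<Sum>b\<in>?B. f b *\<^sub>R b) $ i = f (axis i 1)" for f i
  proof -
    have "(\<Sum>b\<in>?B. f b *\<^sub>R b) $ i = (\<Sum>j\<in>UNIV. f (axis j 1) * (axis j (1::real) :: real^'d) $ i)"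
      unfolding B by (subst sum.reindex[OF inj]) (simp add: sum_component)
    also have "\<dots> = (\<Sum>j\<in>UNIV. if j = i then f (axis j 1) else 0)"
      by (intro sum.cong) (auto simp: axis_def)
    finally show ?thesis by simp
  qed
  define c where "c b = C (inv (\<lambda>i::'d. axis i (1::real)) b)" for b
  have c: "c (axis i 1) = C i" for i by (simp add: c_def inv_f_f[OF inj])
  have [measurable]: "C i \<in> borel_measurable borel" for i using borel_measurable_integrable[OF assms[of i]] by simp
  have "(\<integral>y. tensor C y \<partial>lborel) = (\<integral>y. tensor C y \<partial>distr (\<Pi>\<^sub>M b\<in>?B. lborel) borel (\<lambda>f. \<Sum>b\<in>?B. f b *\<^sub>R b))"
    by (simp add: lborel_eq[symmetric])
  also have "\<dots> = (\<integral>f. tensor C (\<Sum>b\<in>?B. f b *\<^sub>R b) \<partial>(\<Pi>\<^sub>M b\<in>?B. lborel))"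
    by (rule integral_distr) (auto simp: tensor_def[abs_def] intro!: borel_measurable_prod)
  also have "\<dots> = (\<integral>f. (\<Prod>b\<in>?B. c b (f b)) \<partial>(\<Pi>\<^sub>M b\<in>?B. lborel))"
  proof -
    have "tensor C (\<Sum>b\<in>?B. f b *\<^sub>R b) = (\<Prod>b\<in>?B. c b (f b))" for f
    proof -
      have "(\<Prod>b\<in>?B. c b (f b)) = (\<Prod>i\<in>UNIV. C i (f (axis i 1)))"
        unfolding B by (subst prod.reindex[OF inj]) (simp add: c)
      then show ?thesis by (simp only: tensor_def nth)
    qed
    then show ?thesis by simp
  qed
  also have "\<dots> = (\<Prod>b\<in>?B. \<integral>s. c b s \<partial>lborel)"
    by (rule product_integral_prod) (auto simp: B c assms)
  also have "\<dots> = (\<Prod>i\<in>UNIV. \<integral>s. C i s \<partial>lborel)"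
    unfolding B by (subst prod.reindex[OF inj]) (simp add: c)
  finally show ?thesis .
qed

section \<open>Bounds for pairings with functions of small support\<close>

lemma integral_lebesgue_on_eq_lborel:
  fixes \<phi> :: "real^'d::finite \<Rightarrow> real"
  assumes "continuous_on UNIV \<phi>" "\<And>y. y \<notin> U \<Longrightarrow> \<phi> y = 0" "U \<in> sets lebesgue"
  shows "(\<integral>y. \<phi> y \<partial>lebesgue_on U) = (\<integral>y. \<phi> y \<partial>lborel)"
proof -
  have "(\<integral>y. \<phi> y \<partial>lebesgue_on U) = (\<integral>y. indicator U y *\<^sub>R \<phi> y \<partial>lebesgue)"
    using assms(3) by (intro integral_restrict_space) simp
  also have "\<dots> = (\<integral>y. \<phi> y \<partial>lebesgue)"
    using assms(2) by (intro Bochner_Integration.integral_cong) (auto simp: indicator_def)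
  also have "\<dots> = (\<integral>y. \<phi> y \<partial>lborel)"
    using assms(1) by (intro integral_completion) (simp add: borel_measurable_continuous_onI)
  finally show ?thesis .
qed

lemma integral_subset_support:
  fixes \<phi> :: "real^'d::finite \<Rightarrow> real"
  assumes "B \<subseteq> U" "B \<in> sets lebesgue" "U \<in> sets lebesgue" "\<And>y. y \<notin> B \<Longrightarrow> \<phi> y = 0"
  shows "(\<integral>y. \<phi> y \<partial>lebesgue_on U) = (\<integral>y. \<phi> y \<partial>lebesgue_on B)"
proof -
  have "(\<integral>y. \<phi> y \<partial>lebesgue_on U) = (\<integral>y. indicator U y *\<^sub>R \<phi> y \<partial>lebesgue)"
    using assms(3) by (intro integral_restrict_space) simp
  also have "\<dots> = (\<integral>y. indicator B y *\<^sub>R \<phi> y \<partial>lebesgue)"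
    using assms(1,4) by (intro Bochner_Integration.integral_cong) (auto simp: indicator_def)
  also have "\<dots> = (\<integral>y. \<phi> y \<partial>lebesgue_on B)"
    using assms(2) by (intro integral_restrict_space[symmetric]) simp
  finally show ?thesis .
qed

text \<open>Stands in for the Cauchy-Schwarz inequality, with \<open>\<kappa>\<close> optimised in every application.\<close>

lemma two_abs_le: "\<kappa> > 0 \<Longrightarrow> \<bar>a\<bar> \<le> \<kappa> / 2 + a\<^sup>2 / (2 * \<kappa>)" for a \<kappa> :: real
proof -
  assume l: "\<kappa> > 0"
  have "0 \<le> (\<bar>a\<bar> - \<kappa>)\<^sup>2" by simp
  then have "2 * \<kappa> * \<bar>a\<bar> \<le> \<kappa>\<^sup>2 + a\<^sup>2" by (simp add: power2_eq_square algebra_simps)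
  then show ?thesis using l by (simp add: field_simps power2_eq_square)
qed

lemma abs_integral_mult_le:
  fixes g \<phi> :: "'a::euclidean_space \<Rightarrow> real"
  assumes fin: "finite_measure M" and g: "g \<in> borel_measurable M" "integrable M (\<lambda>x. (g x)\<^sup>2)"
    and \<phi>: "\<phi> \<in> borel_measurable M" "\<And>x. \<bar>\<phi> x\<bar> \<le> b" and l: "\<kappa> > 0"
  shows "\<bar>\<integral>x. g x * \<phi> x \<partial>M\<bar> \<le> b * (\<kappa> / 2 * measure M (space M) + (\<integral>x. (g x)\<^sup>2 \<partial>M) / (2 * \<kappa>))"
proof -
  interpret finite_measure M by fact
  have b: "b \<ge> 0" using \<phi>(2) abs_ge_zero order_trans by blast
  have i: "integrable M (\<lambda>x. \<kappa> / 2 + (g x)\<^sup>2 / (2 * \<kappa>))" using g(2) by simp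
  have "\<bar>\<integral>x. g x * \<phi> x \<partial>M\<bar> \<le> (\<integral>x. b * (\<kappa> / 2 + (g x)\<^sup>2 / (2 * \<kappa>)) \<partial>M)"
  proof (rule integral_abs_bound_integral)
    have *: "\<bar>g x * \<phi> x\<bar> \<le> b * (\<kappa> / 2 + (g x)\<^sup>2 / (2 * \<kappa>))" for x
    proof -
      have "\<bar>g x * \<phi> x\<bar> \<le> \<bar>g x\<bar> * b" unfolding abs_mult using \<phi>(2) by (intro mult_left_mono) auto
      also have "\<dots> \<le> (\<kappa> / 2 + (g x)\<^sup>2 / (2 * \<kappa>)) * b" using two_abs_le[OF l] b by (intro mult_right_mono)
      finally show ?thesis by (simp add: mult.commute)
    qed
    then show "\<bar>g x * \<phi> x\<bar> \<le> b * (\<kappa> / 2 + (g x)\<^sup>2 / (2 * \<kappa>))" for x .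
    show ib: "integrable M (\<lambda>x. b * (\<kappa> / 2 + (g x)\<^sup>2 / (2 * \<kappa>)))" using i by (rule integrable_mult_right)
    show "integrable M (\<lambda>x. g x * \<phi> x)"
      using g(1) \<phi>(1) by (intro Bochner_Integration.integrable_bound[OF ib] AE_I2) (auto intro: order_trans[OF * abs_ge_self])
  qed
  also have "\<dots> = b * (\<kappa> / 2 * measure M (space M) + (\<integral>x. (g x)\<^sup>2 \<partial>M) / (2 * \<kappa>))"
    using g(2) by (simp add: mult.commute)
  finally show ?thesis .
qed

text \<open>As \<phi> has mean 0, a constant may be subtracted from g. With the mean of g as this
  constant only differences of values of g remain, and these are what the double integral
  controls.\<close>

lemma abs_integral_mult_le_diff:
  fixes g \<phi> :: "'a::euclidean_space \<Rightarrow> real"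
  assumes fin: "finite_measure M" and g: "g \<in> borel_measurable M" "integrable M (\<lambda>x. (g x)\<^sup>2)"
    and \<phi>: "\<phi> \<in> borel_measurable M" "\<And>x. \<bar>\<phi> x\<bar> \<le> b" "(\<integral>x. \<phi> x \<partial>M) = 0"
    and l: "\<kappa> > 0" and v: "v = measure M (space M)" "v > 0"
    and Q: "(\<integral>\<^sup>+x. (\<integral>\<^sup>+z. ennreal ((g x - g z)\<^sup>2) \<partial>M) \<partial>M) \<le> ennreal Q" "Q \<ge> 0"
  shows "\<bar>\<integral>x. g x * \<phi> x \<partial>M\<bar> \<le> b * (\<kappa> / 2 * v + Q / (2 * \<kappa> * v))"
proof -
  interpret finite_measure M by fact
  have b: "b \<ge> 0" using \<phi>(2) abs_ge_zero order_trans by blast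
  have ig: "integrable M g"
  proof (rule Bochner_Integration.integrable_bound)
    show "integrable M (\<lambda>x. 1 / 2 + (g x)\<^sup>2 / (2 * 1))" using g(2) by simp
    show "AE x in M. norm (g x) \<le> norm (1 / 2 + (g x)\<^sup>2 / (2 * 1))"
      using two_abs_le[of 1] by (intro AE_I2) (auto intro: order_trans[OF _ abs_ge_self])
  qed (rule g(1))
  define G where "G = (\<integral>x. g x \<partial>M)"
  define G2 where "G2 = (\<integral>x. (g x)\<^sup>2 \<partial>M)"
  define q where "q x = (\<integral>z. (g x - g z)\<^sup>2 \<partial>M)" for x
  have i2: "integrable M (\<lambda>z. (g x - g z)\<^sup>2)" for x
    using ig g(2) by (simp add: power2_diff)
  have q: "q x = v * (g x)\<^sup>2 + G2 - 2 * g x * G" for x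
    unfolding q_def power2_diff using ig g(2) by (simp add: v(1) G_def G2_def)
  have q0: "q x \<ge> 0" for x by (simp add: q_def)
  have iq: "integrable M q" unfolding q[abs_def] using ig g(2) by simp
  have intq: "(\<integral>x. q x \<partial>M) \<le> Q"
  proof -
    have "ennreal (\<integral>x. q x \<partial>M) = (\<integral>\<^sup>+x. ennreal (q x) \<partial>M)"
      using q0 iq by (intro nn_integral_eq_integral[symmetric]) auto
    also have "\<dots> = (\<integral>\<^sup>+x. (\<integral>\<^sup>+z. ennreal ((g x - g z)\<^sup>2) \<partial>M) \<partial>M)"
      unfolding q_def using i2 by (intro nn_integral_cong nn_integral_eq_integral[symmetric]) auto
    also have "\<dots> \<le> ennreal Q" by (rule Q(1))
    finally show ?thesis using Q(2) by simp
  qed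
  have dev: "\<bar>v * g x - G\<bar> \<le> \<kappa> / 2 * v + q x / (2 * \<kappa>)" for x
  proof -
    have "v * g x - G = (\<integral>z. g x - g z \<partial>M)" using ig by (simp add: v(1) G_def)
    also have "\<bar>\<dots>\<bar> \<le> (\<integral>z. \<kappa> / 2 + (g x - g z)\<^sup>2 / (2 * \<kappa>) \<partial>M)"
      using ig i2 two_abs_le[OF l] by (intro integral_abs_bound_integral) auto
    also have "\<dots> = \<kappa> / 2 * v + q x / (2 * \<kappa>)" using i2 by (simp add: q_def v(1))
    finally show ?thesis .
  qed
  have i\<phi>: "integrable M \<phi>" using \<phi>(1,2) by (intro integrable_const_bound[of _ b]) auto
  have ig\<phi>: "integrable M (\<lambda>x. g x * \<phi> x)"
  proof (rule Bochner_Integration.integrable_bound)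
    show "integrable M (\<lambda>x. b * g x)" using ig by simp
    show "AE x in M. norm (g x * \<phi> x) \<le> norm (b * g x)"
      using \<phi>(2) b by (intro AE_I2) (auto simp: abs_mult mult.commute intro!: mult_right_mono)
  qed (use g(1) \<phi>(1) in measurable)
  have "v * (\<integral>x. g x * \<phi> x \<partial>M) = (\<integral>x. (v * g x - G) * \<phi> x \<partial>M)"
  proof -
    have "(\<integral>x. (v * g x - G) * \<phi> x \<partial>M) = (\<integral>x. v * (g x * \<phi> x) - G * \<phi> x \<partial>M)"
      by (simp add: algebra_simps)
    also have "\<dots> = v * (\<integral>x. g x * \<phi> x \<partial>M) - G * (\<integral>x. \<phi> x \<partial>M)"
      using ig\<phi> i\<phi> by simp
    finally show ?thesis by (simp add: \<phi>(3))
  qed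
  also have "\<bar>\<dots>\<bar> \<le> (\<integral>x. b * (\<kappa> / 2 * v + q x / (2 * \<kappa>)) \<partial>M)"
  proof (rule integral_abs_bound_integral)
    show "\<bar>(v * g x - G) * \<phi> x\<bar> \<le> b * (\<kappa> / 2 * v + q x / (2 * \<kappa>))" for x
    proof -
      have "\<bar>(v * g x - G) * \<phi> x\<bar> \<le> (\<kappa> / 2 * v + q x / (2 * \<kappa>)) * b"
        unfolding abs_mult using dev[of x] \<phi>(2)[of x] by (intro mult_mono) (auto intro: order_trans[OF abs_ge_zero])
      then show ?thesis by (simp add: mult.commute)
    qed
    have "integrable M (\<lambda>x. v * (g x * \<phi> x) - G * \<phi> x)" using ig\<phi> i\<phi> by simp
    then show "integrable M (\<lambda>x. (v * g x - G) * \<phi> x)" by (simp add: algebra_simps)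
  qed (use iq in simp)
  also have "\<dots> = b * (\<kappa> / 2 * v * v + (\<integral>x. q x \<partial>M) / (2 * \<kappa>))" using iq by (simp add: v(1))
  also have "\<dots> \<le> b * (\<kappa> / 2 * v * v + Q / (2 * \<kappa>))"
    using intq b l by (intro mult_left_mono add_left_mono divide_right_mono) auto
  also have "\<dots> = v * (b * (\<kappa> / 2 * v + Q / (2 * \<kappa> * v)))" using v(2) by (simp add: field_simps)
  finally show ?thesis using v(2) by (simp add: abs_mult)
qed

lemma finite_multi_order_le: "finite {\<alpha> :: 'd::finite \<Rightarrow> nat. multi_order \<alpha> \<le> n}"
proof (rule finite_subset)
  show "{\<alpha> :: 'd \<Rightarrow> nat. multi_order \<alpha> \<le> n} \<subseteq> PiE UNIV (\<lambda>_. {..n})"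
  proof
    fix \<alpha> :: "'d \<Rightarrow> nat" assume "\<alpha> \<in> {\<alpha>. multi_order \<alpha> \<le> n}"
    moreover have "\<alpha> i \<le> multi_order \<alpha>" for i unfolding multi_order_def by (rule member_le_sum) auto
    ultimately show "\<alpha> \<in> PiE UNIV (\<lambda>_. {..n})" by (auto intro: order_trans)
  qed
qed (intro finite_PiE, auto)

lemma sobolev_weak_deriv:
  assumes f: "f \<in> sobolev_space U \<tau>" and N: "sobolev_norm U \<tau> f \<le> N" and \<alpha>: "multi_order \<alpha> = nat \<lfloor>\<tau>\<rfloor>"
  shows "is_weak_deriv U \<alpha> f (weak_deriv U \<alpha> f)"
    and "(\<integral>x. (weak_deriv U \<alpha> f x)\<^sup>2 \<partial>lebesgue_on U) \<le> N\<^sup>2"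
    and "frac \<tau> > 0 \<Longrightarrow> slobodeckij U (frac \<tau>) (weak_deriv U \<alpha> f) \<le> ennreal (N\<^sup>2)"
proof -
  show "is_weak_deriv U \<alpha> f (weak_deriv U \<alpha> f)"
  proof -
    have "\<forall>\<alpha>. multi_order \<alpha> \<le> nat \<lfloor>\<tau>\<rfloor> \<longrightarrow> (\<exists>g. is_weak_deriv U \<alpha> f g)"
      using f unfolding sobolev_space_def by blast
    then have "\<exists>g. is_weak_deriv U \<alpha> f g" using \<alpha> by simp
    then show ?thesis unfolding weak_deriv_def by (rule someI_ex)
  qed
  let ?A = "\<Sum>\<alpha> | multi_order \<alpha> \<le> nat \<lfloor>\<tau>\<rfloor>. \<integral>x. (weak_deriv U \<alpha> f x)\<^sup>2 \<partial>lebesgue_on U"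
  let ?B = "if frac \<tau> > 0
      then \<Sum>\<alpha> | multi_order \<alpha> = nat \<lfloor>\<tau>\<rfloor>. enn2real (slobodeckij U (frac \<tau>) (weak_deriv U \<alpha> f)) else 0"
  have A: "(\<integral>x. (weak_deriv U \<alpha> f x)\<^sup>2 \<partial>lebesgue_on U) \<le> ?A"
    by (rule member_le_sum) (use \<alpha> finite_multi_order_le in auto)
  have B: "enn2real (slobodeckij U (frac \<tau>) (weak_deriv U \<alpha> f)) \<le> ?B" if "frac \<tau> > 0"
  proof -
    have "finite {\<alpha> :: 'a \<Rightarrow> nat. multi_order \<alpha> = nat \<lfloor>\<tau>\<rfloor>}"
      by (rule finite_subset[OF _ finite_multi_order_le[of "nat \<lfloor>\<tau>\<rfloor>"]]) auto
    then have "enn2real (slobodeckij U (frac \<tau>) (weak_deriv U \<alpha> f))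
        \<le> (\<Sum>\<alpha> | multi_order \<alpha> = nat \<lfloor>\<tau>\<rfloor>. enn2real (slobodeckij U (frac \<tau>) (weak_deriv U \<alpha> f)))"
      by (intro member_le_sum) (use \<alpha> in auto)
    then show ?thesis using that by simp
  qed
  have A0: "?A \<ge> 0" and B0: "?B \<ge> 0" by (auto intro!: sum_nonneg)
  have N2: "?A + ?B \<le> N\<^sup>2"
  proof -
    have "sqrt (?A + ?B) \<le> N" using N unfolding sobolev_norm_def .
    then show ?thesis using A0 B0 by (simp add: sqrt_le_D)
  qed
  show "(\<integral>x. (weak_deriv U \<alpha> f x)\<^sup>2 \<partial>lebesgue_on U) \<le> N\<^sup>2" using A B0 N2 by linarith
  show "slobodeckij U (frac \<tau>) (weak_deriv U \<alpha> f) \<le> ennreal (N\<^sup>2)" if fr: "frac \<tau> > 0"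
  proof -
    \<comment> \<open>\<open>enn2real\<close> maps infinity to 0, so the norm bounds the seminorm
      only together with its finiteness.\<close>
    have fin: "slobodeckij U (frac \<tau>) (weak_deriv U \<alpha> f) < \<infinity>" using f \<alpha> fr by (auto simp: sobolev_space_def)
    then have "slobodeckij U (frac \<tau>) (weak_deriv U \<alpha> f) = ennreal (enn2real (slobodeckij U (frac \<tau>) (weak_deriv U \<alpha> f)))"
      by (simp add: less_top)
    also have "\<dots> \<le> ennreal (N\<^sup>2)" using B[OF fr] A0 N2 by (intro ennreal_leI) linarith
    finally show ?thesis .
  qed
qed

lemma nn_integral_lebesgue_on_mono:
  assumes "B \<subseteq> U" "B \<in> sets lebesgue" "U \<in> sets lebesgue"
  shows "(\<integral>\<^sup>+x. h x \<partial>lebesgue_on B) \<le> (\<integral>\<^sup>+x. h x \<partial>lebesgue_on U)"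
  using assms by (subst (1 2) nn_integral_restrict_space) (auto intro!: nn_integral_mono simp: indicator_def)

text \<open>On a set of diameter at most \<delta> the weight in the seminorm is bounded below by a
  negative power of \<delta>, which can be taken out.\<close>

lemma local_slobodeckij_le:
  fixes U :: "(real^'d::finite) set"
  assumes BU: "B \<subseteq> U" "B \<in> sets lebesgue" "U \<in> sets lebesgue" and fin: "finite_measure (lebesgue_on B)"
    and g: "g \<in> borel_measurable (lebesgue_on B)" and \<delta>: "\<And>x y. x \<in> B \<Longrightarrow> y \<in> B \<Longrightarrow> dist x y \<le> \<delta>" and \<sigma>: "\<sigma> > 0"
    and S: "slobodeckij U \<sigma> g \<le> ennreal S" "S \<ge> 0"
  shows "(\<integral>\<^sup>+x. (\<integral>\<^sup>+z. ennreal ((g x - g z)\<^sup>2) \<partial>lebesgue_on B) \<partial>lebesgue_on B)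
    \<le> ennreal (\<delta> powr (real CARD('d) + 2 * \<sigma>) * S)"
proof -
  define e where "e = real CARD('d) + 2 * \<sigma>"
  have e: "e > 0" using \<sigma> by (simp add: e_def add_nonneg_pos)
  define h where "h x z = (g x - g z)\<^sup>2 / dist x z powr e" for x z
  interpret finite_measure "lebesgue_on B" by fact
  note g[measurable]
  have [measurable]: "(\<lambda>x. x) \<in> borel_measurable (lebesgue_on B)"
    using measurable_restrict_space1[OF measurable_completion[of "\<lambda>x. x" lborel borel]] by simp
  have m1: "(\<lambda>p. ennreal (h (fst p) (snd p))) \<in> borel_measurable (lebesgue_on B \<Otimes>\<^sub>M lebesgue_on B)"
    unfolding h_def by measurable
  have m2: "(\<lambda>z. ennreal (h x z)) \<in> borel_measurable (lebesgue_on B)" for x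
    unfolding h_def by measurable
  have m3: "(\<lambda>x. \<integral>\<^sup>+z. ennreal (h x z) \<partial>lebesgue_on B) \<in> borel_measurable (lebesgue_on B)"
    using borel_measurable_nn_integral_fst[OF m1] by simp
  have pt: "ennreal ((g x - g z)\<^sup>2) \<le> ennreal (\<delta> powr e) * ennreal (h x z)" if "x \<in> B" "z \<in> B" for x z
  proof (cases "x = z")
    case False
    then have d: "dist x z > 0" by simp
    have "dist x z powr e \<le> \<delta> powr e" using \<delta>[OF that] e d by (intro powr_mono2) auto
    then have "(g x - g z)\<^sup>2 * dist x z powr e \<le> (g x - g z)\<^sup>2 * \<delta> powr e" by (intro mult_left_mono) auto
    then have "(g x - g z)\<^sup>2 \<le> \<delta> powr e * h x z" using d by (simp add: h_def field_simps)
    then show ?thesis by (simp add: h_def ennreal_mult[symmetric] ennreal_leI)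
  qed simp
  have "(\<integral>\<^sup>+x. (\<integral>\<^sup>+z. ennreal ((g x - g z)\<^sup>2) \<partial>lebesgue_on B) \<partial>lebesgue_on B)
      \<le> (\<integral>\<^sup>+x. (\<integral>\<^sup>+z. ennreal (\<delta> powr e) * ennreal (h x z) \<partial>lebesgue_on B) \<partial>lebesgue_on B)"
    using pt by (intro nn_integral_mono) simp
  also have "\<dots> = ennreal (\<delta> powr e) * (\<integral>\<^sup>+x. (\<integral>\<^sup>+z. ennreal (h x z) \<partial>lebesgue_on B) \<partial>lebesgue_on B)"
    using m2 m3 by (simp add: nn_integral_cmult)
  also have "(\<integral>\<^sup>+x. (\<integral>\<^sup>+z. ennreal (h x z) \<partial>lebesgue_on B) \<partial>lebesgue_on B) \<le> slobodeckij U \<sigma> g"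
  proof -
    have "(\<integral>\<^sup>+x. (\<integral>\<^sup>+z. ennreal (h x z) \<partial>lebesgue_on B) \<partial>lebesgue_on B)
        \<le> (\<integral>\<^sup>+x. (\<integral>\<^sup>+z. ennreal (h x z) \<partial>lebesgue_on U) \<partial>lebesgue_on B)"
      by (intro nn_integral_mono nn_integral_lebesgue_on_mono BU)
    also have "\<dots> \<le> (\<integral>\<^sup>+x. (\<integral>\<^sup>+z. ennreal (h x z) \<partial>lebesgue_on U) \<partial>lebesgue_on U)"
      by (rule nn_integral_lebesgue_on_mono[OF BU])
    finally show ?thesis by (simp add: slobodeckij_def h_def e_def)
  qed
  also have "slobodeckij U \<sigma> g \<le> ennreal S" by (rule S(1))
  finally show ?thesis using S(2) by (simp add: e_def ennreal_mult' mult_left_mono)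
qed

lemma integrable_lebesgue_on_subset:
  fixes h :: "real^'d::finite \<Rightarrow> real"
  assumes "B \<subseteq> U" "B \<in> sets lebesgue" "U \<in> sets lebesgue" "integrable (lebesgue_on U) h"
  shows "integrable (lebesgue_on B) h"
    and "(\<And>x. h x \<ge> 0) \<Longrightarrow> (\<integral>x. h x \<partial>lebesgue_on B) \<le> (\<integral>x. h x \<partial>lebesgue_on U)"
proof -
  have U: "integrable lebesgue (\<lambda>x. indicator U x *\<^sub>R h x)"
    using assms(3,4) by (subst (asm) integrable_restrict_space) auto
  then have "integrable lebesgue (\<lambda>x. indicator B x *\<^sub>R (indicator U x *\<^sub>R h x))"
    by (rule integrable_mult_indicator[OF assms(2)])
  also have "(\<lambda>x. indicator B x *\<^sub>R (indicator U x *\<^sub>R h x)) = (\<lambda>x. indicator B x *\<^sub>R h x)"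
    using assms(1) by (auto simp: indicator_def fun_eq_iff)
  finally have B: "integrable lebesgue (\<lambda>x. indicator B x *\<^sub>R h x)" .
  then show "integrable (lebesgue_on B) h" using assms(2) by (subst integrable_restrict_space) auto
  show "(\<integral>x. h x \<partial>lebesgue_on B) \<le> (\<integral>x. h x \<partial>lebesgue_on U)" if "\<And>x. h x \<ge> 0"
    using B U assms(1-3) that
    by (subst (1 2) integral_restrict_space) (auto intro!: integral_mono simp: indicator_def)
qed

lemma integrable_mult_tensor:
  fixes f :: "real^'d::finite \<Rightarrow> real"
  assumes U: "U \<in> sets lebesgue" and f: "square_integrable_on U f" and C: "\<And>i. smooth1 (C i)"
    and sup: "\<And>i s. s \<notin> {lo $ i..hi $ i} \<Longrightarrow> C i s = 0"
  shows "integrable (lebesgue_on U) (\<lambda>y. f y * tensor C y)"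
proof -
  have cont: "continuous_on UNIV (tensor C)" by (rule continuous_on_tensor[OF smooth1_cont0[OF C]])
  have m: "tensor C \<in> borel_measurable (lebesgue_on U)"
    by (rule continuous_imp_measurable_on_sets_lebesgue[OF continuous_on_subset[OF cont] U]) simp
  have "integrable lborel (\<lambda>y. indicator (cbox lo hi) y *\<^sub>R (tensor C y)\<^sup>2)"
    by (rule borel_integrable_compact) (use cont continuous_on_subset in \<open>auto intro!: continuous_intros\<close>)
  also have "(\<lambda>y. indicator (cbox lo hi) y *\<^sub>R (tensor C y)\<^sup>2) = (\<lambda>y. (tensor C y)\<^sup>2)"
  proof
    show "indicator (cbox lo hi) y *\<^sub>R (tensor C y)\<^sup>2 = (tensor C y)\<^sup>2" for y
      using tensor_eq_0[of lo hi C y, OF sup] by (cases "y \<in> cbox lo hi") auto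
  qed
  finally have "integrable lebesgue (\<lambda>y. (tensor C y)\<^sup>2)"
    by (subst integrable_completion) (use cont in \<open>auto intro!: borel_measurable_continuous_onI continuous_intros\<close>)
  then have sq: "integrable (lebesgue_on U) (\<lambda>y. (tensor C y)\<^sup>2)"
    using U integrable_mult_indicator[OF U, of "\<lambda>y. (tensor C y)\<^sup>2"] by (subst integrable_restrict_space) auto
  show ?thesis
  proof (rule Bochner_Integration.integrable_bound)
    show "integrable (lebesgue_on U) (\<lambda>y. (f y)\<^sup>2 + (tensor C y)\<^sup>2)"
      using f sq by (auto simp: square_integrable_on_def)
    show "(\<lambda>y. f y * tensor C y) \<in> borel_measurable (lebesgue_on U)"
      using f m by (auto simp: square_integrable_on_def)
    show "AE y in lebesgue_on U. norm (f y * tensor C y) \<le> norm ((f y)\<^sup>2 + (tensor C y)\<^sup>2)"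
    proof (rule AE_I2)
      fix y
      have "2 * (\<bar>f y\<bar> * \<bar>tensor C y\<bar>) \<le> (f y)\<^sup>2 + (tensor C y)\<^sup>2"
        using sum_squares_bound[of "\<bar>f y\<bar>" "\<bar>tensor C y\<bar>"] by simp
      then have "\<bar>f y\<bar> * \<bar>tensor C y\<bar> \<le> (f y)\<^sup>2 + (tensor C y)\<^sup>2"
        using mult_nonneg_nonneg[of "\<bar>f y\<bar>" "\<bar>tensor C y\<bar>"] by linarith
      then show "norm (f y * tensor C y) \<le> norm ((f y)\<^sup>2 + (tensor C y)\<^sup>2)" by (simp add: abs_mult)
    qed
  qed
qed

text \<open>In units of the mesh width, l and L bound the sides and S the heights. The summands in
  the bracket stem from the volume of the box, from the L2 norm for integer \<tau> and from the
  seminorm for fractional \<tau>; one constant serves both cases.\<close>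

definition pairing_const :: "nat \<Rightarrow> real \<Rightarrow> real \<Rightarrow> real \<Rightarrow> real \<Rightarrow> real" where
  "pairing_const d \<tau> l L S = L ^ nat \<lfloor>\<tau>\<rfloor> * S ^ d *
     (L ^ d + 1 + (real d * L) powr (real d + 2 * frac \<tau>) / l ^ d)"

text \<open>The factor with vanishing moments is an \<open>m\<close>-th derivative of a compactly supported function,
  so that the pairing only sees the pure weak derivative of order \<open>m = \<lfloor>\<tau>\<rfloor>\<close> in that direction.\<close>

lemma tensor_pairing_bound:
  fixes U :: "(real^'d::finite) set"
  assumes U: "open U" and f: "f \<in> sobolev_space U \<tau>" and N: "sobolev_norm U \<tau> f \<le> N" "N > 0" and \<tau>: "\<tau> \<ge> 0"
    and C: "\<And>i. smooth1 (C i)" and sup: "\<And>i s. s \<notin> {lo $ i..hi $ i} \<Longrightarrow> C i s = 0"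
    and box: "cbox lo hi \<subseteq> U" and bnd: "\<And>i s. \<bar>C i s\<bar> \<le> S / t"
    and side: "\<And>i. l * t \<le> hi $ i - lo $ i" "\<And>i. hi $ i - lo $ i \<le> L * t" and pos: "l > 0" "t > 0"
    and mom: "\<And>j. j \<le> nat \<lfloor>\<tau>\<rfloor> \<Longrightarrow> (\<integral>s. C i s * s ^ j \<partial>lborel) = 0"
  shows "\<bar>\<integral>y. f y * tensor C y \<partial>lebesgue_on U\<bar>
    \<le> pairing_const CARD('d) \<tau> l L S * t powr (\<tau> - real CARD('d) / 2) * N"
proof -
  define m where "m = nat \<lfloor>\<tau>\<rfloor>"
  define d where "d = CARD('d)"
  define \<sigma> where "\<sigma> = frac \<tau>"
  have \<tau>_eq: "\<tau> = real m + \<sigma>" using \<tau> by (simp add: m_def \<sigma>_def frac_def)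
  have d1: "d \<ge> 1" by (simp add: d_def Suc_leI)
  have lL: "l \<le> L"
    using order_trans[OF side(1)[of i] side(2)[of i]] pos by simp
  have lohi: "lo $ i \<le> hi $ i" for i using side(1)[of i] pos mult_pos_pos[of l t] by linarith
  have S0: "S \<ge> 0" using bnd[of i 0] pos abs_ge_zero[of "C i 0"] by (smt (verit) divide_neg_pos)
  define \<alpha> where "\<alpha> = (\<lambda>j. if j = i then m else 0)"
  have "multi_order \<alpha> = nat \<lfloor>\<tau>\<rfloor>" by (simp add: \<alpha>_def multi_order_def m_def)
  note wd = sobolev_weak_deriv[OF f N(1) this]
  define g where "g = weak_deriv U \<alpha> f"
  obtain W where W: "smooth1 W" "(deriv ^^ m) W = C i" "\<And>s. s \<notin> {lo $ i..hi $ i} \<Longrightarrow> W s = 0"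
    "\<And>s. \<bar>W s\<bar> \<le> (hi $ i - lo $ i) ^ m * (S / t)" "(\<integral>s. W s \<partial>lborel) = 0"
    using ex_iterated_antiderivative[of "C i" "lo $ i" "hi $ i" m "S / t", OF C sup lohi] mom bnd unfolding m_def by blast
  define C' where "C' = C(i := W)"
  have C': "smooth1 (C' j)" for j using C W(1) by (simp add: C'_def)
  have sup': "C' j s = 0" if "s \<notin> {lo $ j..hi $ j}" for j s using that sup W(3) by (auto simp: C'_def)
  have upd: "C'(i := (deriv ^^ m) (C' i)) = C" using W(2) by (auto simp: C'_def)
  define \<phi> where "\<phi> = tensor C'"
  have tf: "test_function U \<phi>" unfolding \<phi>_def using C' sup' box by (rule test_function_tensor)
  have "(\<integral>y. f y * multi_partial \<alpha> \<phi> y \<partial>lebesgue_on U) = (- 1) ^ multi_order \<alpha> * (\<integral>y. g y * \<phi> y \<partial>lebesgue_on U)"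
    using wd(1) tf unfolding is_weak_deriv_def g_def by blast
  moreover have "multi_partial \<alpha> \<phi> = tensor C"
    unfolding \<alpha>_def \<phi>_def multi_partial_tensor[OF C'] upd ..
  ultimately have eq: "\<bar>\<integral>y. f y * tensor C y \<partial>lebesgue_on U\<bar> = \<bar>\<integral>y. g y * \<phi> y \<partial>lebesgue_on U\<bar>"
    by (simp add: abs_mult power_abs)
  define B where "B = cbox lo hi"
  have meas: "B \<in> sets lebesgue" "U \<in> sets lebesgue" using U by (auto simp: B_def)
  have BU: "B \<subseteq> U" using box by (simp add: B_def)
  have \<phi>0: "\<phi> y = 0" if "y \<notin> B" for y using tensor_eq_0[of lo hi C', OF sup'] that by (simp add: \<phi>_def B_def)
  have fin: "finite_measure (lebesgue_on B)"
    by (rule finite_measureI) (simp add: space_restrict_space emeasure_restrict_space meas B_def emeasure_lborel_cbox_eq)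
  define v where "v = measure (lebesgue_on B) (space (lebesgue_on B))"
  have v_eq: "v = (\<Prod>j\<in>UNIV. hi $ j - lo $ j)"
  proof -
    have "v = measure lebesgue B" using meas by (simp add: v_def space_restrict_space measure_restrict_space)
    also have "\<dots> = (\<Prod>j\<in>UNIV. hi $ j - lo $ j)"
    proof -
      have "lo \<in> cbox lo hi" using lohi by (simp add: mem_box_cart)
      then have "cbox lo hi \<noteq> {}" by blast
      then show ?thesis unfolding B_def by (simp add: content_cbox_cart)
    qed
    finally show ?thesis .
  qed
  have v_low: "(l * t) ^ d \<le> v" and v_up: "v \<le> (L * t) ^ d"
  proof -
    have "(\<Prod>j\<in>(UNIV::'d set). l * t) \<le> v" unfolding v_eq using side pos by (intro prod_mono) auto
    then show "(l * t) ^ d \<le> v" by (simp add: d_def)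
    have "v \<le> (\<Prod>j\<in>(UNIV::'d set). L * t)" unfolding v_eq using side lohi by (intro prod_mono) auto
    then show "v \<le> (L * t) ^ d" by (simp add: d_def)
  qed
  have v0: "v > 0" using v_low pos by (smt (verit) mult_pos_pos zero_less_power)
  define b where "b = (L * t) ^ m * (S / t) ^ d"
  have b: "\<bar>\<phi> y\<bar> \<le> b" for y
  proof -
    have "\<bar>\<phi> y\<bar> = \<bar>W (y $ i)\<bar> * (\<Prod>j\<in>UNIV - {i}. \<bar>C j (y $ j)\<bar>)"
      unfolding \<phi>_def tensor_def abs_prod by (subst prod.remove[of UNIV i]) (auto simp: C'_def intro!: prod.cong)
    also have "\<dots> \<le> ((L * t) ^ m * (S / t)) * (\<Prod>j\<in>UNIV - {i}. S / t)"
    proof (rule mult_mono)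
      have "(hi $ i - lo $ i) ^ m \<le> (L * t) ^ m" using side(2)[of i] lohi[of i] by (intro power_mono) auto
      then have "(hi $ i - lo $ i) ^ m * (S / t) \<le> (L * t) ^ m * (S / t)" using S0 pos by (intro mult_right_mono) auto
      then show "\<bar>W (y $ i)\<bar> \<le> (L * t) ^ m * (S / t)" using W(4) order_trans by blast
      show "(\<Prod>j\<in>UNIV - {i}. \<bar>C j (y $ j)\<bar>) \<le> (\<Prod>j\<in>UNIV - {i}. S / t)" using bnd by (intro prod_mono) auto
      show "0 \<le> (L * t) ^ m * (S / t)" using S0 pos lL by auto
    qed (intro prod_nonneg, auto)
    also have "\<dots> = (L * t) ^ m * (S / t * (S / t) ^ (d - 1))" by (simp add: d_def)
    also have "S / t * (S / t) ^ (d - 1) = (S / t) ^ d" using d1 by (simp add: power_eq_if)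
    finally show ?thesis by (simp add: b_def)
  qed
  have b0: "b \<ge> 0" using b abs_ge_zero order_trans by blast
  have cont: "continuous_on UNIV \<phi>" unfolding \<phi>_def by (rule continuous_on_tensor[OF smooth1_cont0[OF C']])
  have \<phi>m: "\<phi> \<in> borel_measurable (lebesgue_on B)"
    by (rule continuous_imp_measurable_on_sets_lebesgue[OF continuous_on_subset[OF cont] meas(1)]) simp
  have sqU: "g \<in> borel_measurable (lebesgue_on U)" "integrable (lebesgue_on U) (\<lambda>x. (g x)\<^sup>2)"
    using wd(1) by (auto simp: is_weak_deriv_def square_integrable_on_def g_def)
  have gB: "g \<in> borel_measurable (lebesgue_on B)"
    by (rule measurable_restrict_mono[OF sqU(1) BU])
  have g2: "integrable (lebesgue_on B) (\<lambda>x. (g x)\<^sup>2)"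
    by (rule integrable_lebesgue_on_subset(1)[OF BU meas sqU(2)])
  have g2_le: "(\<integral>x. (g x)\<^sup>2 \<partial>lebesgue_on B) \<le> N\<^sup>2"
    using integrable_lebesgue_on_subset(2)[OF BU meas sqU(2)] wd(2) by (simp add: g_def)
  have restr: "(\<integral>y. g y * \<phi> y \<partial>lebesgue_on U) = (\<integral>y. g y * \<phi> y \<partial>lebesgue_on B)"
    by (rule integral_subset_support[OF BU meas]) (simp add: \<phi>0)
  define T where "T = t powr (\<tau> - real d / 2)"
  define Z where "Z = L ^ m * S ^ d"
  have Z0: "Z \<ge> 0" using S0 lL pos by (simp add: Z_def)
  \<comment> \<open>Chosen to balance the two terms: as the volume v is of order t^d, both are at
    most of order N t^(\<sigma> + d/2).\<close>
  define \<kappa> where "\<kappa> = N * t powr (\<sigma> - real d / 2)"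
  have \<kappa>: "\<kappa> > 0" using N pos by (simp add: \<kappa>_def)
  have b_eq: "b = Z * t powr (real m - real d)"
    using pos by (simp add: b_def Z_def power_mult_distrib power_divide powr_diff powr_realpow)
  have T_eq: "T = t powr (real m - real d) * t powr (\<sigma> + real d / 2)"
    by (simp add: T_def \<tau>_eq powr_add[symmetric])
  have kv: "\<kappa> / 2 * v \<le> N * t powr (\<sigma> + real d / 2) * L ^ d"
  proof -
    have "\<kappa> / 2 * v \<le> \<kappa> * (L * t) ^ d" using \<kappa> v_up v0 by (intro mult_mono) auto
    also have "\<dots> = N * (t powr (\<sigma> - real d / 2) * t powr real d) * L ^ d"
      using pos by (simp add: \<kappa>_def power_mult_distrib powr_realpow)
    also have "t powr (\<sigma> - real d / 2) * t powr real d = t powr (\<sigma> + real d / 2)"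
      by (simp add: powr_add[symmetric] add.commute)
    finally show ?thesis .
  qed
  have main: "\<bar>\<integral>y. g y * \<phi> y \<partial>lebesgue_on B\<bar> \<le> b * (N * t powr (\<sigma> + real d / 2) * (L ^ d + 1 + (real d * L) powr (real d + 2 * \<sigma>) / l ^ d))"
  proof (cases "\<sigma> > 0")
    case False
    then have \<sigma>0: "\<sigma> = 0" using frac_ge_0[of \<tau>] by (simp add: \<sigma>_def)
    have "\<bar>\<integral>y. g y * \<phi> y \<partial>lebesgue_on B\<bar> \<le> b * (\<kappa> / 2 * v + (\<integral>x. (g x)\<^sup>2 \<partial>lebesgue_on B) / (2 * \<kappa>))"
      unfolding v_def by (rule abs_integral_mult_le[OF fin gB g2 \<phi>m b \<kappa>])
    also have "\<dots> \<le> b * (N * t powr (\<sigma> + real d / 2) * (L ^ d + 1 + (real d * L) powr (real d + 2 * \<sigma>) / l ^ d))"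
    proof (rule mult_left_mono[OF _ b0])
      have "(\<integral>x. (g x)\<^sup>2 \<partial>lebesgue_on B) / (2 * \<kappa>) \<le> N\<^sup>2 / (1 * \<kappa>)"
        using g2_le \<kappa> by (intro frac_le) auto
      also have "\<dots> = N * t powr (\<sigma> + real d / 2)"
        using N pos by (simp add: \<kappa>_def \<sigma>0 power2_eq_square powr_minus_divide)
      finally have "\<kappa> / 2 * v + (\<integral>x. (g x)\<^sup>2 \<partial>lebesgue_on B) / (2 * \<kappa>)
          \<le> N * t powr (\<sigma> + real d / 2) * L ^ d + N * t powr (\<sigma> + real d / 2)" using kv by linarith
      also have "\<dots> = N * t powr (\<sigma> + real d / 2) * (L ^ d + 1)" by (simp add: algebra_simps)
      also have "\<dots> \<le> N * t powr (\<sigma> + real d / 2) * (L ^ d + 1 + (real d * L) powr (real d + 2 * \<sigma>) / l ^ d)"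
        using N pos by (intro mult_left_mono) auto
      finally show "\<kappa> / 2 * v + (\<integral>x. (g x)\<^sup>2 \<partial>lebesgue_on B) / (2 * \<kappa>)
        \<le> N * t powr (\<sigma> + real d / 2) * (L ^ d + 1 + (real d * L) powr (real d + 2 * \<sigma>) / l ^ d)" .
    qed
    finally show ?thesis .
  next
    case True
    define \<delta> where "\<delta> = real d * L * t"
    have \<delta>: "dist x y \<le> \<delta>" if "x \<in> B" "y \<in> B" for x y
    proof -
      have "dist x y \<le> (\<Sum>j\<in>UNIV. \<bar>(x - y) $ j\<bar>)" unfolding dist_norm by (rule norm_le_l1_cart)
      also have "\<dots> \<le> (\<Sum>j\<in>(UNIV::'d set). L * t)"
      proof (rule sum_mono)
        fix j
        have "lo $ j \<le> x $ j" "x $ j \<le> hi $ j" "lo $ j \<le> y $ j" "y $ j \<le> hi $ j"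
          using that by (auto simp: B_def mem_box_cart)
        then show "\<bar>(x - y) $ j\<bar> \<le> L * t" using side(2)[of j] by simp
      qed
      finally show ?thesis by (simp add: \<delta>_def d_def)
    qed
    define Q where "Q = \<delta> powr (real d + 2 * \<sigma>) * N\<^sup>2"
    \<comment> \<open>The vanishing mean of \<open>W\<close> is passed on to the whole tensor
      product.\<close>
    have int0: "(\<integral>y. \<phi> y \<partial>lebesgue_on B) = 0"
    proof -
      have "(\<integral>y. \<phi> y \<partial>lebesgue_on B) = (\<integral>y. \<phi> y \<partial>lborel)"
        by (rule integral_lebesgue_on_eq_lborel[OF cont \<phi>0 meas(1)])
      also have "\<dots> = (\<Prod>j\<in>UNIV. \<integral>s. C' j s \<partial>lborel)"
        unfolding \<phi>_def by (rule integral_tensor) (rule integrable_compact_support[OF smooth1_cont0[OF C'] sup'])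
      also have "\<dots> = 0" using W(5) by (intro prod_zero) (auto simp: C'_def)
      finally show ?thesis .
    qed
    have "(\<integral>\<^sup>+x. (\<integral>\<^sup>+z. ennreal ((g x - g z)\<^sup>2) \<partial>lebesgue_on B) \<partial>lebesgue_on B) \<le> ennreal Q"
      unfolding Q_def d_def
      by (rule local_slobodeckij_le[OF BU meas fin gB \<delta> True]) (use wd(3) True in \<open>auto simp: g_def \<sigma>_def\<close>)
    then have "\<bar>\<integral>y. g y * \<phi> y \<partial>lebesgue_on B\<bar> \<le> b * (\<kappa> / 2 * v + Q / (2 * \<kappa> * v))"
      by (intro abs_integral_mult_le_diff[OF fin gB g2 \<phi>m b int0 \<kappa> v_def v0]) (auto simp: Q_def)
    also have "\<dots> \<le> b * (N * t powr (\<sigma> + real d / 2) * (L ^ d + 1 + (real d * L) powr (real d + 2 * \<sigma>) / l ^ d))"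
    proof (rule mult_left_mono[OF _ b0])
      have "Q / (2 * \<kappa> * v) \<le> Q / (1 * \<kappa> * (l * t) ^ d)"
        using \<kappa> v_low v0 pos by (intro divide_left_mono mult_mono mult_pos_pos) (auto simp: Q_def)
      also have "\<dots> = N * ((t powr (real d + 2 * \<sigma>) / t powr (\<sigma> - real d / 2)) / t powr real d) * ((real d * L) powr (real d + 2 * \<sigma>) / l ^ d)"
        using N pos lL by (simp add: Q_def \<kappa>_def \<delta>_def powr_mult power_mult_distrib power2_eq_square powr_realpow mult_ac)
      also have "(t powr (real d + 2 * \<sigma>) / t powr (\<sigma> - real d / 2)) / t powr real d = t powr (\<sigma> + real d / 2)"
        by (simp add: powr_diff[symmetric] add.commute)
      finally have "\<kappa> / 2 * v + Q / (2 * \<kappa> * v) \<le> N * t powr (\<sigma> + real d / 2) * L ^ d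
          + N * t powr (\<sigma> + real d / 2) * ((real d * L) powr (real d + 2 * \<sigma>) / l ^ d)" using kv by linarith
      also have "\<dots> = N * t powr (\<sigma> + real d / 2) * (L ^ d + (real d * L) powr (real d + 2 * \<sigma>) / l ^ d)" by (simp add: algebra_simps)
      also have "\<dots> \<le> N * t powr (\<sigma> + real d / 2) * (L ^ d + 1 + (real d * L) powr (real d + 2 * \<sigma>) / l ^ d)"
        using N pos by (intro mult_left_mono) auto
      finally show "\<kappa> / 2 * v + Q / (2 * \<kappa> * v)
        \<le> N * t powr (\<sigma> + real d / 2) * (L ^ d + 1 + (real d * L) powr (real d + 2 * \<sigma>) / l ^ d)" .
    qed
    finally show ?thesis .
  qed
  also have "\<dots> = pairing_const CARD('d) \<tau> l L S * T * N"
    by (simp add: b_eq T_eq pairing_const_def Z_def d_def m_def \<sigma>_def mult_ac)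
  finally show ?thesis unfolding eq restr T_def d_def .
qed

text \<open>The difference of two tensor products is telescoped over the coordinates.\<close>

lemma tensor_diff_pairing_bound:
  fixes U :: "(real^'d::finite) set"
  assumes U: "open U" and f: "f \<in> sobolev_space U \<tau>" and N: "sobolev_norm U \<tau> f \<le> N" "N > 0" and \<tau>: "\<tau> \<ge> 0"
    and A: "\<And>i. smooth1 (A i)" "\<And>i s. s \<notin> {lo $ i..hi $ i} \<Longrightarrow> A i s = 0" "\<And>i s. \<bar>A i s\<bar> \<le> S / t"
    and B: "\<And>i. smooth1 (B i)" "\<And>i s. s \<notin> {lo $ i..hi $ i} \<Longrightarrow> B i s = 0" "\<And>i s. \<bar>B i s\<bar> \<le> S / t"
    and box: "cbox lo hi \<subseteq> U"
    and side: "\<And>i. l * t \<le> hi $ i - lo $ i" "\<And>i. hi $ i - lo $ i \<le> L * t" and pos: "l > 0" "t > 0"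
    and mom: "\<And>i j. j \<le> nat \<lfloor>\<tau>\<rfloor> \<Longrightarrow> (\<integral>s. A i s * s ^ j \<partial>lborel) = (\<integral>s. B i s * s ^ j \<partial>lborel)"
  shows "\<bar>(\<integral>y. f y * tensor A y \<partial>lebesgue_on U) - (\<integral>y. f y * tensor B y \<partial>lebesgue_on U)\<bar>
    \<le> real CARD('d) * (pairing_const CARD('d) \<tau> l L (2 * S) * t powr (\<tau> - real CARD('d) / 2) * N)"
proof -
  define E where "E = pairing_const CARD('d) \<tau> l L (2 * S) * t powr (\<tau> - real CARD('d) / 2) * N"
  define H where "H K i = (if i \<in> K then A i else B i)" for K i
  have H: "smooth1 (H K i)" "s \<notin> {lo $ i..hi $ i} \<Longrightarrow> H K i s = 0" "\<bar>H K i s\<bar> \<le> S / t" for K i s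
    using A B by (auto simp: H_def)
  have sq: "square_integrable_on U f" using f by (simp add: sobolev_space_def)
  have Um: "U \<in> sets lebesgue" using U by simp
  have int: "integrable (lebesgue_on U) (\<lambda>y. f y * tensor (H K) y)" for K
    by (rule integrable_mult_tensor[OF Um sq H(1) H(2)])
  define G where "G K = (\<integral>y. f y * tensor (H K) y \<partial>lebesgue_on U)" for K
  have step: "\<bar>G (insert i K) - G K\<bar> \<le> E" if "i \<notin> K" for i K
  proof -
    \<comment> \<open>The factor in coordinate i is a difference with vanishing moments and height
      at most 2 S / t; this is the origin of 2 S in the constant.\<close>
    define C where "C = (H K)(i := (\<lambda>s. A i s - B i s))"
    have "tensor (H (insert i K)) y - tensor (H K) y = tensor C y" for y
    proof -
      have P: "(\<Prod>j\<in>UNIV - {i}. H (insert i K) j (y $ j)) = (\<Prod>j\<in>UNIV - {i}. H K j (y $ j))"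
        "(\<Prod>j\<in>UNIV - {i}. C j (y $ j)) = (\<Prod>j\<in>UNIV - {i}. H K j (y $ j))"
        by (intro prod.cong; auto simp: H_def C_def)+
      show ?thesis unfolding tensor_def using that
        by (subst (1 2 3) prod.remove[of UNIV i]) (auto simp: P, simp add: H_def C_def algebra_simps)
    qed
    then have "G (insert i K) - G K = (\<integral>y. f y * tensor C y \<partial>lebesgue_on U)"
      unfolding G_def by (subst Bochner_Integration.integral_diff[OF int int, symmetric]) (simp add: right_diff_distrib[symmetric])
    also have "\<bar>\<dots>\<bar> \<le> E" unfolding E_def
    proof (rule tensor_pairing_bound[OF U f N \<tau> _ _ box _ side pos, where C = C and i = i])
      show "smooth1 (C j)" for j using H(1) smooth1_diff[OF A(1) B(1)] by (simp add: C_def)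
      show "C j s = 0" if "s \<notin> {lo $ j..hi $ j}" for j s using H(2) A(2) B(2) that by (auto simp: C_def)
      show "\<bar>C j s\<bar> \<le> 2 * S / t" for j s
      proof -
        have "S / t \<ge> 0" using A(3)[of j s] by linarith
        then show ?thesis using H(3)[of K j s] A(3)[of j s] B(3)[of j s] by (auto simp: C_def)
      qed
      show "(\<integral>s. C i s * s ^ j \<partial>lborel) = 0" if "j \<le> nat \<lfloor>\<tau>\<rfloor>" for j
      proof -
        have i: "integrable lborel (\<lambda>s. A i s * s ^ j)" "integrable lborel (\<lambda>s. B i s * s ^ j)"
          using integrable_moment[OF smooth1_cont0[OF A(1)] A(2)] integrable_moment[OF smooth1_cont0[OF B(1)] B(2)] by auto
        have "(\<integral>s. C i s * s ^ j \<partial>lborel) = (\<integral>s. A i s * s ^ j - B i s * s ^ j \<partial>lborel)"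
          by (simp add: C_def left_diff_distrib)
        then show ?thesis using mom[OF that, of i] i by simp
      qed
    qed
    finally show ?thesis .
  qed
  have "\<bar>G K - G {}\<bar> \<le> real (card K) * E" if "finite K" for K
    using that
  proof (induction K)
    case (insert i K)
    have "\<bar>G (insert i K) - G {}\<bar> \<le> \<bar>G (insert i K) - G K\<bar> + \<bar>G K - G {}\<bar>" by linarith
    then show ?case using insert step[of i K] by (simp add: algebra_simps)
  qed simp
  from this[of UNIV] show ?thesis by (simp add: G_def H_def[abs_def] E_def)
qed

section \<open>Skewed boxes at a smooth boundary\<close>

text \<open>Both points may vary, unlike in plain differentiability at z. The mean value inequality
  is applied to g minus its linear part at z, whose derivative is small near z because the partial
  derivatives are continuous.\<close>

lemma smooth_on_strict_derivative:
  fixes g :: "real^'d::finite \<Rightarrow> real"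
  assumes sm: "smooth_on UNIV g" and \<epsilon>: "\<epsilon> > 0"
  shows "\<exists>\<delta>>0. \<forall>x\<in>ball z \<delta>. \<forall>y\<in>ball z \<delta>.
    \<bar>g y - g x - (\<chi> i. partials [i] g z) \<bullet> (y - x)\<bar> \<le> \<epsilon> * norm (y - x)"
proof -
  define p where "p i x = partials [i] g x" for i x
  define m where "m = (\<chi> i. p i z)"
  have D: "(g has_derivative (\<lambda>v. \<Sum>i\<in>UNIV. v $ i * p i x)) (at x)" for x
  proof -
    have dg: "(g has_derivative frechet_derivative g (at x)) (at x)"
      using sm[unfolded smooth_on_def, rule_format, of x "[]"] by (simp add: frechet_derivative_works)
    then interpret linear "frechet_derivative g (at x)" using has_derivative_linear by blast
    have "frechet_derivative g (at x) v = (\<Sum>i\<in>UNIV. v $ i * p i x)" for v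
    proof -
      have "frechet_derivative g (at x) v = frechet_derivative g (at x) (\<Sum>i\<in>UNIV. v $ i *\<^sub>R axis i 1)"
        by (simp add: basis_expansion scalar_mult_eq_scaleR[symmetric])
      then show ?thesis by (simp add: sum scaleR p_def)
    qed
    then have "frechet_derivative g (at x) = (\<lambda>v. \<Sum>i\<in>UNIV. v $ i * p i x)" by (rule ext)
    then show ?thesis using dg by simp
  qed
  have cont: "continuous (at x) (p i)" for i x
    using sm[unfolded smooth_on_def, rule_format, of x "[i]"] differentiable_imp_continuous_within
    unfolding p_def by blast
  have "((\<lambda>x. \<Sum>i\<in>UNIV. \<bar>p i x - p i z\<bar>) \<longlongrightarrow> (\<Sum>i\<in>UNIV. \<bar>p i z - p i z\<bar>)) (at z)"
    using cont[of z] by (intro tendsto_intros) (simp add: continuous_within)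
  then have "eventually (\<lambda>x. (\<Sum>i\<in>UNIV. \<bar>p i x - p i z\<bar>) < \<epsilon>) (at z)"
    using \<epsilon> by (intro order_tendstoD(2)) auto
  then obtain \<delta> where \<delta>: "\<delta> > 0" "\<And>x. x \<noteq> z \<Longrightarrow> dist x z < \<delta> \<Longrightarrow> (\<Sum>i\<in>UNIV. \<bar>p i x - p i z\<bar>) < \<epsilon>"
    unfolding eventually_at by blast
  have small: "(\<Sum>i\<in>UNIV. \<bar>p i x - p i z\<bar>) \<le> \<epsilon>" if "x \<in> ball z \<delta>" for x
    using \<delta>(2)[of x] that \<epsilon> by (cases "x = z") (auto simp: dist_commute less_imp_le)
  have "\<bar>g y - g x - m \<bullet> (y - x)\<bar> \<le> \<epsilon> * norm (y - x)" if xy: "x \<in> ball z \<delta>" "y \<in> ball z \<delta>" for x y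
  proof -
    define H where "H x = g x - m \<bullet> x" for x
    have "norm (H y - H x) \<le> \<epsilon> * norm (y - x)"
    proof (rule differentiable_bound[OF convex_ball _ _ xy(2) xy(1)])
      fix w assume w: "w \<in> ball z \<delta>"
      have "(H has_derivative (\<lambda>v. (\<Sum>i\<in>UNIV. v $ i * p i w) - m \<bullet> v)) (at w)"
        unfolding H_def by (intro derivative_intros D)
      then show "(H has_derivative (\<lambda>v. (\<Sum>i\<in>UNIV. v $ i * p i w) - m \<bullet> v)) (at w within ball z \<delta>)"
        by (rule has_derivative_at_withinI)
      show "onorm (\<lambda>v. (\<Sum>i\<in>UNIV. v $ i * p i w) - m \<bullet> v) \<le> \<epsilon>"
      proof (rule onorm_le)
        fix v :: "real^'d"
        have "(\<Sum>i\<in>UNIV. v $ i * p i w) - m \<bullet> v = (\<Sum>i\<in>UNIV. v $ i * (p i w - p i z))"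
          by (simp add: m_def inner_vec_def sum_subtractf[symmetric] algebra_simps)
        also have "norm \<dots> \<le> (\<Sum>i\<in>UNIV. norm v * \<bar>p i w - p i z\<bar>)"
          by (intro sum_norm_le) (simp add: abs_mult mult_right_mono component_le_norm_cart)
        also have "\<dots> \<le> norm v * \<epsilon>"
          unfolding sum_distrib_left[symmetric] using small[OF w] by (intro mult_left_mono) auto
        finally show "norm ((\<Sum>i\<in>UNIV. v $ i * p i w) - m \<bullet> v) \<le> \<epsilon> * norm v" by (simp add: mult.commute)
      qed
    qed
    then show ?thesis by (simp add: H_def inner_diff_right algebra_simps)
  qed
  then show ?thesis using \<delta>(1) unfolding m_def p_def by blast
qed

text \<open>For \<rho>, t \<ge> 0, the smallest coordinate box containing x + t \<theta> w and x + t
  w, enlarged by t \<rho> on each side. The two points are the shifts used on two consecutive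
  levels.\<close>

definition skew_box :: "real^'d::finite \<Rightarrow> real \<Rightarrow> real \<Rightarrow> real \<Rightarrow> real^'d \<Rightarrow> (real^'d) set" where
  "skew_box w \<theta> \<rho> t x = {y. \<forall>i. x $ i + t * (min (\<theta> * w $ i) (w $ i) - \<rho>) \<le> y $ i \<and>
    y $ i \<le> x $ i + t * (max (\<theta> * w $ i) (w $ i) + \<rho>)}"

lemma skew_box_mono:
  assumes "\<rho>' \<le> \<rho>" "t \<ge> 0"
  shows "skew_box w \<theta> \<rho>' t x \<subseteq> skew_box w \<theta> \<rho> t x"
proof
  fix y assume y: "y \<in> skew_box w \<theta> \<rho>' t x"
  have "t * (min (\<theta> * w $ i) (w $ i) - \<rho>) \<le> t * (min (\<theta> * w $ i) (w $ i) - \<rho>')"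
       "t * (max (\<theta> * w $ i) (w $ i) + \<rho>') \<le> t * (max (\<theta> * w $ i) (w $ i) + \<rho>)" for i
    using assms by (auto intro!: mult_left_mono)
  then show "y \<in> skew_box w \<theta> \<rho> t x" using y unfolding skew_box_def mem_Collect_eq by (meson add_left_mono order_trans)
qed

lemma norm_skew_box:
  assumes "y \<in> skew_box w \<theta> \<rho> t x" "0 \<le> \<theta>" "\<theta> \<le> 1" "t \<ge> 0" "\<rho> \<ge> 0"
  shows "norm (y - x) \<le> t * (\<Sum>i\<in>UNIV. \<bar>w $ i\<bar> + \<rho>)"
proof -
  have "\<bar>(y - x) $ i\<bar> \<le> t * (\<bar>w $ i\<bar> + \<rho>)" for i
  proof -
    have "\<theta> * \<bar>w $ i\<bar> \<le> \<bar>w $ i\<bar>" using assms by (simp add: mult_left_le_one_le)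
    then have "\<bar>\<theta> * w $ i\<bar> \<le> \<bar>w $ i\<bar>" using assms by (simp add: abs_mult)
    then have "t * (max (\<theta> * w $ i) (w $ i) + \<rho>) \<le> t * (\<bar>w $ i\<bar> + \<rho>)"
      "t * - (\<bar>w $ i\<bar> + \<rho>) \<le> t * (min (\<theta> * w $ i) (w $ i) - \<rho>)"
      using assms(4) by (auto intro!: mult_left_mono simp: min_def max_def)
    moreover have "x $ i + t * (min (\<theta> * w $ i) (w $ i) - \<rho>) \<le> y $ i" "y $ i \<le> x $ i + t * (max (\<theta> * w $ i) (w $ i) + \<rho>)"
      using assms(1) by (auto simp: skew_box_def)
    ultimately show ?thesis unfolding abs_le_iff vector_minus_component mult_minus_right by linarith
  qed
  then have "(\<Sum>i\<in>UNIV. \<bar>(y - x) $ i\<bar>) \<le> (\<Sum>i\<in>UNIV. t * (\<bar>w $ i\<bar> + \<rho>))" by (intro sum_mono)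
  then show ?thesis using norm_le_l1_cart[of "y - x"] by (simp add: sum_distrib_left)
qed

text \<open>Near a boundary point, take for \<open>w\<close> the gradient \<open>n\<close> of the defining function \<open>G\<close>: every vector
  obtained from \<open>n\<close> by scaling its coordinates with factors in \<open>[\<theta>, 1]\<close> still increases \<open>G\<close> at a rate
  of at least \<open>\<theta> \<bar>n\<bar>\<^sup>2\<close>. This is where a differentiable boundary is needed, a Lipschitz one
  would only give a thin cone.\<close>

lemma local_skew_box:
  fixes \<Omega> :: "(real^'d::finite) set"
  assumes sb: "smooth_boundary \<Omega>" and \<theta>: "0 < \<theta>" "\<theta> \<le> 1" and p: "p \<in> closure \<Omega>"
  shows "\<exists>w \<rho> h \<delta>. \<rho> > 0 \<and> h > 0 \<and> \<delta> > 0 \<and> (\<forall>x\<in>\<Omega> \<inter> ball p \<delta>. \<forall>t. 0 < t \<and> t \<le> h \<longrightarrow> skew_box w \<theta> \<rho> t x \<subseteq> interior \<Omega>)"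
proof (cases "p \<in> interior \<Omega>")
  case True
  then obtain e where e: "e > 0" "ball p e \<subseteq> interior \<Omega>" using open_contains_ball open_interior by blast
  define c where "c = real CARD('d)"
  have c: "c > 0" by (simp add: c_def)
  have "skew_box 0 \<theta> 1 t x \<subseteq> interior \<Omega>" if "x \<in> ball p (e / 2)" "0 < t" "t \<le> e / (4 * c)" for x t
  proof
    fix y assume y: "y \<in> skew_box 0 \<theta> 1 t x"
    have "norm (y - x) \<le> t * c" using norm_skew_box[OF y] \<theta> that by (simp add: c_def)
    also have "\<dots> \<le> e / 4" using that c by (simp add: field_simps)
    finally have "dist x y < e / 2" using e(1) by (simp add: dist_norm norm_minus_commute)
    moreover have "dist p y \<le> dist p x + dist x y" by (rule dist_triangle)
    ultimately have "dist p y < e" using that(1) by simp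
    then show "y \<in> interior \<Omega>" using e(2) by auto
  qed
  then show ?thesis using e(1) c
    by (intro exI[of _ 0] exI[of _ 1] exI[of _ "e / (4 * c)"] exI[of _ "e / 2"]) auto
next
  case False
  then have "p \<in> frontier \<Omega>" using p by (simp add: frontier_def)
  then obtain r \<nu> g where r: "r > 0" and g: "smooth_on UNIV g" and \<nu>: "norm \<nu> = 1"
    and int: "interior \<Omega> \<inter> ball p r = {x\<in>ball p r. x \<bullet> \<nu> > g (x - (x \<bullet> \<nu>) *\<^sub>R \<nu>)}"
    and fro: "frontier \<Omega> \<inter> ball p r = {x\<in>ball p r. x \<bullet> \<nu> = g (x - (x \<bullet> \<nu>) *\<^sub>R \<nu>)}"
    using sb unfolding smooth_boundary_def graph_boundary_def by blast
  define \<pi> where "\<pi> x = x - (x \<bullet> \<nu>) *\<^sub>R \<nu>" for x :: "real^'d"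
  define G where "G x = x \<bullet> \<nu> - g (\<pi> x)" for x
  have \<nu>\<nu>: "\<nu> \<bullet> \<nu> = 1" using \<nu> by (simp add: norm_eq_1)
  have \<pi>_diff: "\<pi> y - \<pi> x = \<pi> (y - x)" for x y by (simp add: \<pi>_def inner_diff_left algebra_simps)
  have \<pi>_norm: "norm (\<pi> v) \<le> 2 * norm v" for v
  proof -
    have "norm (\<pi> v) \<le> norm v + \<bar>v \<bullet> \<nu>\<bar>" unfolding \<pi>_def using norm_triangle_ineq4[of v "(v \<bullet> \<nu>) *\<^sub>R \<nu>"] \<nu> by simp
    then show ?thesis using Cauchy_Schwarz_ineq2[of v \<nu>] \<nu> by simp
  qed
  define m where "m = (\<chi> i. partials [i] g (\<pi> p))"
  \<comment> \<open>The gradient at p of the height \<open>G\<close> above the graph, as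
    \<open>n_inner\<close> makes visible: the part of the gradient of g orthogonal to \<nu> is
    subtracted from \<nu>.\<close>
  define n where "n = \<nu> - (m - (m \<bullet> \<nu>) *\<^sub>R \<nu>)"
  have n_inner: "n \<bullet> v = v \<bullet> \<nu> - m \<bullet> \<pi> v" for v
    by (simp add: n_def \<pi>_def inner_diff_left inner_diff_right inner_commute algebra_simps)
  have "n \<bullet> \<nu> = 1" by (simp add: n_inner \<pi>_def \<nu>\<nu>)
  then have n0: "n \<noteq> 0" by auto
  define N2 where "N2 = n \<bullet> n"
  have N2: "N2 > 0" using n0 by (simp add: N2_def)
  define N1 where "N1 = (\<Sum>i\<in>UNIV. \<bar>n $ i\<bar>)"
  have N1: "N1 \<ge> 0" by (simp add: N1_def sum_nonneg)
  define c where "c = real CARD('d)"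
  have c: "c \<ge> 1" by (simp add: c_def Suc_leI)
  define K where "K = N1 + c"
  have K: "K > 0" using N1 c by (simp add: K_def)
  \<comment> \<open>The shift alone raises the height at rate \<theta> N2. As displacements are at
    most t K, linearisation costs at most a quarter of this, and \<rho> is chosen so that the
    enlargement of the box costs at most another quarter.\<close>
  define \<epsilon> where "\<epsilon> = \<theta> * N2 / (8 * K)"
  have \<epsilon>: "\<epsilon> > 0" using \<theta> N2 K by (simp add: \<epsilon>_def)
  define \<rho> where "\<rho> = min 1 (\<theta> * N2 / (4 * (N1 + 1)))"
  have \<rho>: "\<rho> > 0" "\<rho> \<le> 1" using \<theta> N2 N1 by (auto simp: \<rho>_def)
  have \<rho>N1: "\<rho> * N1 \<le> \<theta> * N2 / 4"
  proof -
    have "\<rho> * N1 \<le> (\<theta> * N2 / (4 * (N1 + 1))) * (N1 + 1)" using \<rho> N1 \<theta> N2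
      by (intro mult_mono) (auto simp: \<rho>_def)
    also have "\<dots> = \<theta> * N2 / 4"
    proof -
      have "N1 + 1 \<noteq> 0" using N1 by simp
      moreover have "a / (4 * b) * b = a / 4" if "b \<noteq> 0" for a b :: real using that by simp
      ultimately show ?thesis by blast
    qed
    finally show ?thesis .
  qed
  obtain \<delta>0 where \<delta>0: "\<delta>0 > 0" "\<And>x y. x \<in> ball (\<pi> p) \<delta>0 \<Longrightarrow> y \<in> ball (\<pi> p) \<delta>0 \<Longrightarrow>
    \<bar>g y - g x - m \<bullet> (y - x)\<bar> \<le> \<epsilon> * norm (y - x)"
    using smooth_on_strict_derivative[OF g \<epsilon>, of "\<pi> p"] unfolding m_def by blast
  \<comment> \<open>Halved because the projection \<pi> is estimated to at most double
    distances.\<close>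
  define \<delta> where "\<delta> = min r (\<delta>0 / 2)"
  have \<delta>: "\<delta> > 0" using r \<delta>0 by (simp add: \<delta>_def)
  have Gdiff: "\<bar>G y - G x - n \<bullet> (y - x)\<bar> \<le> 2 * \<epsilon> * norm (y - x)" if "x \<in> ball p \<delta>" "y \<in> ball p \<delta>" for x y
  proof -
    have *: "\<pi> z \<in> ball (\<pi> p) \<delta>0" if "z \<in> ball p \<delta>" for z
    proof -
      have "norm (\<pi> p - \<pi> z) \<le> 2 * norm (p - z)" unfolding \<pi>_diff by (rule \<pi>_norm)
      also have "\<dots> < \<delta>0" using that by (simp add: dist_norm \<delta>_def)
      finally show ?thesis by (simp add: dist_norm)
    qed
    have "G y - G x - n \<bullet> (y - x) = - (g (\<pi> y) - g (\<pi> x) - m \<bullet> (\<pi> y - \<pi> x))"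
      unfolding n_inner \<pi>_diff by (simp add: G_def inner_diff_left)
    also have "\<bar>\<dots>\<bar> \<le> \<epsilon> * norm (\<pi> y - \<pi> x)" using \<delta>0(2)[OF *[OF that(1)] *[OF that(2)]] by simp
    also have "\<dots> \<le> \<epsilon> * (2 * norm (y - x))" using \<epsilon> \<pi>_norm unfolding \<pi>_diff by (intro mult_left_mono) auto
    finally show ?thesis by simp
  qed
  define h where "h = \<delta> / (4 * K)"
  have h: "h > 0" using \<delta> K by (simp add: h_def)
  have "y \<in> interior \<Omega>" if x: "x \<in> \<Omega>" "x \<in> ball p (\<delta> / 2)" and t: "0 < t" "t \<le> h" and y: "y \<in> skew_box n \<theta> \<rho> t x" for x y t
  proof -
    have "(\<Sum>i\<in>UNIV. \<bar>n $ i\<bar> + \<rho>) \<le> K" using \<rho> by (simp add: sum.distrib N1_def c_def K_def)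
    then have "t * (\<Sum>i\<in>UNIV. \<bar>n $ i\<bar> + \<rho>) \<le> t * K" using t by (intro mult_left_mono) auto
    moreover have "norm (y - x) \<le> t * (\<Sum>i\<in>UNIV. \<bar>n $ i\<bar> + \<rho>)"
      by (rule norm_skew_box[OF y]) (use \<theta> t \<rho> in auto)
    ultimately have yx: "norm (y - x) \<le> t * K" by linarith
    also have "\<dots> \<le> h * K" using t K by (intro mult_right_mono) auto
    also have "\<dots> = \<delta> / 4" using K by (simp add: h_def)
    finally have "dist x y < \<delta> / 2" using \<delta> by (simp add: dist_norm norm_minus_commute)
    then have yp: "y \<in> ball p \<delta>" using x(2) dist_triangle[of p y x] by simp
    have xp: "x \<in> ball p \<delta>" using x(2) \<delta> by simp
    have xr: "x \<in> ball p r" and yr: "y \<in> ball p r" using xp yp by (auto simp: \<delta>_def)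
    \<comment> \<open>Points of \<Omega> on the frontier have height 0; the strict gain moves them
      into the interior as well.\<close>
    have "x \<in> interior \<Omega> \<or> x \<in> frontier \<Omega>" using x(1) closure_subset by (auto simp: frontier_def)
    then have Gx: "G x \<ge> 0" using int[unfolded set_eq_iff, rule_format, of x] fro[unfolded set_eq_iff, rule_format, of x] xr
      by (auto simp: G_def \<pi>_def)
    have "n \<bullet> (y - x) \<ge> t * (\<theta> * N2 - \<rho> * N1)"
    proof -
      have "n $ i * (y - x) $ i \<ge> t * (\<theta> * (n $ i * n $ i) - \<rho> * \<bar>n $ i\<bar>)" for i
      proof -
        have b: "t * (min (\<theta> * n $ i) (n $ i) - \<rho>) \<le> (y - x) $ i" "(y - x) $ i \<le> t * (max (\<theta> * n $ i) (n $ i) + \<rho>)"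
          using y by (auto simp: skew_box_def algebra_simps)
        show ?thesis
        proof (cases "n $ i \<ge> 0")
          case True
          have "\<theta> * n $ i \<le> n $ i" using True \<theta> by (simp add: mult_left_le_one_le)
          then have "n $ i * (t * (\<theta> * n $ i - \<rho>)) \<le> n $ i * (y - x) $ i"
            using b(1) True by (intro mult_left_mono) (simp_all add: min_absorb1)
          then show ?thesis using True by (simp add: algebra_simps)
        next
          case False
          have "\<theta> * (- n $ i) \<le> - n $ i" using False \<theta> by (intro mult_left_le_one_le) auto
          then have "n $ i \<le> \<theta> * n $ i" by simp
          then have "(- n $ i) * (y - x) $ i \<le> (- n $ i) * (t * (\<theta> * n $ i + \<rho>))"
            using b(2) False by (intro mult_left_mono) (simp_all add: max_absorb1)
          then show ?thesis using False by (simp add: algebra_simps)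
        qed
      qed
      then have "(\<Sum>i\<in>UNIV. t * (\<theta> * (n $ i * n $ i) - \<rho> * \<bar>n $ i\<bar>)) \<le> (\<Sum>i\<in>UNIV. n $ i * (y - x) $ i)" by (intro sum_mono)
      then show ?thesis by (simp add: inner_vec_def N2_def N1_def sum_distrib_left[symmetric] sum_subtractf)
    qed
    moreover have "t * (\<theta> * N2 - \<rho> * N1) \<ge> t * (3 / 4 * (\<theta> * N2))"
    proof (rule mult_left_mono)
      show "3 / 4 * (\<theta> * N2) \<le> \<theta> * N2 - \<rho> * N1" using \<rho>N1 by linarith
    qed (use t in simp)
    moreover have "2 * \<epsilon> * norm (y - x) \<le> t * (1 / 4 * (\<theta> * N2))"
    proof -
      have "2 * \<epsilon> * norm (y - x) \<le> 2 * \<epsilon> * (t * K)" using yx \<epsilon> by (intro mult_left_mono) auto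
      also have "\<dots> = t * (1 / 4 * (\<theta> * N2))" using K by (simp add: \<epsilon>_def)
      finally show ?thesis .
    qed
    moreover have "G y - G x \<ge> n \<bullet> (y - x) - 2 * \<epsilon> * norm (y - x)" using Gdiff[OF xp yp] by (simp add: abs_le_iff)
    moreover have "t * (1 / 4 * (\<theta> * N2)) < t * (3 / 4 * (\<theta> * N2))" using t \<theta> N2 by simp
    ultimately have "G y > 0" using Gx by linarith
    then show ?thesis using int[unfolded set_eq_iff, rule_format, of y] yr by (auto simp: G_def \<pi>_def)
  qed
  then have *: "\<forall>x\<in>\<Omega> \<inter> ball p (\<delta> / 2). \<forall>t. 0 < t \<and> t \<le> h \<longrightarrow> skew_box n \<theta> \<rho> t x \<subseteq> interior \<Omega>" by blast
  have "\<delta> / 2 > 0" using \<delta> by simp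
  then show ?thesis using * \<rho>(1) h by blast
qed

text \<open>Compactness of the closure. Finiteness of the set of directions matters as much as
  uniform constants, because the vectors of a level are counted per direction.\<close>

lemma uniform_skew_box:
  fixes \<Omega> :: "(real^'d::finite) set"
  assumes "bounded \<Omega>" "smooth_boundary \<Omega>" "0 < \<theta>" "\<theta> \<le> 1"
  shows "\<exists>D \<rho> h. finite D \<and> \<rho> > 0 \<and> h > 0 \<and>
    (\<forall>x\<in>\<Omega>. \<exists>w\<in>D. \<forall>t. 0 < t \<and> t \<le> h \<longrightarrow> skew_box w \<theta> \<rho> t x \<subseteq> interior \<Omega>)"
proof -
  have "\<forall>p\<in>closure \<Omega>. \<exists>w \<rho> h \<delta>. \<rho> > 0 \<and> h > 0 \<and> \<delta> > 0 \<and>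
    (\<forall>x\<in>\<Omega> \<inter> ball p \<delta>. \<forall>t. 0 < t \<and> t \<le> h \<longrightarrow> skew_box w \<theta> \<rho> t x \<subseteq> interior \<Omega>)"
    using local_skew_box[OF assms(2-4)] by (rule ballI)
  from this[unfolded bchoice_iff] obtain W R H \<delta> where q: "\<forall>p\<in>closure \<Omega>. R p > 0 \<and> H p > 0 \<and> \<delta> p > 0 \<and>
    (\<forall>x\<in>\<Omega> \<inter> ball p (\<delta> p). \<forall>t. 0 < t \<and> t \<le> H p \<longrightarrow> skew_box (W p) \<theta> (R p) t x \<subseteq> interior \<Omega>)"
    by (elim exE)
  have pos: "R p > 0" "H p > 0" "\<delta> p > 0" if "p \<in> closure \<Omega>" for p
    using q that by auto
  have box: "skew_box (W p) \<theta> (R p) t x \<subseteq> interior \<Omega>"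
    if "p \<in> closure \<Omega>" "x \<in> \<Omega>" "x \<in> ball p (\<delta> p)" "0 < t" "t \<le> H p" for p x t
    using bspec[OF q that(1)] that(2-) by blast
  have "compact (closure \<Omega>)" using assms(1) by (simp add: compact_closure)
  then obtain F where F: "F \<subseteq> closure \<Omega>" "finite F" "closure \<Omega> \<subseteq> (\<Union>p\<in>F. ball p (\<delta> p))"
  proof (rule compactE_image)
    show "closure \<Omega> \<subseteq> (\<Union>p\<in>closure \<Omega>. ball p (\<delta> p))" using pos(3) by force
  qed auto
  define \<rho> where "\<rho> = Min (insert 1 (R ` F))"
  define h where "h = Min (insert 1 (H ` F))"
  have \<rho>: "\<rho> > 0" "\<And>p. p \<in> F \<Longrightarrow> \<rho> \<le> R p"
    unfolding \<rho>_def using F pos(1) by (auto simp: Min_gr_iff Min_le_iff)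
  have h: "h > 0" "\<And>p. p \<in> F \<Longrightarrow> h \<le> H p"
    unfolding h_def using F pos(2) by (auto simp: Min_gr_iff Min_le_iff)
  have "\<exists>w\<in>W ` F. \<forall>t. 0 < t \<and> t \<le> h \<longrightarrow> skew_box w \<theta> \<rho> t x \<subseteq> interior \<Omega>" if x: "x \<in> \<Omega>" for x
  proof -
    obtain p where p: "p \<in> F" "x \<in> ball p (\<delta> p)" using F(3) x closure_subset by blast
    have "skew_box (W p) \<theta> \<rho> t x \<subseteq> interior \<Omega>" if "0 < t" "t \<le> h" for t
    proof -
      have "skew_box (W p) \<theta> \<rho> t x \<subseteq> skew_box (W p) \<theta> (R p) t x" using \<rho>(2)[OF p(1)] that by (intro skew_box_mono) auto
      also have "\<dots> \<subseteq> interior \<Omega>" using F(1) p x that h(2)[OF p(1)] by (intro box) auto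
      finally show ?thesis .
    qed
    then show ?thesis using p(1) by blast
  qed
  then show ?thesis using F(2) \<rho>(1) h(1) by (intro exI[of _ "W ` F"] exI[of _ \<rho>] exI[of _ h]) auto
qed

section \<open>Multilevel expansion of kernel sections\<close>

text \<open>A Lagrange polynomial of one grid, read on another affine grid, is still a polynomial of
  degree at most m and hence interpolated exactly.\<close>

lemma lagrange_basis_reproduces:
  "(\<Sum>k\<le>m. lagrange_basis m k v * lagrange_basis m j (c + s * real k)) = lagrange_basis m j (c + s * v)"
  if "j \<le> m"
proof -
  define L where "L = (\<Prod>i\<in>{..m} - {j}. smult (1 / (real j - real i)) [:- real i, 1:])"
  have L: "poly L w = lagrange_basis m j w" for w
    by (simp add: L_def lagrange_basis_def poly_prod divide_simps mult.commute)
  have "degree L \<le> (\<Sum>i\<in>{..m} - {j}. degree (smult (1 / (real j - real i)) [:- real i, 1:]))"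
    unfolding L_def using degree_prod_sum_le[of "{..m} - {j}" "\<lambda>i. smult (1 / (real j - real i)) [:- real i, 1:]"]
    by (simp add: o_def)
  also have "\<dots> \<le> (\<Sum>i\<in>{..m} - {j}. 1)" by (intro sum_mono) auto
  also have "\<dots> = m" using that by simp
  finally have "degree L \<le> m" .
  have "degree (pcompose L [:c, s:]) \<le> degree L * degree [:c, s:]" by (rule degree_pcompose_le)
  also have "\<dots> \<le> m * 1" using \<open>degree L \<le> m\<close> by (intro mult_mono) auto
  finally have "degree (pcompose L [:c, s:]) \<le> m" by simp
  from lagrange_interpolation_poly[OF this, of v] show ?thesis by (simp add: poly_pcompose L mult.commute)
qed

section \<open>Mollified polynomial interpolation on the line\<close>

locale mollifier =
  fixes \<psi> :: "real \<Rightarrow> real" and m :: nat and M :: real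
  assumes \<psi>_smooth: "smooth1 \<psi>" and \<psi>_supp: "\<And>x. x \<notin> {-1..1} \<Longrightarrow> \<psi> x = 0"
    and \<psi>_mom: "\<And>j. j \<le> m \<Longrightarrow> (\<integral>x. \<psi> x * x ^ j \<partial>lborel) = 0 ^ j" and \<psi>_bnd: "\<And>x. \<bar>\<psi> x\<bar> \<le> M"
begin

definition psi :: "real \<Rightarrow> real \<Rightarrow> real \<Rightarrow> real" where
  "psi t a s = 1 / t * \<psi> (1 / t * s + (- a))"

text \<open>The polynomial interpolant at the nodes \<open>t (a + k)\<close>, evaluated at \<open>u\<close>, with the node
  evaluations mollified.\<close>

definition kap :: "real \<Rightarrow> real \<Rightarrow> real \<Rightarrow> real \<Rightarrow> real" where
  "kap t a u s = (\<Sum>k\<le>m. lagrange_basis m k (u / t - a) * psi t (a + real k) s)"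

lemma M_nonneg: "M \<ge> 0"
  using \<psi>_bnd[of 0] by linarith

lemma smooth1_psi: "smooth1 (psi t a)"
  unfolding psi_def[abs_def] by (rule smooth1_affine[OF \<psi>_smooth])

lemma smooth1_kap: "smooth1 (kap t a u)"
  unfolding kap_def[abs_def] by (rule smooth1_sum[OF smooth1_psi])

lemma psi_supp:
  assumes "t > 0" "s \<notin> {t * (a - 1)..t * (a + 1)}"
  shows "psi t a s = 0"
proof -
  have "1 / t * s + (- a) \<notin> {-1..1}" using assms by (auto simp: field_simps)
  from \<psi>_supp[OF this] show ?thesis by (simp only: psi_def mult_zero_right)
qed

lemma kap_supp:
  assumes "t > 0" "s \<notin> {t * (a - 1)..t * (a + real m + 1)}"
  shows "kap t a u s = 0"
proof -
  have "psi t (a + real k) s = 0" if "k \<le> m" for k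
  proof (rule psi_supp[OF assms(1)])
    have "t * (a - 1) \<le> t * (a + real k - 1)" "t * (a + real k + 1) \<le> t * (a + real m + 1)"
      using that assms(1) by (auto intro!: mult_left_mono)
    then show "s \<notin> {t * (a + real k - 1)..t * (a + real k + 1)}" using assms(2) by auto
  qed
  then show ?thesis by (simp add: kap_def)
qed

lemma abs_psi_le: "t > 0 \<Longrightarrow> \<bar>psi t a s\<bar> \<le> M / t"
  using \<psi>_bnd by (simp add: psi_def abs_mult divide_right_mono)

lemma abs_kap_le:
  assumes t: "t > 0" and r: "\<bar>u / t - a\<bar> \<le> r"
  shows "\<bar>kap t a u s\<bar> \<le> (real m + 1) * (r + real m) ^ m * M / t"
proof -
  have "\<bar>kap t a u s\<bar> \<le> (\<Sum>k\<le>m. \<bar>lagrange_basis m k (u / t - a) * psi t (a + real k) s\<bar>)"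
    unfolding kap_def by (rule sum_abs)
  also have "\<dots> \<le> (\<Sum>k\<le>m. (r + real m) ^ m * (M / t))"
  proof (rule sum_mono)
    fix k assume "k \<in> {..m}"
    then show "\<bar>lagrange_basis m k (u / t - a) * psi t (a + real k) s\<bar> \<le> (r + real m) ^ m * (M / t)"
      unfolding abs_mult using abs_lagrange_basis_le[OF r, of k m] abs_psi_le[OF t] r
      by (intro mult_mono) auto
  qed
  also have "\<dots> = (real m + 1) * (r + real m) ^ m * M / t" by simp
  finally show ?thesis .
qed

lemma psi_integrable: "t > 0 \<Longrightarrow> integrable lborel (\<lambda>s. psi t a s * s ^ j)"
  using integrable_moment[OF smooth1_cont0[OF smooth1_psi] psi_supp] by blast

text \<open>After the substitution s = t (a + x) the power is expanded and only the moment of order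
  0 of \<psi> survives. Averaging with \<open>psi t a\<close> is thus evaluation at t a on
  polynomials of degree at most m.\<close>

lemma psi_moment:
  assumes t: "t > 0" and j: "j \<le> m"
  shows "(\<integral>s. psi t a s * s ^ j \<partial>lborel) = (t * a) ^ j"
proof -
  have "(\<integral>s. psi t a s * s ^ j \<partial>lborel) = \<bar>t\<bar> *\<^sub>R (\<integral>x. psi t a (t * a + t * x) * (t * a + t * x) ^ j \<partial>lborel)"
    using t by (intro lborel_integral_real_affine) auto
  also have "(\<lambda>x. psi t a (t * a + t * x) * (t * a + t * x) ^ j)
      = (\<lambda>x. (1 / t) * (\<Sum>i\<le>j. real (j choose i) * t ^ i * (t * a) ^ (j - i) * (\<psi> x * x ^ i)))"
  proof
    fix x
    have "1 / t * (t * a + t * x) + - a = x" using t by (simp add: field_simps)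
    then have "psi t a (t * a + t * x) = 1 / t * \<psi> x" by (simp add: psi_def)
    moreover have "(t * a + t * x) ^ j = (\<Sum>i\<le>j. real (j choose i) * t ^ i * (t * a) ^ (j - i) * x ^ i)"
      by (subst add.commute, subst binomial_ring) (simp add: power_mult_distrib mult_ac)
    ultimately show "psi t a (t * a + t * x) * (t * a + t * x) ^ j
      = (1 / t) * (\<Sum>i\<le>j. real (j choose i) * t ^ i * (t * a) ^ (j - i) * (\<psi> x * x ^ i))"
      by (simp add: sum_distrib_left mult_ac)
  qed
  also have "(\<integral>x. (1 / t) * (\<Sum>i\<le>j. real (j choose i) * t ^ i * (t * a) ^ (j - i) * (\<psi> x * x ^ i)) \<partial>lborel)
      = (1 / t) * (\<Sum>i\<le>j. real (j choose i) * t ^ i * (t * a) ^ (j - i) * 0 ^ i)"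
  proof -
    have i: "integrable lborel (\<lambda>x. \<psi> x * x ^ i)" for i
      by (rule integrable_moment[OF smooth1_cont0[OF \<psi>_smooth] \<psi>_supp])
    have "(\<integral>x. (\<Sum>i\<le>j. real (j choose i) * t ^ i * (t * a) ^ (j - i) * (\<psi> x * x ^ i)) \<partial>lborel)
        = (\<Sum>i\<le>j. (\<integral>x. real (j choose i) * t ^ i * (t * a) ^ (j - i) * (\<psi> x * x ^ i) \<partial>lborel))"
      by (rule Bochner_Integration.integral_sum) (intro integrable_mult_right i)
    also have "\<dots> = (\<Sum>i\<le>j. real (j choose i) * t ^ i * (t * a) ^ (j - i) * 0 ^ i)"
      using j by (intro sum.cong) (auto simp: \<psi>_mom)
    finally show ?thesis by simp
  qed
  also have "(\<Sum>i\<le>j. real (j choose i) * t ^ i * (t * a) ^ (j - i) * 0 ^ i) = (t * a) ^ j"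
    by (subst sum.remove[of _ 0]) (auto intro!: sum.neutral)
  finally show ?thesis using t by simp
qed

lemma kap_integrable: "t > 0 \<Longrightarrow> integrable lborel (\<lambda>s. kap t a u s * s ^ j)"
  using integrable_moment[OF smooth1_cont0[OF smooth1_kap] kap_supp] by blast

lemma kap_moment:
  assumes t: "t > 0" and j: "j \<le> m"
  shows "(\<integral>s. kap t a u s * s ^ j \<partial>lborel) = u ^ j"
proof -
  have "(\<integral>s. kap t a u s * s ^ j \<partial>lborel)
      = (\<integral>s. (\<Sum>k\<le>m. lagrange_basis m k (u / t - a) * (psi t (a + real k) s * s ^ j)) \<partial>lborel)"
    by (simp add: kap_def sum_distrib_right mult.assoc)
  also have "\<dots> = (\<Sum>k\<le>m. (\<integral>s. lagrange_basis m k (u / t - a) * (psi t (a + real k) s * s ^ j) \<partial>lborel))"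
    by (rule Bochner_Integration.integral_sum) (intro integrable_mult_right psi_integrable t)
  also have "\<dots> = (\<Sum>k\<le>m. lagrange_basis m k (u / t - a) * (t * (a + real k)) ^ j)"
    using psi_moment[OF t j] by simp
  also have "\<dots> = (t * (a + (u / t - a))) ^ j" by (rule lagrange_interpolation_power[OF j])
  finally show ?thesis using t by simp
qed

text \<open>\<open>kap\<close> is a polynomial of degree at most m in the evaluation point u, so
  interpolating it on another grid changes nothing. This expresses the kernel of one level in the
  weights of the next.\<close>

lemma kap_reproduces:
  assumes "t > 0" "t' > 0"
  shows "(\<Sum>k\<le>m. lagrange_basis m k (u / t' - a') * kap t a (t' * (a' + real k)) s) = kap t a u s"
proof -
  have "(\<Sum>k\<le>m. lagrange_basis m k (u / t' - a') * kap t a (t' * (a' + real k)) s)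
      = (\<Sum>k\<le>m. \<Sum>j\<le>m. lagrange_basis m k (u / t' - a') * lagrange_basis m j ((t' * a' / t - a) + t' / t * real k) * psi t (a + real j) s)"
    unfolding kap_def sum_distrib_left
    by (intro sum.cong refl) (simp add: distrib_left add_divide_distrib algebra_simps)
  also have "\<dots> = (\<Sum>j\<le>m. (\<Sum>k\<le>m. lagrange_basis m k (u / t' - a') * lagrange_basis m j ((t' * a' / t - a) + t' / t * real k)) * psi t (a + real j) s)"
    unfolding sum_distrib_right by (rule sum.swap)
  also have "\<dots> = (\<Sum>j\<le>m. lagrange_basis m j ((t' * a' / t - a) + t' / t * (u / t' - a')) * psi t (a + real j) s)"
    by (intro sum.cong refl) (simp only: lagrange_basis_reproduces atMost_iff)
  also have "(t' * a' / t - a) + t' / t * (u / t' - a') = u / t - a" using assms by (simp add: field_simps)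
  finally show ?thesis by (simp add: kap_def)
qed

end

lemma ex_mollifier_locale: "\<exists>\<psi> M. mollifier \<psi> m M"
proof -
  obtain \<psi> where \<psi>: "smooth1 \<psi>" "\<And>x. x \<notin> {-1..1} \<Longrightarrow> \<psi> x = 0" "\<And>j. j \<le> m \<Longrightarrow> (\<integral>x. \<psi> x * x ^ j \<partial>lborel) = 0 ^ j"
    using ex_mollifier[of m] by blast
  have "compact (\<psi> ` {-1..1})" by (intro compact_continuous_image smooth1_cont0 \<psi>(1)) auto
  then obtain M where M: "\<And>x. x \<in> {-1..1} \<Longrightarrow> \<bar>\<psi> x\<bar> \<le> M"
    using compact_imp_bounded by (fastforce simp: bounded_iff)
  have "\<bar>\<psi> x\<bar> \<le> max 0 M" for x using M[of x] \<psi>(2)[of x] by (cases "x \<in> {-1..1}") auto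
  then have "mollifier \<psi> m (max 0 M)" using \<psi> by unfold_locales auto
  then show ?thesis by blast
qed

lemma tensor_sum:
  fixes C :: "'d::finite \<Rightarrow> nat \<Rightarrow> real \<Rightarrow> real"
  shows "tensor (\<lambda>i s. \<Sum>k\<le>m. c i k * C i k s) y
    = (\<Sum>\<gamma>\<in>PiE UNIV (\<lambda>_. {..m}). (\<Prod>i\<in>UNIV. c i (\<gamma> i)) * tensor (\<lambda>i. C i (\<gamma> i)) y)"
  unfolding tensor_def by (subst prod_sum_PiE) (auto simp: prod.distrib)

text \<open>Height (S / t)^d times volume (L t)^d: the mesh width cancels, so one bound serves all
  levels.\<close>

lemma abs_pairing_tensor_le:
  fixes U :: "(real^'d::finite) set"
  assumes U: "U \<in> sets lebesgue" and int: "integrable (lebesgue_on U) (\<lambda>y. \<phi> y * tensor C y)"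
    and F: "\<And>y. y \<in> cbox lo hi \<Longrightarrow> \<bar>\<phi> y\<bar> \<le> F" "F \<ge> 0"
    and sup: "\<And>i s. s \<notin> {lo $ i..hi $ i} \<Longrightarrow> C i s = 0" and box: "cbox lo hi \<subseteq> U"
    and bnd: "\<And>i s. \<bar>C i s\<bar> \<le> S / t"
    and side: "\<And>i. lo $ i \<le> hi $ i" "\<And>i. hi $ i - lo $ i \<le> L * t" and t: "t > 0"
  shows "\<bar>\<integral>y. \<phi> y * tensor C y \<partial>lebesgue_on U\<bar> \<le> F * (S * L) ^ CARD('d)"
proof -
  let ?B = "cbox lo hi"
  have S0: "S / t \<ge> 0" using bnd abs_ge_zero order_trans by blast
  have tb: "\<bar>tensor C y\<bar> \<le> (S / t) ^ CARD('d)" for y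
  proof -
    have "\<bar>tensor C y\<bar> \<le> (\<Prod>i\<in>(UNIV::'d set). S / t)"
      unfolding tensor_def abs_prod using bnd by (intro prod_mono) auto
    then show ?thesis by simp
  qed
  have Bm: "?B \<in> sets (lebesgue_on U)" using box U by (auto simp: sets_restrict_space_iff)
  have em: "emeasure (lebesgue_on U) ?B = emeasure lborel ?B"
    using box U by (simp add: emeasure_restrict_space)
  have ms: "measure (lebesgue_on U) ?B = (\<Prod>i\<in>UNIV. hi $ i - lo $ i)"
  proof -
    have "lo \<in> ?B" using side(1) by (simp add: mem_box_cart)
    then have "?B \<noteq> {}" by blast
    then show ?thesis using box U by (simp add: measure_restrict_space content_cbox_cart)
  qed
  define c where "c = F * (S / t) ^ CARD('d)"
  have c0: "c \<ge> 0" using F(2) S0 by (simp add: c_def)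
  have i2: "integrable (lebesgue_on U) (\<lambda>y. indicator ?B y * c)"
    using Bm em emeasure_lborel_cbox_finite[of lo hi] by (intro integrable_mult_left) (simp add: less_top)
  have "\<bar>\<integral>y. \<phi> y * tensor C y \<partial>lebesgue_on U\<bar> \<le> (\<integral>y. indicator ?B y * c \<partial>lebesgue_on U)"
  proof (rule integral_abs_bound_integral[OF int i2])
    fix y
    show "\<bar>\<phi> y * tensor C y\<bar> \<le> indicator ?B y * c"
    proof (cases "y \<in> ?B")
      case True
      then show ?thesis unfolding abs_mult c_def using F tb[of y] by (auto intro!: mult_mono)
    next
      case False
      then show ?thesis using tensor_eq_0[of lo hi C, OF sup] by simp
    qed
  qed
  also have "\<dots> = c * (\<Prod>i\<in>UNIV. hi $ i - lo $ i)" using Bm ms box by (simp add: mult.commute Int_absorb2)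
  also have "\<dots> \<le> c * (\<Prod>i\<in>(UNIV::'d set). L * t)" using side c0 by (intro mult_left_mono prod_mono) auto
  also have "\<dots> = F * (S / t * (L * t)) ^ CARD('d)" by (simp add: c_def power_mult_distrib power_divide)
  also have "S / t * (L * t) = S * L" using t by simp
  finally show ?thesis .
qed

text \<open>The number \<open>p\<close> fixes the mesh ratio \<theta> = 2^(-p) of consecutive levels
  and is so large that the increments decay at least like 4^(-l); \<open>chart\<close> picks for
  each point one of the finitely many directions along which boxes stay in the domain.\<close>

locale sobolev_kernel = kernel_space \<Omega> k ev + mollifier \<psi> "nat \<lfloor>\<tau>\<rfloor>" M
  for \<Omega> :: "(real^'d::finite) set" and k and ev :: "'h::{real_inner,complete_space} \<Rightarrow> real^'d \<Rightarrow> real"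
    and \<psi> and \<tau> M :: real +
  fixes K \<theta> \<rho> h0 W bb :: real and p :: nat and Dirs :: "(real^'d) set" and chart :: "real^'d \<Rightarrow> real^'d"
  assumes cont: "continuous_kernel_on \<Omega> k" and \<tau>: "\<tau> > real CARD('d) / 2"
    and emb: "\<And>f. ev f \<in> sobolev_space (interior \<Omega>) \<tau>" "\<And>f. sobolev_norm (interior \<Omega>) \<tau> (ev f) \<le> K * norm f"
    and K: "K > 0" and p: "real p * (\<tau> - real CARD('d) / 2) \<ge> 2" and \<theta>: "\<theta> = 1 / 2 ^ p"
    and \<rho>: "\<rho> > 0" and h0: "h0 > 0" and Dirs: "finite Dirs" "\<And>x. x \<in> \<Omega> \<Longrightarrow> chart x \<in> Dirs"
    and box: "\<And>x t. x \<in> \<Omega> \<Longrightarrow> 0 < t \<Longrightarrow> t \<le> h0 \<Longrightarrow> skew_box (chart x) \<theta> \<rho> t x \<subseteq> interior \<Omega>"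
    and W: "\<And>w i. w \<in> Dirs \<Longrightarrow> \<bar>w $ i\<bar> \<le> W" "W \<ge> 0" and bb: "\<And>x i. x \<in> \<Omega> \<Longrightarrow> \<bar>x $ i\<bar> \<le> bb"
begin

abbreviation "m \<equiv> nat \<lfloor>\<tau>\<rfloor>"
abbreviation "U \<equiv> interior \<Omega>"

text \<open>The nodes for \<open>x\<close> on level \<open>l\<close> form a grid of mesh width \<open>t l\<close> starting at \<open>t l * a l x\<close>, which
  is the grid cell of \<open>x\<close> moved by about \<open>R * t l\<close> along the chart direction. The mollifiers for these
  nodes and for those of the next level are supported in the box between \<open>lo l x\<close> and \<open>hi l x\<close>.\<close>

definition R where "R = (real m + 3) / \<rho>"
definition t where "t l = h0 / R * \<theta> ^ l"
definition cell :: "nat \<Rightarrow> real^'d \<Rightarrow> 'd \<Rightarrow> int" where "cell l x i = \<lfloor>x $ i / t l\<rfloor>"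
definition base :: "real^'d \<Rightarrow> ('d \<Rightarrow> int) \<Rightarrow> 'd \<Rightarrow> real" where "base w c i = real_of_int (c i + \<lfloor>R * w $ i\<rfloor>)"
definition a where "a l x = base (chart x) (cell l x)"
definition lo where "lo l x = (\<chi> i. x $ i + R * t l * (min (\<theta> * chart x $ i) (chart x $ i) - \<rho>))"
definition hi where "hi l x = (\<chi> i. x $ i + R * t l * (max (\<theta> * chart x $ i) (chart x $ i) + \<rho>))"
definition \<Gamma> :: "('d \<Rightarrow> nat) set" where "\<Gamma> = PiE UNIV (\<lambda>_. {..m})"

lemma R: "R > 0" "R * \<rho> = real m + 3"
  using \<rho> by (auto simp: R_def)

lemma \<theta>01: "0 < \<theta>" "\<theta> \<le> 1"
  by (auto simp: \<theta>)

lemma t: "t l > 0" "t (Suc l) = \<theta> * t l" "R * t l \<le> h0"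
  using h0 R \<theta>01 by (auto simp: t_def mult_left_le power_le_one)

lemma cbox_subset: "x \<in> \<Omega> \<Longrightarrow> cbox (lo l x) (hi l x) \<subseteq> U"
proof -
  assume x: "x \<in> \<Omega>"
  have "cbox (lo l x) (hi l x) = skew_box (chart x) \<theta> \<rho> (R * t l) x"
    by (auto simp: lo_def hi_def skew_box_def mem_box_cart)
  also have "\<dots> \<subseteq> U" using t R by (intro box x) auto
  finally show ?thesis .
qed

lemma a_bounds: "x $ i / t l + R * chart x $ i - 2 \<le> a l x i" "a l x i \<le> x $ i / t l + R * chart x $ i"
  unfolding a_def base_def cell_def by linarith+

lemma ta_bounds: "x $ i + t l * (R * chart x $ i - 2) \<le> t l * a l x i" "t l * a l x i \<le> x $ i + t l * (R * chart x $ i)"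
proof -
  have "t l * (x $ i / t l + R * chart x $ i - 2) \<le> t l * a l x i"
       "t l * a l x i \<le> t l * (x $ i / t l + R * chart x $ i)"
    using a_bounds t(1)[of l] by (auto intro!: mult_left_mono)
  then show "x $ i + t l * (R * chart x $ i - 2) \<le> t l * a l x i" "t l * a l x i \<le> x $ i + t l * (R * chart x $ i)"
    using t(1)[of l] by (auto simp: algebra_simps)
qed

text \<open>\<sigma> = 1 stands for level l and \<sigma> = \<theta> for the next one. The two
  roundings in \<open>cell\<close> and \<open>base\<close> lower the first node by at most 2, the
  nodes extend over length m, and mollifiers stick out by 1, which gives -3 and m + 1;
  \<open>R * \<rho> = m + 3\<close> covers both.\<close>

lemma interval_subset:
  assumes \<sigma>: "\<sigma> = 1 \<or> \<sigma> = \<theta>"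
  shows "{x $ i + \<sigma> * t l * (R * chart x $ i - 3)..x $ i + \<sigma> * t l * (R * chart x $ i + real m + 1)} \<subseteq> {lo l x $ i..hi l x $ i}"
proof -
  let ?w = "chart x $ i"
  have \<sigma>1: "0 < \<sigma>" "\<sigma> \<le> 1" using \<sigma> \<theta>01 by auto
  have mm: "min (\<theta> * ?w) ?w \<le> \<sigma> * ?w" "\<sigma> * ?w \<le> max (\<theta> * ?w) ?w" using \<sigma> by auto
  have "R * t l * (min (\<theta> * ?w) ?w - \<rho>) \<le> \<sigma> * t l * (R * ?w - 3)"
  proof -
    have "R * t l * min (\<theta> * ?w) ?w \<le> R * t l * (\<sigma> * ?w)" using mm(1) R t(1)[of l] by (intro mult_left_mono) auto
    moreover have "R * t l * \<rho> = t l * (real m + 3)" using R(2) by (metis mult.assoc mult.commute)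
    moreover have "\<sigma> * t l * 3 \<le> t l * (real m + 3)"
      using \<sigma>1 t(1)[of l] mult_mono[of \<sigma> 1 "t l * 3" "t l * (real m + 3)"] by simp
    ultimately show ?thesis by (simp add: algebra_simps)
  qed
  moreover have "\<sigma> * t l * (R * ?w + real m + 1) \<le> R * t l * (max (\<theta> * ?w) ?w + \<rho>)"
  proof -
    have "R * t l * (\<sigma> * ?w) \<le> R * t l * max (\<theta> * ?w) ?w" using mm(2) R t(1)[of l] by (intro mult_left_mono) auto
    moreover have "R * t l * \<rho> = t l * (real m + 3)" using R(2) by (metis mult.assoc mult.commute)
    moreover have "\<sigma> * t l * (real m + 1) \<le> t l * (real m + 3)"
      using \<sigma>1 t(1)[of l] mult_mono[of \<sigma> 1 "t l * (real m + 1)" "t l * (real m + 3)"] by simp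
    ultimately show ?thesis by (simp add: algebra_simps)
  qed
  ultimately show ?thesis by (auto simp: lo_def hi_def)
qed

lemma node_supp:
  assumes l': "l' = l \<or> l' = Suc l" and \<gamma>: "\<gamma> \<in> \<Gamma>" and s: "s \<notin> {lo l x $ i..hi l x $ i}"
  shows "psi (t l') (a l' x i + real (\<gamma> i)) s = 0"
proof (rule psi_supp[OF t(1)])
  obtain \<sigma> where \<sigma>: "\<sigma> = 1 \<or> \<sigma> = \<theta>" "t l' = \<sigma> * t l" using l' t(2) by (metis mult_1)
  have g: "real (\<gamma> i) \<le> real m" using \<gamma> by (auto simp: \<Gamma>_def)
  have "t l' * (a l' x i + real (\<gamma> i) - 1) \<ge> x $ i + t l' * (R * chart x $ i - 3)"
    using ta_bounds(1)[where x = x and i = i and l = l']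
      mult_nonneg_nonneg[of "t l'" "real (\<gamma> i)", OF less_imp_le[OF t(1)] of_nat_0_le_iff] by (simp add: algebra_simps)
  moreover have "t l' * (a l' x i + real (\<gamma> i) + 1) \<le> x $ i + t l' * (R * chart x $ i + real m + 1)"
    using ta_bounds(2)[where x = x and i = i and l = l']
      mult_left_mono[OF g less_imp_le[OF t(1)[of l']]] by (simp add: algebra_simps)
  ultimately show "s \<notin> {t l' * (a l' x i + real (\<gamma> i) - 1)..t l' * (a l' x i + real (\<gamma> i) + 1)}"
    using interval_subset[OF \<sigma>(1), of x i l] s unfolding \<sigma>(2) by auto
qed

lemma ker_supp:
  assumes s: "s \<notin> {lo l x $ i..hi l x $ i}"
  shows "kap (t l) (a l x i) u s = 0"
proof (rule kap_supp[OF t(1)])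
  have "t l * (a l x i - 1) \<ge> x $ i + t l * (R * chart x $ i - 3)"
    using ta_bounds(1)[where x = x and i = i and l = l] by (simp add: algebra_simps)
  moreover have "t l * (a l x i + real m + 1) \<le> x $ i + t l * (R * chart x $ i + real m + 1)"
    using ta_bounds(2)[where x = x and i = i and l = l] by (simp add: algebra_simps)
  ultimately show "s \<notin> {t l * (a l x i - 1)..t l * (a l x i + real m + 1)}"
    using interval_subset[of 1 x i l] s by auto
qed

definition lw where "lw = 2 * \<rho> * R"
definition Lw where "Lw = R * (W + 2 * \<rho>)"
definition r where "r = 2 * R * W + real m + 4"
text \<open>The first entry is for mollifiers, including those of the next level, whose height M / t
  (Suc l) is measured in units of 1 / t l; the second is for interpolation kernels.\<close>

definition S where "S = max (M / \<theta>) ((real m + 1) * (r + real m) ^ m * M)"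

lemma lw: "lw > 0" using \<rho> R by (simp add: lw_def)

lemma side:
  assumes x: "x \<in> \<Omega>"
  shows "lw * t l \<le> hi l x $ i - lo l x $ i" "hi l x $ i - lo l x $ i \<le> Lw * t l"
proof -
  let ?w = "chart x $ i"
  have "\<bar>?w\<bar> \<le> W" using W(1) Dirs(2)[OF x] by blast
  moreover have "\<bar>?w - \<theta> * ?w\<bar> \<le> \<bar>?w\<bar>"
  proof -
    have "\<bar>?w - \<theta> * ?w\<bar> = (1 - \<theta>) * \<bar>?w\<bar>"
    proof -
      have "?w - \<theta> * ?w = (1 - \<theta>) * ?w" by (simp add: left_diff_distrib)
      then show ?thesis using \<theta>01 by (simp add: abs_mult)
    qed
    also have "\<dots> \<le> \<bar>?w\<bar>" using \<theta>01 by (intro mult_left_le_one_le) auto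
    finally show ?thesis .
  qed
  ultimately have w: "0 \<le> max (\<theta> * ?w) ?w - min (\<theta> * ?w) ?w" "max (\<theta> * ?w) ?w - min (\<theta> * ?w) ?w \<le> W" by auto
  have eq: "hi l x $ i - lo l x $ i = R * t l * ((max (\<theta> * ?w) ?w - min (\<theta> * ?w) ?w) + 2 * \<rho>)"
    by (simp add: hi_def lo_def algebra_simps)
  have "R * t l * (2 * \<rho>) \<le> hi l x $ i - lo l x $ i" unfolding eq
    using w R t(1)[of l] by (intro mult_left_mono) auto
  then show "lw * t l \<le> hi l x $ i - lo l x $ i" by (simp add: lw_def mult_ac)
  have "hi l x $ i - lo l x $ i \<le> R * t l * (W + 2 * \<rho>)" unfolding eq
    using w R t(1)[of l] by (intro mult_left_mono) auto
  then show "hi l x $ i - lo l x $ i \<le> Lw * t l" by (simp add: Lw_def mult_ac)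
qed

lemma lohi: "x \<in> \<Omega> \<Longrightarrow> lo l x $ i \<le> hi l x $ i"
  using side(1)[of x l i] lw t(1)[of l] mult_pos_pos[of lw "t l"] by linarith

lemma frac_bounds:
  assumes x: "x \<in> \<Omega>"
  shows "\<bar>x $ i / t l - a l x i\<bar> \<le> r"
    and "\<gamma> \<in> \<Gamma> \<Longrightarrow> \<bar>t (Suc l) * (a (Suc l) x i + real (\<gamma> i)) / t l - a l x i\<bar> \<le> r"
proof -
  have w: "\<bar>R * chart x $ i\<bar> \<le> R * W" using W(1)[OF Dirs(2)[OF x]] R by (simp add: abs_mult)
  have RW: "0 \<le> R * W" using R W(2) by simp
  show "\<bar>x $ i / t l - a l x i\<bar> \<le> r"
    using a_bounds[where x = x and i = i and l = l] w RW unfolding r_def by (auto simp: abs_le_iff)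
  assume \<gamma>: "\<gamma> \<in> \<Gamma>"
  have g: "real (\<gamma> i) \<le> real m" using \<gamma> by (auto simp: \<Gamma>_def)
  define q where "q = a (Suc l) x i + real (\<gamma> i) - x $ i / t (Suc l)"
  have q: "\<bar>q\<bar> \<le> R * W + 2 + real m" unfolding q_def
    using a_bounds[where x = x and i = i and l = "Suc l"] w g by (auto simp: abs_le_iff)
  have "t (Suc l) * (a (Suc l) x i + real (\<gamma> i)) / t l = x $ i / t l + \<theta> * q"
    unfolding q_def t(2) using t(1)[of l] \<theta>01 by (simp add: field_simps)
  moreover have "\<bar>\<theta> * q\<bar> \<le> R * W + 2 + real m"
  proof -
    have "\<bar>\<theta> * q\<bar> \<le> 1 * \<bar>q\<bar>" unfolding abs_mult using \<theta>01 by (intro mult_right_mono) auto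
    then show ?thesis using q by simp
  qed
  ultimately show "\<bar>t (Suc l) * (a (Suc l) x i + real (\<gamma> i)) / t l - a l x i\<bar> \<le> r"
    using a_bounds[where x = x and i = i and l = l] w RW unfolding r_def by (auto simp: abs_le_iff)
qed

lemma node_bnd: "l' = l \<or> l' = Suc l \<Longrightarrow> \<bar>psi (t l') b s\<bar> \<le> S / t l"
proof -
  assume l': "l' = l \<or> l' = Suc l"
  have M1: "M \<le> M / \<theta>" using M_nonneg \<theta>01 by (simp add: pos_le_divide_eq mult_left_le)
  have "\<bar>psi (t l') b s\<bar> \<le> M / t l'" by (rule abs_psi_le[OF t(1)])
  also have "\<dots> \<le> (M / \<theta>) / t l"
  proof (cases "l' = l")
    case True
    then show ?thesis using divide_right_mono[OF M1 less_imp_le[OF t(1)[of l]]] by simp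
  next
    case False
    then show ?thesis using l' by (simp add: t(2))
  qed
  also have "\<dots> \<le> S / t l" unfolding S_def using t(1)[of l] by (intro divide_right_mono) auto
  finally show ?thesis .
qed

lemma ker_bnd: "\<bar>u / t l - a l x i\<bar> \<le> r \<Longrightarrow> \<bar>kap (t l) (a l x i) u s\<bar> \<le> S / t l"
proof -
  assume "\<bar>u / t l - a l x i\<bar> \<le> r"
  then have "\<bar>kap (t l) (a l x i) u s\<bar> \<le> (real m + 1) * (r + real m) ^ m * M / t l" by (rule abs_kap_le[OF t(1)])
  also have "\<dots> \<le> S / t l" unfolding S_def using t(1)[of l] by (intro divide_right_mono) auto
  finally show ?thesis .
qed

lemma U_meas: "U \<in> sets lebesgue" by simp

lemma ev_sq: "square_integrable_on U (ev f)"
  using emb(1)[of f] by (simp add: sobolev_space_def)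

text \<open>The Riesz representer of the pairing with F. It is meaningful where that functional is
  bounded, which \<open>rep_tensor\<close> secures for tensor products supported in a box.\<close>

definition rep :: "(real^'d \<Rightarrow> real) \<Rightarrow> 'h" where
  "rep F = (SOME v. \<forall>f. f \<bullet> v = (\<integral>y. ev f y * F y \<partial>lebesgue_on U))"

lemma rep_tensor:
  assumes x: "x \<in> \<Omega>" and C: "\<And>i. smooth1 (C i)" and sup: "\<And>i s. s \<notin> {lo l x $ i..hi l x $ i} \<Longrightarrow> C i s = 0"
    and bnd: "\<And>i s. \<bar>C i s\<bar> \<le> S / t l"
  shows "f \<bullet> rep (tensor C) = (\<integral>y. ev f y * tensor C y \<partial>lebesgue_on U)"
    and "norm (rep (tensor C)) \<le> (S * Lw) ^ CARD('d)"
proof -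
  define T where "T f = (\<integral>y. ev f y * tensor C y \<partial>lebesgue_on U)" for f
  have int: "integrable (lebesgue_on U) (\<lambda>y. ev f y * tensor C y)" for f
    by (rule integrable_mult_tensor[OF U_meas ev_sq C sup])
  have sub: "U \<subseteq> \<Omega>" by (rule interior_subset)
  have bound: "\<bar>T f\<bar> \<le> norm f * (S * Lw) ^ CARD('d)" for f
    unfolding T_def
  proof (rule abs_pairing_tensor_le[OF U_meas int _ _ sup cbox_subset[OF x] bnd lohi[OF x] side(2)[OF x] t(1)])
    show "\<bar>ev f y\<bar> \<le> norm f" if "y \<in> cbox (lo l x) (hi l x)" for y
      using cbox_subset[OF x, of l] sub that by (intro abs_ev_le) blast
  qed simp
  have linev: "linear (\<lambda>f. ev f y)" if "y \<in> \<Omega>" for y using rkhs that by (simp add: rkhs_def)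
  have "linear T"
  proof (rule linearI)
    show "T (f + g) = T f + T g" for f g
      unfolding T_def Bochner_Integration.integral_add[OF int int, symmetric]
      using sub by (intro Bochner_Integration.integral_cong) (auto simp: linear_add[OF linev] distrib_right)
    show "T (c *\<^sub>R f) = c *\<^sub>R T f" for c f
      unfolding T_def real_scaleR_def integral_mult_right_zero[symmetric]
      using sub by (intro Bochner_Integration.integral_cong) (auto simp: linear_cmul[OF linev])
  qed
  then have "\<exists>v. \<forall>f. T f = f \<bullet> v" using bound by (intro riesz_representation[of T "(S * Lw) ^ CARD('d)"]) (auto simp: mult.commute)
  then have "\<exists>v. \<forall>f. f \<bullet> v = (\<integral>y. ev f y * tensor C y \<partial>lebesgue_on U)" unfolding T_def by metis
  then have *: "\<forall>f. f \<bullet> rep (tensor C) = (\<integral>y. ev f y * tensor C y \<partial>lebesgue_on U)"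
    unfolding rep_def by (rule someI_ex)
  then show "f \<bullet> rep (tensor C) = (\<integral>y. ev f y * tensor C y \<partial>lebesgue_on U)" by blast
  have "norm (rep (tensor C)) * norm (rep (tensor C)) = rep (tensor C) \<bullet> rep (tensor C)"
    by (simp add: power2_norm_eq_inner[symmetric] power2_eq_square)
  also have "\<dots> = T (rep (tensor C))" using * unfolding T_def by blast
  also have "\<dots> \<le> norm (rep (tensor C)) * (S * Lw) ^ CARD('d)" using bound[of "rep (tensor C)"] by linarith
  finally have "norm (rep (tensor C)) = 0 \<or> norm (rep (tensor C)) \<le> (S * Lw) ^ CARD('d)"
    by (auto simp: mult_le_cancel_left)
  moreover have "0 \<le> (S * Lw) ^ CARD('d)"
  proof -
    have "0 \<le> S" using M_nonneg \<theta>01 by (simp add: S_def le_max_iff_disj)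
    moreover have "0 \<le> Lw" using R \<rho> W(2) by (simp add: Lw_def)
    ultimately show ?thesis by simp
  qed
  ultimately show "norm (rep (tensor C)) \<le> (S * Lw) ^ CARD('d)" by auto
qed

end

text \<open>Levels are sets, so the coefficients of indices with the same vector are merged; the
  triangle inequality keeps the absolute sum.\<close>

lemma sum_as_absconv:
  fixes g :: "'b \<Rightarrow> 'a::real_vector"
  assumes "finite G" "finite H" "g ` G \<subseteq> H" "(\<Sum>\<gamma>\<in>G. \<bar>c \<gamma>\<bar>) \<le> 1"
  shows "\<exists>C. (\<Sum>h\<in>H. \<bar>C h\<bar>) \<le> 1 \<and> (\<Sum>h\<in>H. C h *\<^sub>R h) = (\<Sum>\<gamma>\<in>G. c \<gamma> *\<^sub>R g \<gamma>)"
proof (intro exI conjI)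
  define C where "C h = (\<Sum>\<gamma>\<in>{\<gamma>\<in>G. g \<gamma> = h}. c \<gamma>)" for h
  have "(\<Sum>h\<in>H. \<bar>C h\<bar>) \<le> (\<Sum>h\<in>H. \<Sum>\<gamma>\<in>{\<gamma>\<in>G. g \<gamma> = h}. \<bar>c \<gamma>\<bar>)" unfolding C_def by (intro sum_mono sum_abs)
  also have "\<dots> = (\<Sum>\<gamma>\<in>G. \<bar>c \<gamma>\<bar>)" by (rule sum.group[OF assms(1-3)])
  finally show "(\<Sum>h\<in>H. \<bar>C h\<bar>) \<le> 1" using assms(4) by simp
  have "(\<Sum>h\<in>H. C h *\<^sub>R h) = (\<Sum>h\<in>H. \<Sum>\<gamma>\<in>{\<gamma>\<in>G. g \<gamma> = h}. c \<gamma> *\<^sub>R g \<gamma>)"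
    unfolding C_def scaleR_sum_left by (intro sum.cong refl) auto
  also have "\<dots> = (\<Sum>\<gamma>\<in>G. c \<gamma> *\<^sub>R g \<gamma>)" by (rule sum.group[OF assms(1-3)])
  finally show "(\<Sum>h\<in>H. C h *\<^sub>R h) = (\<Sum>\<gamma>\<in>G. c \<gamma> *\<^sub>R g \<gamma>)" .
qed

section \<open>The telescoping expansion: size, number and convergence of its terms\<close>

context sobolev_kernel
begin

definition node :: "nat \<Rightarrow> real^'d \<Rightarrow> ('d \<Rightarrow> nat) \<Rightarrow> real^'d \<Rightarrow> real" where
  "node l x \<gamma> = tensor (\<lambda>i. psi (t l) (a l x i + real (\<gamma> i)))"

definition ker :: "nat \<Rightarrow> real^'d \<Rightarrow> ('d \<Rightarrow> real) \<Rightarrow> real^'d \<Rightarrow> real" where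
  "ker l x z = tensor (\<lambda>i. kap (t l) (a l x i) (z i))"

definition pt :: "nat \<Rightarrow> real^'d \<Rightarrow> ('d \<Rightarrow> nat) \<Rightarrow> 'd \<Rightarrow> real" where
  "pt l x \<gamma> i = t l * (a l x i + real (\<gamma> i))"

definition weight :: "nat \<Rightarrow> real^'d \<Rightarrow> ('d \<Rightarrow> nat) \<Rightarrow> real" where
  "weight l x \<gamma> = (\<Prod>i\<in>UNIV. lagrange_basis m (\<gamma> i) (x $ i / t l - a l x i))"

text \<open>The vectors of the multilevel expansion: node functionals on the coarsest level, and on the
  others the error that the interpolation on the previous level makes for a node functional.\<close>

definition detail :: "nat \<Rightarrow> real^'d \<Rightarrow> ('d \<Rightarrow> nat) \<Rightarrow> 'h" where
  "detail l x \<gamma> = (case l of 0 \<Rightarrow> rep (node 0 x \<gamma>)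
     | Suc l' \<Rightarrow> rep (node (Suc l') x \<gamma>) - rep (ker l' x (pt (Suc l') x \<gamma>)))"

definition A1 where "A1 = real (card \<Gamma>) * ((r + real m) ^ m) ^ CARD('d)"

lemma finite_\<Gamma>: "finite \<Gamma>"
  unfolding \<Gamma>_def by (intro finite_PiE) auto

lemma A1_pos: "A1 > 0"
proof -
  have "(\<lambda>_. 0) \<in> \<Gamma>" by (auto simp: \<Gamma>_def)
  then have "card \<Gamma> > 0" using finite_\<Gamma> by (auto simp: card_gt_0_iff)
  moreover have "r + real m > 0" unfolding r_def using R W(2) by (intro add_nonneg_pos add_pos_nonneg mult_nonneg_nonneg) auto
  ultimately show ?thesis by (simp add: A1_def)
qed

lemma sum_abs_weight_le: "x \<in> \<Omega> \<Longrightarrow> (\<Sum>\<gamma>\<in>\<Gamma>. \<bar>weight l x \<gamma>\<bar>) \<le> A1"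
proof -
  assume x: "x \<in> \<Omega>"
  have "\<bar>weight l x \<gamma>\<bar> \<le> ((r + real m) ^ m) ^ CARD('d)" if "\<gamma> \<in> \<Gamma>" for \<gamma>
  proof -
    have "\<bar>weight l x \<gamma>\<bar> \<le> (\<Prod>i\<in>(UNIV :: 'd set). (r + real m) ^ m)"
      unfolding weight_def abs_prod using that
      by (intro prod_mono conjI abs_lagrange_basis_le frac_bounds(1)[OF x]) (auto simp: \<Gamma>_def)
    then show ?thesis by simp
  qed
  then have "(\<Sum>\<gamma>\<in>\<Gamma>. \<bar>weight l x \<gamma>\<bar>) \<le> (\<Sum>\<gamma>\<in>\<Gamma>. ((r + real m) ^ m) ^ CARD('d))" by (intro sum_mono)
  then show ?thesis by (simp add: A1_def)
qed

lemma rep_node: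
  assumes "x \<in> \<Omega>" "\<gamma> \<in> \<Gamma>" "l' = l \<or> l' = Suc l"
  shows "f \<bullet> rep (node l' x \<gamma>) = (\<integral>y. ev f y * node l' x \<gamma> y \<partial>lebesgue_on U)"
    and "norm (rep (node l' x \<gamma>)) \<le> (S * Lw) ^ CARD('d)"
  unfolding node_def
  using rep_tensor[OF assms(1) smooth1_psi node_supp[OF assms(3,2)] node_bnd[OF assms(3)]] by auto

lemma rep_ker:
  assumes "x \<in> \<Omega>" "\<And>i. \<bar>z i / t l - a l x i\<bar> \<le> r"
  shows "f \<bullet> rep (ker l x z) = (\<integral>y. ev f y * ker l x z y \<partial>lebesgue_on U)"
  unfolding ker_def
  by (rule rep_tensor(1)[OF assms(1) smooth1_kap ker_supp ker_bnd[OF assms(2)]])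

lemma pt_bound: "x \<in> \<Omega> \<Longrightarrow> \<gamma> \<in> \<Gamma> \<Longrightarrow> \<bar>pt (Suc l) x \<gamma> i / t l - a l x i\<bar> \<le> r"
  unfolding pt_def by (rule frac_bounds(2))

lemma x_bound: "x \<in> \<Omega> \<Longrightarrow> \<bar>x $ i / t l - a l x i\<bar> \<le> r"
  by (rule frac_bounds(1))

lemma ker_eq_sum_node: "ker l x (\<lambda>i. x $ i) y = (\<Sum>\<gamma>\<in>\<Gamma>. weight l x \<gamma> * node l x \<gamma> y)"
  unfolding ker_def kap_def[abs_def] tensor_sum \<Gamma>_def weight_def node_def ..

lemma ker_reproduces: "ker l x (\<lambda>i. x $ i) y = (\<Sum>\<gamma>\<in>\<Gamma>. weight (Suc l) x \<gamma> * ker l x (pt (Suc l) x \<gamma>) y)"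
proof -
  have "ker l x (\<lambda>i. x $ i) y = tensor (\<lambda>i s. \<Sum>k\<le>m. lagrange_basis m k (x $ i / t (Suc l) - a (Suc l) x i)
      * kap (t l) (a l x i) (t (Suc l) * (a (Suc l) x i + real k)) s) y"
    unfolding ker_def kap_reproduces[OF t(1) t(1)] ..
  also have "\<dots> = (\<Sum>\<gamma>\<in>\<Gamma>. weight (Suc l) x \<gamma> * ker l x (pt (Suc l) x \<gamma>) y)"
    unfolding tensor_sum \<Gamma>_def weight_def ker_def pt_def ..
  finally show ?thesis .
qed

lemma rep_ker_0:
  assumes x: "x \<in> \<Omega>"
  shows "rep (ker 0 x (\<lambda>i. x $ i)) = (\<Sum>\<gamma>\<in>\<Gamma>. weight 0 x \<gamma> *\<^sub>R detail 0 x \<gamma>)"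
proof -
  have int: "integrable (lebesgue_on U) (\<lambda>y. ev f y * node 0 x \<gamma> y)" if "\<gamma> \<in> \<Gamma>" for f \<gamma>
    unfolding node_def by (rule integrable_mult_tensor[OF U_meas ev_sq smooth1_psi node_supp[OF disjI1[OF refl] that]])
  have "f \<bullet> rep (ker 0 x (\<lambda>i. x $ i)) = f \<bullet> (\<Sum>\<gamma>\<in>\<Gamma>. weight 0 x \<gamma> *\<^sub>R detail 0 x \<gamma>)" for f
  proof -
    have "f \<bullet> rep (ker 0 x (\<lambda>i. x $ i)) = (\<integral>y. (\<Sum>\<gamma>\<in>\<Gamma>. weight 0 x \<gamma> * (ev f y * node 0 x \<gamma> y)) \<partial>lebesgue_on U)"
      unfolding rep_ker[OF x x_bound[OF x]] ker_eq_sum_node by (simp add: sum_distrib_left mult_ac)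
    also have "\<dots> = (\<Sum>\<gamma>\<in>\<Gamma>. \<integral>y. weight 0 x \<gamma> * (ev f y * node 0 x \<gamma> y) \<partial>lebesgue_on U)"
      by (intro Bochner_Integration.integral_sum integrable_mult_right int)
    also have "\<dots> = (\<Sum>\<gamma>\<in>\<Gamma>. weight 0 x \<gamma> * (f \<bullet> detail 0 x \<gamma>))"
      using rep_node(1)[OF x, of _ 0 0] by (intro sum.cong) (auto simp: detail_def)
    finally show ?thesis by (simp add: inner_sum_right)
  qed
  then show ?thesis by (rule vector_eq_ldot[THEN iffD1, OF allI])
qed

text \<open>Both kernels are written with the same weights of level \<open>Suc l\<close>: the fine
  one by its definition, the coarse one by \<open>ker_reproduces\<close>. Their difference is then a
  weighted sum of details.\<close>

lemma rep_ker_Suc: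
  assumes x: "x \<in> \<Omega>"
  shows "rep (ker (Suc l) x (\<lambda>i. x $ i)) = rep (ker l x (\<lambda>i. x $ i)) + (\<Sum>\<gamma>\<in>\<Gamma>. weight (Suc l) x \<gamma> *\<^sub>R detail (Suc l) x \<gamma>)"
proof -
  have int: "integrable (lebesgue_on U) (\<lambda>y. ev f y * node (Suc l) x \<gamma> y)" if "\<gamma> \<in> \<Gamma>" for f \<gamma>
    unfolding node_def by (rule integrable_mult_tensor[OF U_meas ev_sq smooth1_psi node_supp[OF disjI1[OF refl] that]])
  have int': "integrable (lebesgue_on U) (\<lambda>y. ev f y * ker l x z y)" for f z
    unfolding ker_def by (rule integrable_mult_tensor[OF U_meas ev_sq smooth1_kap ker_supp])
  have "f \<bullet> rep (ker (Suc l) x (\<lambda>i. x $ i)) = f \<bullet> (rep (ker l x (\<lambda>i. x $ i)) + (\<Sum>\<gamma>\<in>\<Gamma>. weight (Suc l) x \<gamma> *\<^sub>R detail (Suc l) x \<gamma>))" for f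
  proof -
    have 1: "f \<bullet> rep (ker (Suc l) x (\<lambda>i. x $ i)) = (\<Sum>\<gamma>\<in>\<Gamma>. weight (Suc l) x \<gamma> * (f \<bullet> rep (node (Suc l) x \<gamma>)))"
    proof -
      have "f \<bullet> rep (ker (Suc l) x (\<lambda>i. x $ i)) = (\<integral>y. (\<Sum>\<gamma>\<in>\<Gamma>. weight (Suc l) x \<gamma> * (ev f y * node (Suc l) x \<gamma> y)) \<partial>lebesgue_on U)"
        unfolding rep_ker[OF x x_bound[OF x]] ker_eq_sum_node by (simp add: sum_distrib_left mult_ac)
      also have "\<dots> = (\<Sum>\<gamma>\<in>\<Gamma>. \<integral>y. weight (Suc l) x \<gamma> * (ev f y * node (Suc l) x \<gamma> y) \<partial>lebesgue_on U)"
        by (intro Bochner_Integration.integral_sum integrable_mult_right int)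
      also have "\<dots> = (\<Sum>\<gamma>\<in>\<Gamma>. weight (Suc l) x \<gamma> * (f \<bullet> rep (node (Suc l) x \<gamma>)))"
        using rep_node(1)[OF x, of _ "Suc l" "Suc l"] by (intro sum.cong) auto
      finally show ?thesis .
    qed
    have 2: "f \<bullet> rep (ker l x (\<lambda>i. x $ i)) = (\<Sum>\<gamma>\<in>\<Gamma>. weight (Suc l) x \<gamma> * (f \<bullet> rep (ker l x (pt (Suc l) x \<gamma>))))"
    proof -
      have "f \<bullet> rep (ker l x (\<lambda>i. x $ i)) = (\<integral>y. (\<Sum>\<gamma>\<in>\<Gamma>. weight (Suc l) x \<gamma> * (ev f y * ker l x (pt (Suc l) x \<gamma>) y)) \<partial>lebesgue_on U)"
        unfolding rep_ker[OF x x_bound[OF x]] ker_reproduces by (simp add: sum_distrib_left mult_ac)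
      also have "\<dots> = (\<Sum>\<gamma>\<in>\<Gamma>. \<integral>y. weight (Suc l) x \<gamma> * (ev f y * ker l x (pt (Suc l) x \<gamma>) y) \<partial>lebesgue_on U)"
        by (intro Bochner_Integration.integral_sum integrable_mult_right int')
      also have "\<dots> = (\<Sum>\<gamma>\<in>\<Gamma>. weight (Suc l) x \<gamma> * (f \<bullet> rep (ker l x (pt (Suc l) x \<gamma>))))"
        using rep_ker[OF x pt_bound[OF x]] by (intro sum.cong) auto
      finally show ?thesis .
    qed
    show ?thesis unfolding inner_add_right 1 2 inner_sum_right
      by (simp add: detail_def inner_diff_right right_diff_distrib sum_subtractf)
  qed
  then show ?thesis by (rule vector_eq_ldot[THEN iffD1, OF allI])
qed

definition s0 where "s0 = \<tau> - real CARD('d) / 2"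
text \<open>The decay exponent in powers of 2: \<open>t l\<close> is a multiple of 2^(-p l), so its
  power s0 decays like 2^(-s l).\<close>

definition s where "s = real p * s0"
text \<open>The pairing bound at mesh width \<open>t l\<close> is used for details of level
  \<open>Suc l\<close>; the factor 2^s corrects this index shift.\<close>

definition B1 where "B1 = real CARD('d) * pairing_const CARD('d) \<tau> lw Lw (2 * S) * K * (h0 / R) powr s0 * 2 powr s"

lemma s: "s \<ge> 2" using p by (simp add: s_def s0_def)

lemma t_powr: "t l powr s0 = (h0 / R) powr s0 * 2 powr (- s * real l)"
proof -
  have "\<theta> ^ l = 2 powr (- (real p * real l))"
    by (simp add: \<theta> power_divide powr_minus_divide powr_realpow[symmetric] powr_powr)
  then have "t l powr s0 = (h0 / R) powr s0 * (2 powr (- (real p * real l))) powr s0"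
    unfolding t_def using h0 R powr_mult[of "h0 / R" "2 powr (- (real p * real l))" s0] by simp
  then show ?thesis by (simp add: powr_powr s_def mult_ac)
qed

text \<open>The vector is tested with itself: its squared norm is a difference of two pairings with
  equal moments, hence at most a constant times its norm. The zero vector is separate because the
  pairing bound asks for a positive norm bound.\<close>

lemma norm_detail_Suc:
  assumes x: "x \<in> \<Omega>" and \<gamma>: "\<gamma> \<in> \<Gamma>"
  shows "norm (detail (Suc l) x \<gamma>) \<le> B1 * 2 powr (- s * real (Suc l))"
proof (cases "detail (Suc l) x \<gamma> = 0")
  case True
  have "lw \<le> Lw"
    using order_trans[OF side(1)[OF x, of 0 undefined] side(2)[OF x, of 0 undefined]] t(1)[of 0] by simp
  then have "B1 \<ge> 0" using K lw M_nonneg \<theta>01 unfolding B1_def pairing_const_def S_def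
    by (intro mult_nonneg_nonneg add_nonneg_nonneg divide_nonneg_nonneg) (auto simp: le_max_iff_disj)
  then show ?thesis using True by simp
next
  case False
  let ?v = "detail (Suc l) x \<gamma>"
  define E where "E = real CARD('d) * (pairing_const CARD('d) \<tau> lw Lw (2 * S) * t l powr s0 * (K * norm ?v))"
  have "?v \<bullet> ?v = (\<integral>y. ev ?v y * node (Suc l) x \<gamma> y \<partial>lebesgue_on U) - (\<integral>y. ev ?v y * ker l x (pt (Suc l) x \<gamma>) y \<partial>lebesgue_on U)"
    using rep_node(1)[OF x \<gamma>, of "Suc l" l ?v] rep_ker[OF x pt_bound[OF x \<gamma>], of ?v l]
    by (simp add: detail_def inner_diff_right)
  also have "\<dots> \<le> \<bar>\<dots>\<bar>" by (rule abs_ge_self)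
  also have "\<dots> \<le> E"
    unfolding node_def ker_def E_def s0_def
  proof (rule tensor_diff_pairing_bound[OF _ emb(1) emb(2) _ _ smooth1_psi node_supp[OF _ \<gamma>] node_bnd smooth1_kap ker_supp
        ker_bnd[OF pt_bound[OF x \<gamma>]] cbox_subset[OF x] side(1)[OF x] side(2)[OF x] lw t(1)])
    show "0 < K * norm ?v" using K False by simp
    show "\<tau> \<ge> 0" using \<tau> by (smt (verit) of_nat_0_le_iff zero_le_divide_iff)
    show "(\<integral>s. psi (t (Suc l)) (a (Suc l) x i + real (\<gamma> i)) s * s ^ j \<partial>lborel)
        = (\<integral>s. kap (t l) (a l x i) (pt (Suc l) x \<gamma> i) s * s ^ j \<partial>lborel)" if "j \<le> m" for i j
      by (simp add: psi_moment[OF t(1) that] kap_moment[OF t(1) that] pt_def)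
  qed auto
  finally have "?v \<bullet> ?v \<le> E" .
  moreover have "?v \<bullet> ?v = norm ?v * norm ?v" using power2_norm_eq_inner[of ?v] power2_eq_square[of "norm ?v"] by simp
  moreover define E' where "E' = real CARD('d) * (pairing_const CARD('d) \<tau> lw Lw (2 * S) * t l powr s0 * K)"
  have "E = norm ?v * E'" by (simp add: E_def E'_def)
  ultimately have "norm ?v * norm ?v \<le> norm ?v * E'" by simp
  moreover have "norm ?v > 0" using False by simp
  ultimately have "norm ?v \<le> E'" by (rule mult_left_le_imp_le)
  also have "\<dots> = real CARD('d) * (pairing_const CARD('d) \<tau> lw Lw (2 * S) * t l powr s0 * K)" by (simp add: E'_def)
  also have "\<dots> = B1 * 2 powr (- s * real (Suc l))"
  proof -
    have "2 powr (- s * real l) = 2 powr s * 2 powr (- s * real (Suc l))"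
      by (simp add: powr_add[symmetric] algebra_simps)
    then show ?thesis unfolding B1_def t_powr by (simp add: mult_ac)
  qed
  finally show ?thesis .
qed

definition B2 where "B2 = max (max B1 ((S * Lw) ^ CARD('d))) 1"

lemma norm_detail:
  assumes x: "x \<in> \<Omega>" and \<gamma>: "\<gamma> \<in> \<Gamma>"
  shows "norm (detail l x \<gamma>) \<le> B2 * 2 powr (- s * real l)"
proof (cases l)
  case 0
  have "norm (detail 0 x \<gamma>) \<le> (S * Lw) ^ CARD('d)"
    using rep_node(2)[OF x \<gamma>, of 0 0] by (simp add: detail_def)
  also have "\<dots> \<le> B2" by (simp add: B2_def)
  finally show ?thesis using 0 by simp
next
  case (Suc l')
  have "norm (detail l x \<gamma>) \<le> B1 * 2 powr (- s * real l)" using norm_detail_Suc[OF x \<gamma>, of l'] Suc by simp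
  also have "\<dots> \<le> B2 * 2 powr (- s * real l)" by (intro mult_right_mono) (auto simp: B2_def)
  finally show ?thesis .
qed

text \<open>\<open>A1\<close> bounds the sum of the absolute weights; with this factor each
  increment is an absolutely convex combination of vectors of the level.\<close>

definition level :: "nat \<Rightarrow> 'h set" where
  "level l = (\<lambda>(x, \<gamma>). A1 *\<^sub>R detail l x \<gamma>) ` (\<Omega> \<times> \<Gamma>)"

text \<open>A detail vector depends on \<open>x\<close> only through its chart and its grid cell, which makes every
  level finite.\<close>

definition detail_of_cell :: "nat \<Rightarrow> real^'d \<Rightarrow> ('d \<Rightarrow> int) \<Rightarrow> ('d \<Rightarrow> nat) \<Rightarrow> 'h" where
  "detail_of_cell l w c \<gamma> = (let node = rep (tensor (\<lambda>i. psi (t l) (base w c i + real (\<gamma> i)))) in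
     case l of 0 \<Rightarrow> node
     | Suc l' \<Rightarrow> node - rep (tensor (\<lambda>i. kap (t l') (base w (\<lambda>i. c i div 2 ^ p) i) (t l * (base w c i + real (\<gamma> i))))))"

lemma \<theta>_pow: "\<theta> * 2 ^ p = 1"
  by (simp add: \<theta>)

lemma t_eq: "t l = t (Suc l) * 2 ^ p" "t 0 = t l * 2 ^ (p * l)"
proof -
  show "t l = t (Suc l) * 2 ^ p"
    using \<theta>_pow unfolding t(2) by (metis mult.assoc mult.commute mult_1)
  have "\<theta> ^ l * 2 ^ (p * l) = 1"
    using \<theta>_pow unfolding power_mult power_mult_distrib[symmetric] by simp
  then show "t 0 = t l * 2 ^ (p * l)"
    unfolding t_def by (simp only: mult.assoc power_0 mult_1_right)
qed

text \<open>Grid cells of consecutive levels are nested since the mesh ratio is the reciprocal of an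
  integer. Hence the cell on the finer level determines the one on the coarser level, which a detail
  vector refers to as well.\<close>

lemma cell_div: "cell l x i = cell (Suc l) x i div 2 ^ p"
proof -
  have "x $ i / t l = (x $ i / t (Suc l)) / real_of_int (2 ^ p)"
    unfolding t_eq(1)[of l] by simp
  then have "cell l x i = \<lfloor>(x $ i / t (Suc l)) / real_of_int (2 ^ p)\<rfloor>" by (simp only: cell_def)
  also have "\<dots> = \<lfloor>x $ i / t (Suc l)\<rfloor> div 2 ^ p" by (rule floor_divide_real_eq_div) simp
  finally show ?thesis by (simp add: cell_def)
qed

lemma detail_eq_of_cell: "detail l x \<gamma> = detail_of_cell l (chart x) (cell l x) \<gamma>"
proof (cases l)
  case 0
  then show ?thesis by (simp add: detail_def detail_of_cell_def node_def a_def)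
next
  case (Suc l')
  have ce: "cell l' x = (\<lambda>i. cell (Suc l') x i div 2 ^ p)" using cell_div by blast
  then show ?thesis unfolding Suc detail_def detail_of_cell_def node_def ker_def pt_def a_def Let_def
    by (simp add: ce)
qed

definition N0 :: nat where "N0 = nat \<lceil>bb / t 0\<rceil>"

lemma cell_range:
  assumes x: "x \<in> \<Omega>"
  shows "cell l x i \<in> {- int (N0 * 2 ^ (p * l))..int (N0 * 2 ^ (p * l))}"
proof -
  have t0l: "t l = t 0 / 2 ^ (p * l)" using t_eq(2)[of l] by simp
  have "\<bar>x $ i / t l\<bar> = \<bar>x $ i\<bar> / t 0 * 2 ^ (p * l)" using t(1)[of 0] by (simp add: t0l abs_mult)
  also have "\<dots> \<le> real N0 * 2 ^ (p * l)"
  proof (rule mult_right_mono)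
    have "\<bar>x $ i\<bar> / t 0 \<le> bb / t 0" using bb[OF x] t(1)[of 0] by (intro divide_right_mono) auto
    also have "\<dots> \<le> real N0" unfolding N0_def by linarith
    finally show "\<bar>x $ i\<bar> / t 0 \<le> real N0" .
  qed simp
  finally have "\<bar>x $ i / t l\<bar> \<le> real_of_int (int (N0 * 2 ^ (p * l)))" by simp
  then have "- real_of_int (int (N0 * 2 ^ (p * l))) \<le> x $ i / t l" "x $ i / t l \<le> real_of_int (int (N0 * 2 ^ (p * l)))"
    by linarith+
  then have "real_of_int (- int (N0 * 2 ^ (p * l))) \<le> x $ i / t l" "\<lfloor>x $ i / t l\<rfloor> \<le> \<lfloor>real_of_int (int (N0 * 2 ^ (p * l)))\<rfloor>"
    by (simp only: of_int_minus, intro floor_mono)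
  then show ?thesis unfolding cell_def floor_of_int atLeastAtMost_iff le_floor_iff by (intro conjI)
qed

definition DD :: nat where "DD = card Dirs * (2 * N0 + 1) ^ CARD('d) * card \<Gamma>"

text \<open>Boundedness of \<Omega> leaves at most (2 N0 + 1) 2^(p l) cell indices per coordinate,
  so there are of order 2^(p d l) triples of direction, cell and node index.\<close>

lemma level_finite_card: "finite (level l)" "card (level l) \<le> DD * 2 ^ ((p * CARD('d)) * l)"
proof -
  define I where "I = {- int (N0 * 2 ^ (p * l))..int (N0 * 2 ^ (p * l))}"
  define Z where "Z = Dirs \<times> (PiE (UNIV :: 'd set) (\<lambda>_. I)) \<times> \<Gamma>"
  have fin: "finite Z" unfolding Z_def I_def using Dirs(1) finite_\<Gamma> by (intro finite_cartesian_product finite_PiE) auto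
  have sub: "level l \<subseteq> (\<lambda>(w, c, \<gamma>). A1 *\<^sub>R detail_of_cell l w c \<gamma>) ` Z"
  proof
    fix v assume "v \<in> level l"
    then obtain x \<gamma> where x: "x \<in> \<Omega>" "\<gamma> \<in> \<Gamma>" "v = A1 *\<^sub>R detail l x \<gamma>" by (auto simp: level_def)
    have "(chart x, cell l x, \<gamma>) \<in> Z" using Dirs(2)[OF x(1)] cell_range[OF x(1)] x(2) by (auto simp: Z_def I_def)
    then show "v \<in> (\<lambda>(w, c, \<gamma>). A1 *\<^sub>R detail_of_cell l w c \<gamma>) ` Z"
      unfolding x(3) detail_eq_of_cell by (intro image_eqI[of _ _ "(chart x, cell l x, \<gamma>)"]) auto
  qed
  then show "finite (level l)" using fin finite_subset by blast
  have "card (level l) \<le> card Z" using surj_card_le[OF fin sub] .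
  also have "card Z = card Dirs * ((card I) ^ CARD('d) * card \<Gamma>)"
    by (simp add: Z_def card_cartesian_product card_PiE)
  also have "card I \<le> (2 * N0 + 1) * 2 ^ (p * l)"
  proof -
    have "card I = nat (int (2 * (N0 * 2 ^ (p * l)) + 1))" by (simp add: I_def)
    also have "\<dots> = 2 * (N0 * 2 ^ (p * l)) + 1" by (rule nat_int)
    also have "\<dots> \<le> 2 * (N0 * 2 ^ (p * l)) + 2 ^ (p * l)" by simp
    finally show ?thesis by (simp add: algebra_simps)
  qed
  then have "card Dirs * ((card I) ^ CARD('d) * card \<Gamma>) \<le> card Dirs * (((2 * N0 + 1) * 2 ^ (p * l)) ^ CARD('d) * card \<Gamma>)"
    by (intro mult_le_mono power_mono) auto
  also have "((2 * N0 + 1) * 2 ^ (p * l)) ^ CARD('d) = (2 * N0 + 1) ^ CARD('d) * 2 ^ ((p * CARD('d)) * l)"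
    by (simp only: power_mult_distrib power_mult[symmetric] mult.assoc mult.commute[of l])
  also have "card Dirs * ((2 * N0 + 1) ^ CARD('d) * 2 ^ ((p * CARD('d)) * l) * card \<Gamma>) = DD * 2 ^ ((p * CARD('d)) * l)"
    unfolding DD_def by (simp only: mult_ac)
  finally show "card (level l) \<le> DD * 2 ^ ((p * CARD('d)) * l)" .
qed

lemma norm_level: "v \<in> level l \<Longrightarrow> norm v \<le> (2 * A1 * B2) * 2 powr (- s * real l)"
proof -
  assume "v \<in> level l"
  then obtain x \<gamma> where x: "x \<in> \<Omega>" "\<gamma> \<in> \<Gamma>" "v = A1 *\<^sub>R detail l x \<gamma>" by (auto simp: level_def)
  have B2: "B2 \<ge> 0" by (simp add: B2_def)
  have "norm v = A1 * norm (detail l x \<gamma>)" using A1_pos x(3) by simp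
  also have "\<dots> \<le> A1 * (B2 * 2 powr (- s * real l))" using norm_detail[OF x(1,2)] A1_pos by (intro mult_left_mono) auto
  also have "\<dots> \<le> (2 * A1 * B2) * 2 powr (- s * real l)" using A1_pos B2 by simp
  finally show ?thesis .
qed

definition incr :: "nat \<Rightarrow> real^'d \<Rightarrow> 'h" where
  "incr l x = (\<Sum>\<gamma>\<in>\<Gamma>. weight l x \<gamma> *\<^sub>R detail l x \<gamma>)"

lemma rep_ker_eq_sum: "x \<in> \<Omega> \<Longrightarrow> rep (ker l x (\<lambda>i. x $ i)) = (\<Sum>j<Suc l. incr j x)"
  by (induction l) (simp_all add: rep_ker_0 rep_ker_Suc incr_def)

lemma norm_incr:
  assumes x: "x \<in> \<Omega>"
  shows "norm (incr l x) \<le> A1 * B2 * 2 powr (- s * real l)"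
proof -
  have B2: "B2 \<ge> 0" by (simp add: B2_def)
  have "norm (incr l x) \<le> (\<Sum>\<gamma>\<in>\<Gamma>. \<bar>weight l x \<gamma>\<bar> * (B2 * 2 powr (- s * real l)))"
    unfolding incr_def using norm_detail[OF x] by (intro sum_norm_le) (auto intro!: mult_left_mono)
  also have "\<dots> \<le> A1 * (B2 * 2 powr (- s * real l))"
    unfolding sum_distrib_right[symmetric] using sum_abs_weight_le[OF x] B2 by (intro mult_right_mono) auto
  finally show ?thesis by (simp add: mult.assoc)
qed

lemma incr_absconv:
  assumes x: "x \<in> \<Omega>"
  shows "\<exists>C. (\<Sum>h\<in>level l. \<bar>C h\<bar>) \<le> 1 \<and> (\<Sum>h\<in>level l. C h *\<^sub>R h) = incr l x"
proof -
  have "(\<Sum>\<gamma>\<in>\<Gamma>. \<bar>weight l x \<gamma> / A1\<bar>) \<le> 1"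
    using sum_abs_weight_le[OF x, of l] A1_pos by (simp add: abs_divide sum_divide_distrib[symmetric])
  moreover have "(\<lambda>\<gamma>. A1 *\<^sub>R detail l x \<gamma>) ` \<Gamma> \<subseteq> level l" using x by (auto simp: level_def)
  ultimately have "\<exists>C. (\<Sum>h\<in>level l. \<bar>C h\<bar>) \<le> 1 \<and>
      (\<Sum>h\<in>level l. C h *\<^sub>R h) = (\<Sum>\<gamma>\<in>\<Gamma>. (weight l x \<gamma> / A1) *\<^sub>R (A1 *\<^sub>R detail l x \<gamma>))"
    by (intro sum_as_absconv[OF finite_\<Gamma> level_finite_card(1)])
  moreover have "(\<Sum>\<gamma>\<in>\<Gamma>. (weight l x \<gamma> / A1) *\<^sub>R (A1 *\<^sub>R detail l x \<gamma>)) = incr l x"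
    using A1_pos by (simp add: incr_def)
  ultimately show ?thesis by (simp only:)
qed

lemma ks: "kernel_space \<Omega> k ev" ..

text \<open>An approximate identity: the kernels have integral 1, by the moment of order 0, bounded
  L1 norms, and supports shrinking to x.\<close>

lemma rep_ker_tendsto:
  assumes x: "x \<in> \<Omega>"
  shows "(\<lambda>l. f \<bullet> rep (ker l x (\<lambda>i. x $ i))) \<longlonglongrightarrow> ev f x"
proof (rule LIMSEQ_I)
  fix e :: real assume e: "e > 0"
  define c where "c = (S * Lw) ^ CARD('d)"
  have c: "c \<ge> 0"
  proof -
    have "0 \<le> S" using M_nonneg \<theta>01 by (simp add: S_def le_max_iff_disj)
    moreover have "0 \<le> Lw" using R \<rho> W(2) by (simp add: Lw_def)
    ultimately show ?thesis by (simp add: c_def)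
  qed
  define e' where "e' = e / (c + 1)"
  have e': "e' > 0" "e' * c < e" using e c by (auto simp: e'_def field_simps)
  obtain \<delta> where \<delta>: "\<delta> > 0" "\<And>y. y \<in> \<Omega> \<Longrightarrow> dist y x < \<delta> \<Longrightarrow> \<bar>ev f y - ev f x\<bar> < e'"
    using continuous_on_ev[OF ks cont, of f] x e'(1) unfolding continuous_on_iff dist_real_def by blast
  define V where "V = (\<Sum>i\<in>(UNIV :: 'd set). \<bar>chart x $ i\<bar> + \<rho>)"
  have V: "V \<ge> 0" unfolding V_def using \<rho> by (intro sum_nonneg) auto
  have \<theta>1: "\<theta> < 1"
  proof -
    have "p \<noteq> 0" using p by (intro notI) simp
    then show ?thesis by (simp add: \<theta> one_less_power)
  qed
  have "(\<lambda>l. R * (h0 / R * \<theta> ^ l) * V) \<longlonglongrightarrow> R * (h0 / R * 0) * V"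
    using \<theta>01 \<theta>1 by (intro tendsto_intros LIMSEQ_power_zero) auto
  then have "(\<lambda>l. R * t l * V) \<longlonglongrightarrow> 0" by (simp add: t_def)
  then have "eventually (\<lambda>l. R * t l * V < \<delta>) sequentially" by (rule order_tendstoD(2)) (rule \<delta>(1))
  then obtain N where N: "\<And>l. l \<ge> N \<Longrightarrow> R * t l * V < \<delta>" unfolding eventually_sequentially by blast
  have "norm (f \<bullet> rep (ker l x (\<lambda>i. x $ i)) - ev f x) < e" if l: "l \<ge> N" for l
  proof -
    let ?C = "\<lambda>i. kap (t l) (a l x i) (x $ i)"
    have bnd: "\<bar>?C i s\<bar> \<le> S / t l" for i s by (rule ker_bnd[OF x_bound[OF x]])
    have cker: "continuous_on UNIV (tensor ?C)" by (rule continuous_on_tensor[OF smooth1_cont0[OF smooth1_kap]])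
    have int1: "integrable (lebesgue_on U) (\<lambda>y. ev f y * tensor ?C y)"
      by (rule integrable_mult_tensor[OF U_meas ev_sq smooth1_kap ker_supp])
    have one: "(\<integral>y. tensor ?C y \<partial>lebesgue_on U) = 1"
    proof -
      have "(\<integral>y. tensor ?C y \<partial>lebesgue_on U) = (\<integral>y. tensor ?C y \<partial>lborel)"
      proof (rule integral_lebesgue_on_eq_lborel[OF cker _ U_meas])
        show "tensor ?C y = 0" if "y \<notin> U" for y
          by (rule tensor_eq_0[of "lo l x" "hi l x", OF ker_supp]) (use cbox_subset[OF x] that in auto)
      qed
      also have "\<dots> = (\<Prod>i\<in>UNIV. \<integral>s. ?C i s \<partial>lborel)"
        by (rule integral_tensor) (use kap_integrable[OF t(1), of _ _ _ 0] in simp)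
      also have "\<dots> = 1" using kap_moment[OF t(1), of 0] by simp
      finally show ?thesis .
    qed
    \<comment> \<open>The integral of a function that is not integrable is 0 by convention, so the
      value 1 already proves integrability.\<close>
    have int2: "integrable (lebesgue_on U) (tensor ?C)"
      using one not_integrable_integral_eq[of "lebesgue_on U" "tensor ?C"] by (cases "integrable (lebesgue_on U) (tensor ?C)") simp_all
    have "f \<bullet> rep (ker l x (\<lambda>i. x $ i)) - ev f x = (\<integral>y. ev f y * tensor ?C y \<partial>lebesgue_on U) - (\<integral>y. ev f x * tensor ?C y \<partial>lebesgue_on U)"
      by (simp add: rep_ker[OF x x_bound[OF x]] one) (simp add: ker_def)
    also have "\<dots> = (\<integral>y. (ev f y - ev f x) * tensor ?C y \<partial>lebesgue_on U)"
      using int1 int2 by (subst Bochner_Integration.integral_diff[symmetric]) (auto simp: left_diff_distrib)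
    also have "\<bar>\<dots>\<bar> \<le> e' * (S * Lw) ^ CARD('d)"
    proof (rule abs_pairing_tensor_le[OF U_meas _ _ _ ker_supp cbox_subset[OF x] bnd lohi[OF x] side(2)[OF x] t(1)])
      show "integrable (lebesgue_on U) (\<lambda>y. (ev f y - ev f x) * tensor ?C y)"
        using int1 int2 by (simp add: left_diff_distrib)
      fix y assume y: "y \<in> cbox (lo l x) (hi l x)"
      have "y \<in> skew_box (chart x) \<theta> \<rho> (R * t l) x"
        using y by (auto simp: lo_def hi_def skew_box_def mem_box_cart)
      then have "norm (y - x) \<le> R * t l * V" unfolding V_def
        by (rule norm_skew_box) (use \<theta>01 R t(1)[of l] \<rho> in auto)
      then have "dist y x < \<delta>" using N[OF l] by (simp add: dist_norm)
      moreover have "y \<in> \<Omega>" using cbox_subset[OF x, of l] y interior_subset by blast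
      ultimately show "\<bar>ev f y - ev f x\<bar> \<le> e'" using \<delta>(2) by (simp add: less_imp_le)
    qed (use e' in simp)
    finally show ?thesis using e'(2) by (simp add: c_def)
  qed
  then show "\<exists>N. \<forall>l\<ge>N. norm (f \<bullet> rep (ker l x (\<lambda>i. x $ i)) - ev f x) < e" by blast
qed

text \<open>Only weak convergence of the expansion is known so far. Testing with the remainder g
  itself turns it into a norm estimate, the tail being geometric with ratio q \<le> 1/2.\<close>

lemma expansion_error:
  assumes x: "x \<in> \<Omega>"
  shows "norm (\<phi> x - (\<Sum>j<L. incr j x)) \<le> (2 * A1 * B2) * 2 powr (- s * real L)"
proof -
  define g where "g = \<phi> x - (\<Sum>j<L. incr j x)"
  define q where "q = 2 powr (- s)"
  have q: "0 < q" "q \<le> 1 / 2"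
  proof -
    have "q \<le> 2 powr (-1)" unfolding q_def using s by (intro powr_mono) auto
    then show "q \<le> 1 / 2" by (simp add: powr_minus_divide)
  qed (simp add: q_def)
  have qj: "2 powr (- s * real j) = q ^ j" for j by (simp add: q_def powr_power mult.commute)
  have c: "A1 * B2 \<ge> 0" using A1_pos by (simp add: B2_def)
  have geo: "(\<Sum>j\<in>{L..<L + n}. q ^ j) \<le> 2 * q ^ L - 2 * q ^ (L + n)" for n
  proof (induction n)
    case (Suc n)
    have "q ^ (L + n) * (2 * q) \<le> q ^ (L + n) * 1" using q by (intro mult_left_mono) auto
    then show ?case using Suc by (simp add: algebra_simps)
  qed simp
  have part: "g \<bullet> (\<Sum>j<L + n. incr j x) - g \<bullet> (\<Sum>j<L. incr j x) \<le> norm g * (2 * A1 * B2 * q ^ L)" for n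
  proof -
    have "{..<L + n} = {..<L} \<union> {L..<L + n}" by auto
    then have "(\<Sum>j<L + n. incr j x) = (\<Sum>j<L. incr j x) + (\<Sum>j\<in>{L..<L + n}. incr j x)"
      by (simp add: sum.union_disjoint ivl_disj_int)
    then have "g \<bullet> (\<Sum>j<L + n. incr j x) - g \<bullet> (\<Sum>j<L. incr j x) = g \<bullet> (\<Sum>j\<in>{L..<L + n}. incr j x)"
      by (simp add: inner_add_right)
    also have "\<dots> \<le> norm g * norm (\<Sum>j\<in>{L..<L + n}. incr j x)" by (rule norm_cauchy_schwarz)
    also have "\<dots> \<le> norm g * (A1 * B2 * (2 * q ^ L))"
    proof (rule mult_left_mono[OF _ norm_ge_zero])
    have "norm (\<Sum>j\<in>{L..<L + n}. incr j x) \<le> (\<Sum>j\<in>{L..<L + n}. A1 * B2 * q ^ j)"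
      using norm_incr[OF x] by (intro sum_norm_le) (simp only: qj)
    also have "\<dots> \<le> A1 * B2 * (2 * q ^ L)"
      unfolding sum_distrib_left[symmetric] using geo[of n] q c zero_less_power[OF q(1), of "L + n"] by (intro mult_left_mono) linarith+
      finally show "norm (\<Sum>j\<in>{L..<L + n}. incr j x) \<le> A1 * B2 * (2 * q ^ L)" .
    qed
    also have "norm g * (A1 * B2 * (2 * q ^ L)) = norm g * (2 * A1 * B2 * q ^ L)" by simp
    finally show ?thesis .
  qed
  have "(\<lambda>l. g \<bullet> (\<Sum>j<Suc l. incr j x)) \<longlonglongrightarrow> g \<bullet> \<phi> x"
    using rep_ker_tendsto[OF x, of g] by (simp only: rep_ker_eq_sum[OF x] kernel_section(2)[OF x])
  then have "(\<lambda>n. g \<bullet> (\<Sum>j<n. incr j x)) \<longlonglongrightarrow> g \<bullet> \<phi> x" by (rule LIMSEQ_imp_Suc)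
  then have "(\<lambda>n. g \<bullet> (\<Sum>j<n + L. incr j x)) \<longlonglongrightarrow> g \<bullet> \<phi> x" by (rule LIMSEQ_ignore_initial_segment)
  then have "(\<lambda>n. g \<bullet> (\<Sum>j<L + n. incr j x) - g \<bullet> (\<Sum>j<L. incr j x)) \<longlonglongrightarrow> g \<bullet> \<phi> x - g \<bullet> (\<Sum>j<L. incr j x)"
    by (intro tendsto_diff tendsto_const) (simp add: add.commute)
  then have "g \<bullet> \<phi> x - g \<bullet> (\<Sum>j<L. incr j x) \<le> norm g * (2 * A1 * B2 * q ^ L)"
    by (rule LIMSEQ_le_const2) (use part in blast)
  then have "norm g * norm g \<le> norm g * (2 * A1 * B2 * q ^ L)"
    unfolding inner_diff_right[symmetric] g_def[symmetric] power2_norm_eq_inner[of g, symmetric]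
      power2_eq_square[of "norm g"] .
  then have "norm g = 0 \<or> norm g \<le> 2 * A1 * B2 * q ^ L" by (auto simp: mult_le_cancel_left)
  moreover have "0 \<le> 2 * A1 * B2 * q ^ L" using c q by simp
  ultimately show ?thesis unfolding qj g_def[symmetric] by auto
qed

theorem entropy_co_kernel_sections: "\<exists>C>0. entropy_bound (co (\<phi> ` \<Omega>)) C (\<tau> / real CARD('d))"
proof -
  have p0: "p \<ge> 1"
  proof -
    have "p \<noteq> 0" using p by (intro notI) simp
    then show ?thesis by simp
  qed
  have B: "2 * A1 * B2 > 0" using A1_pos by (simp add: B2_def)
  have "\<exists>C>0. entropy_bound (co (\<phi> ` \<Omega>)) C ((s + real (p * CARD('d)) / 2) / real (p * CARD('d)))"
  proof (rule entropy_bound_multilevel[OF _ s B level_finite_card norm_level])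
    show "1 \<le> p * CARD('d)" using p0 by (simp add: Suc_le_eq)
    fix g assume "g \<in> \<phi> ` \<Omega>"
    then obtain x where x: "x \<in> \<Omega>" "g = \<phi> x" by blast
    have "\<forall>l. \<exists>C. (\<Sum>h\<in>level l. \<bar>C h\<bar>) \<le> 1 \<and> (\<Sum>h\<in>level l. C h *\<^sub>R h) = incr l x" using incr_absconv[OF x(1)] by blast
    from choice[OF this] obtain C where C: "\<And>l. (\<Sum>h\<in>level l. \<bar>C l h\<bar>) \<le> 1" "\<And>l. (\<Sum>h\<in>level l. C l h *\<^sub>R h) = incr l x" by blast
    show "\<exists>C. \<forall>l. (\<Sum>h\<in>level l. \<bar>C l h\<bar>) \<le> 1 \<and>
        norm (g - (\<Sum>j<l. \<Sum>h\<in>level j. C j h *\<^sub>R h)) \<le> 2 * A1 * B2 * 2 powr (- s * real l)"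
      using C(1) expansion_error[OF x(1)] by (intro exI[of _ C]) (simp add: C(2) x(2))
  qed
  moreover have "(s + real (p * CARD('d)) / 2) / real (p * CARD('d)) = \<tau> / real CARD('d)"
    using p0 by (simp add: s_def s0_def field_simps)
  ultimately show ?thesis by simp
qed

end

lemma ex_entropy_bound:
  fixes \<Omega> :: "(real^'d::finite) set" and ev :: "'h::{real_inner,complete_space} \<Rightarrow> real^'d \<Rightarrow> real"
  assumes ks: "kernel_space \<Omega> k ev" and bd: "bounded \<Omega>" and sb: "smooth_boundary \<Omega>"
    and cont: "continuous_kernel_on \<Omega> k" and \<tau>: "\<tau> > real CARD('d) / 2" and emb: "embedded_in_sobolev \<Omega> \<tau> ev"
  shows "\<exists>C>0. entropy_bound (co (kernel_section \<Omega> k ev ` \<Omega>)) C (\<tau> / real CARD('d))"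
proof -
  obtain \<psi> M where moll: "mollifier \<psi> (nat \<lfloor>\<tau>\<rfloor>) M" using ex_mollifier_locale by blast
  define s0 where "s0 = \<tau> - real CARD('d) / 2"
  have s0: "s0 > 0" using \<tau> by (simp add: s0_def)
  define p where "p = nat \<lceil>2 / s0\<rceil>"
  have "2 / s0 \<le> real p" unfolding p_def by linarith
  then have p: "real p * s0 \<ge> 2" using s0 by (simp add: field_simps)
  define \<theta> :: real where "\<theta> = 1 / 2 ^ p"
  obtain Dirs \<rho> h where D: "finite Dirs" "\<rho> > 0" "h > 0"
    "\<forall>x\<in>\<Omega>. \<exists>w\<in>Dirs. \<forall>t. 0 < t \<and> t \<le> h \<longrightarrow> skew_box w \<theta> \<rho> t x \<subseteq> interior \<Omega>"
    using uniform_skew_box[OF bd sb, of \<theta>] by (auto simp: \<theta>_def)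
  obtain chart where chart: "\<And>x. x \<in> \<Omega> \<Longrightarrow> chart x \<in> Dirs"
    "\<And>x t. x \<in> \<Omega> \<Longrightarrow> 0 < t \<Longrightarrow> t \<le> h \<Longrightarrow> skew_box (chart x) \<theta> \<rho> t x \<subseteq> interior \<Omega>"
  proof -
    from D(4) have "\<forall>x. \<exists>w. x \<in> \<Omega> \<longrightarrow> w \<in> Dirs \<and> (\<forall>t. 0 < t \<and> t \<le> h \<longrightarrow> skew_box w \<theta> \<rho> t x \<subseteq> interior \<Omega>)" by blast
    from choice[OF this] show thesis using that by blast
  qed
  obtain K where K: "\<And>f. sobolev_norm (interior \<Omega>) \<tau> (ev f) \<le> K * norm f"
    using emb by (auto simp: embedded_in_sobolev_def)
  \<comment> \<open>The embedding constant is raised to at least 1 because the locale asks for a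
    positive one.\<close>
  have K': "sobolev_norm (interior \<Omega>) \<tau> (ev f) \<le> max K 1 * norm f" for f
    using K[of f] mult_right_mono[of K "max K 1" "norm f"] by simp
  obtain bb where bb: "\<And>x. x \<in> \<Omega> \<Longrightarrow> norm x \<le> bb" using bd by (auto simp: bounded_iff)
  have W: "\<bar>w $ i\<bar> \<le> (\<Sum>w\<in>Dirs. norm w)" if "w \<in> Dirs" for w i
    using component_le_norm_cart[of w i] member_le_sum[of w Dirs norm] D(1) that by auto
  interpret sobolev_kernel \<Omega> k ev \<psi> \<tau> M "max K 1" \<theta> \<rho> h "\<Sum>w\<in>Dirs. norm w" bb p Dirs chart
  proof (intro sobolev_kernel.intro sobolev_kernel_axioms.intro ks moll cont \<tau> K' D chart W)
    show "ev f \<in> sobolev_space (interior \<Omega>) \<tau>" for f using emb by (auto simp: embedded_in_sobolev_def)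
    show "real p * (\<tau> - real CARD('d) / 2) \<ge> 2" using p by (simp add: s0_def)
    show "\<bar>x $ i\<bar> \<le> bb" if "x \<in> \<Omega>" for x i using bb[OF that] component_le_norm_cart[of x i] by linarith
  qed (auto simp: \<theta>_def intro: sum_nonneg)
  show ?thesis by (rule entropy_co_kernel_sections)
qed

theorem corollary12:
  fixes \<Omega> :: "(real^'d::finite) set"
    and k :: "real^'d \<Rightarrow> real^'d \<Rightarrow> real"
    and ev :: "'h::{real_inner,complete_space} \<Rightarrow> real^'d \<Rightarrow> real"
    and ev_cl :: "'g::{real_inner,complete_space} \<Rightarrow> real^'d \<Rightarrow> real"
    and E :: "'h \<Rightarrow> 'g"
    and \<tau> :: real
  assumes "bounded \<Omega>" and "lipschitz_boundary \<Omega>" and "smooth_boundary \<Omega>"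
    and "continuous_kernel_on \<Omega> k" and "strictly_positive_definite_on \<Omega> k"
    and "\<And>x. x \<in> \<Omega> \<Longrightarrow> k x x \<le> 1"
    and "rkhs \<Omega> k ev"
    and "continuous_kernel_on (closure \<Omega>) k" and "strictly_positive_definite_on (closure \<Omega>) k"
    and "rkhs (closure \<Omega>) k ev_cl"
    and "\<And>f x. x \<in> \<Omega> \<Longrightarrow> ev_cl (E f) x = ev f x"
    and "\<And>f. norm (E f) = norm f"
    and "\<tau> > real CARD('d) / 2"
    and "embedded_in_sobolev \<Omega> \<tau> ev"
  shows "(\<exists>C>0. entropy_bound (co (kernel_section \<Omega> k ev ` \<Omega>)) C (\<tau> / real CARD('d))) \<and>
    (\<forall>C>0. entropy_bound (co (kernel_section \<Omega> k ev ` \<Omega>)) C (\<tau> / real CARD('d)) \<longrightarrow>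
      (\<forall>(\<beta>::ennreal) \<gamma> f x. admissible \<Omega> \<gamma> \<and> weak_greedy \<Omega> k ev \<beta> \<gamma> f x \<longrightarrow>
        (let I = (\<lambda>i. interpolant \<Omega> k ev (points x i) f);
             b = enn2real \<beta>;
             c = (if \<beta> = \<infinity> then 1 else (C * sqrt 5) powr (1 / max 1 b));
             rate = (\<lambda>n::nat. if \<beta> = \<infinity> then real n powr (- 1 / 2)
                     else (real n powr (- \<tau> / real CARD('d) + (1 - b) / 2)) powr (1 / max 1 b))
         in \<forall>n\<ge>1. (MIN i\<in>{n+1..2*n}. Linf_norm \<Omega> (ev (f - I i)))
                   \<le> ereal (c * inverse \<gamma> * rate n * norm (f - I (n + 1))))))"
proof -
  have ks: "kernel_space \<Omega> k ev" using assms(5-7) by unfold_locales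
  show ?thesis
    unfolding Let_def
  proof (intro conjI allI impI, goal_cases)
    case 1
    show ?case by (rule ex_entropy_bound[OF ks assms(1,3,4,13,14)])
  next
    case (2 C \<beta> \<gamma> f x n)
    \<comment> \<open>The rate in the statement is read as (- \<tau>) / d, whereas the entropy bound
      contains the negative of \<tau> / d.\<close>
    have eq: "- \<tau> / real CARD('d) = - (\<tau> / real CARD('d))" by simp
    show ?case unfolding eq
      by (rule greedy_min_residual_le[OF ks assms(4)]) (use 2 in auto)
  qed
qed

end
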